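(* Let $X_1,X_2,\dots$ be real independent random variables such that $E(X_j)=0$, $E(X_j^2)=1$ for all $j$, and such that for some constant $\tau>0$, $$\sup_k E\big(|X_k|^3\exp(|X_k|/\tau)\big)\le\tau .$$ Let $(r_n)$ be a sequence of positive integers such that $$\frac{r_n^4}{n}\to0\quad\text{and}\quad\frac{\log n}{r_n}\to0\quad\text{as } n\to\infty .$$ Define $$S_{n,k}=\sqrt{\frac2n}\sum_{j=1}^n\cos\Big(\frac{2\pi jk}{n}\Big)X_j,\quad k=1,\dots,r_n,\qquad \mu_n=\frac1{r_n}\sum_{k=1}^{r_n}\delta_{S_{n,k}} .$$ Then for all open sets $G$ and all closed sets $F$ in $\mathcal M_1(\mathbb R)$, $$\liminf_{n\to\infty}\frac1{r_n}\ln\Pr(\mu_n\in G)\ge-\inf_{\nu\in G}I(\nu)$$ and $$\limsup_{n\to\infty}\frac1{r_n}\ln\Pr(\mu_n\in F)\le-\inf_{\nu\in F}I(\nu) .$$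
   Context: $\mathcal M_1(\mathbb R)$ is the Polish space of probability measures on the Borel sets of $\mathbb R$ with the topology of weak convergence; $\delta_a$ is the unit point mass at $a$, so $\mu_n$ is a random element of $\mathcal M_1(\mathbb R)$. The rate function $I:\mathcal M_1(\mathbb R)\to[0,\infty]$ is the relative entropy with respect to the standard normal law: with $\phi(x)=\frac1{\sqrt{2\pi}}e^{-x^2/2}$, $I(\nu)=\int\ln\frac{f(x)}{\phi(x)}\,f(x)\,dx$ if $\nu$ has a density $f$ with respect to Lebesgue measure and the expression is integrable, and $I(\nu)=\infty$ otherwise. *)

theory Defs
  imports "HOL-Probability.Probability"
begin

section \<open>Probability measures on the real line with the weak topology\<close>

text \<open>
  The coarsest topology on the set of all Borel probability measures on the real line for which
  \<open>\<nu> \<mapsto> \<integral> f d\<nu>\<close> is continuous for every bounded continuous \<open>f\<close>.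
\<close>

definition weak_topology :: "real measure topology" where
  "weak_topology = topology_generated_by
     {{\<nu> \<in> space (prob_algebra borel). (\<integral>x. f x \<partial>\<nu>) \<in> U} | (f :: real \<Rightarrow> real) U.
        continuous_on UNIV f \<and> bounded (range f) \<and> open U}"

lemma space_prob_algebra_borel:
  "space (prob_algebra borel) = {\<nu> :: real measure. sets \<nu> = sets borel \<and> prob_space \<nu>}"
  by (auto simp: space_prob_algebra)

lemma topspace_weak_topology: "topspace weak_topology = space (prob_algebra borel)"
  unfolding weak_topology_def topology_generated_by_topspace
  apply (intro equalityI subsetI)
   apply blast
  apply (rule UnionI[where X = "{\<nu> \<in> space (prob_algebra borel). (\<integral>x. (\<lambda>_. 0::real) x \<partial>\<nu>) \<in> UNIV}"])
   apply (rule CollectI, rule exI[of _ "\<lambda>_. 0::real"], rule exI[of _ "UNIV :: real set"])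
   apply auto
  done

lemma continuous_map_weak_topology_integral:
  fixes f :: "real \<Rightarrow> real"
  assumes "continuous_on UNIV f" "bounded (range f)"
  shows "continuous_map weak_topology euclideanreal (\<lambda>\<nu>. \<integral>x. f x \<partial>\<nu>)"
  unfolding continuous_map_def topspace_weak_topology
  using assms by (auto simp: weak_topology_def intro!: topology_generated_by_Basis)

lemma continuous_map_into_weak_topology:
  assumes "\<And>x. x \<in> topspace T \<Longrightarrow> m x \<in> space (prob_algebra borel)"
  assumes "\<And>f :: real \<Rightarrow> real. continuous_on UNIV f \<Longrightarrow> bounded (range f) \<Longrightarrow>
             continuous_map T euclideanreal (\<lambda>x. \<integral>y. f y \<partial>m x)"
  shows "continuous_map T weak_topology m"
  unfolding weak_topology_def
proof (rule continuous_on_generated_topo)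
  fix S assume "S \<in> {{\<nu> \<in> space (prob_algebra borel). (\<integral>x. f x \<partial>\<nu>) \<in> U} | (f :: real \<Rightarrow> real) U.
        continuous_on UNIV f \<and> bounded (range f) \<and> open U}"
  then obtain f :: "real \<Rightarrow> real" and U where
    S: "S = {\<nu> \<in> space (prob_algebra borel). (\<integral>x. f x \<partial>\<nu>) \<in> U}"
    and f: "continuous_on UNIV f" "bounded (range f)" and U: "open U" by blast
  have "m -` S \<inter> topspace T = {x \<in> topspace T. (\<integral>y. f y \<partial>m x) \<in> U}"
    using assms(1) S by auto
  moreover have "openin T {x \<in> topspace T. (\<integral>y. f y \<partial>m x) \<in> U}"
    using assms(2)[OF f] U by (auto simp: continuous_map_def)
  ultimately show "openin T (m -` S \<inter> topspace T)" by simp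
next
  show "m ` topspace T \<subseteq> \<Union> {{\<nu> \<in> space (prob_algebra borel). (\<integral>x. f x \<partial>\<nu>) \<in> U} | (f :: real \<Rightarrow> real) U.
        continuous_on UNIV f \<and> bounded (range f) \<and> open U}"
    using assms(1) topspace_weak_topology
    unfolding weak_topology_def topology_generated_by_topspace by blast
qed

text \<open>Convergent sequences are exactly those of the library's weak convergence.\<close>

lemma limitin_weak_topology_iff:
  assumes mu: "\<And>n. \<mu> n \<in> space (prob_algebra borel)" and nu: "\<nu> \<in> space (prob_algebra borel)"
  shows "limitin weak_topology \<mu> \<nu> sequentially \<longleftrightarrow> weak_conv_m \<mu> \<nu>"
proof -
  have rd: "real_distribution m" if "m \<in> space (prob_algebra borel)" for m :: "real measure"
    using that by (auto simp: space_prob_algebra real_distribution_def real_distribution_axioms_def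
        dest: sets_eq_imp_space_eq)
  note rdmu = rd[OF mu] and rdnu = rd[OF nu]
  show ?thesis
  proof
    assume lim: "limitin weak_topology \<mu> \<nu> sequentially"
    show "weak_conv_m \<mu> \<nu>"
    proof (rule integral_bdd_continuous_conv_imp_weak_conv[OF rdmu rdnu])
      fix f :: "real \<Rightarrow> real"
      assume f: "\<And>x. isCont f x" and b: "\<And>x. \<bar>f x\<bar> \<le> 1"
      have "continuous_map weak_topology euclideanreal (\<lambda>\<nu>. \<integral>x. f x \<partial>\<nu>)"
        using f b by (intro continuous_map_weak_topology_integral)
          (auto simp: bounded_iff continuous_on_eq_continuous_at)
      from continuous_map_limit[OF this lim]
      show "(\<lambda>n. integral\<^sup>L (\<mu> n) f) \<longlonglongrightarrow> integral\<^sup>L \<nu> f" by (simp add: comp_def)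
    qed
  next
    assume w: "weak_conv_m \<mu> \<nu>"
    have ev: "\<forall>\<^sub>F n in sequentially. \<mu> n \<in> W"
      if "openin weak_topology W" "\<nu> \<in> W" for W
    proof -
      have "generate_topology_on {{\<nu> \<in> space (prob_algebra borel). (\<integral>x. f x \<partial>\<nu>) \<in> U} | (f :: real \<Rightarrow> real) U.
        continuous_on UNIV f \<and> bounded (range f) \<and> open U} W"
        using that(1) unfolding weak_topology_def by (rule openin_topology_generated_by)
      then show ?thesis using that(2)
      proof (induction rule: generate_topology_on.induct)
        case Empty then show ?case by simp
      next
        case (Int a b) then show ?case by (auto intro: eventually_conj)
      next
        case (UN K)
        then obtain k where "k \<in> K" "\<nu> \<in> k" by blast
        then have "\<forall>\<^sub>F n in sequentially. \<mu> n \<in> k" using UN.IH by blast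
        then show ?case using \<open>k \<in> K\<close> by (auto elim: eventually_mono)
      next
        case (Basis s)
        then obtain f :: "real \<Rightarrow> real" and U where
          s: "s = {\<nu> \<in> space (prob_algebra borel). (\<integral>x. f x \<partial>\<nu>) \<in> U}"
          and f: "continuous_on UNIV f" "bounded (range f)" and U: "open U" by blast
        obtain B where B: "\<And>x. norm (f x) \<le> B" using f(2) by (auto simp: bounded_iff)
        have "(\<lambda>n. integral\<^sup>L (\<mu> n) f) \<longlonglongrightarrow> integral\<^sup>L \<nu> f"
          using f(1) B by (intro weak_conv_imp_integral_bdd_continuous_conv[OF rdmu rdnu w])
            (auto simp: continuous_on_eq_continuous_at)
        then have "\<forall>\<^sub>F n in sequentially. integral\<^sup>L (\<mu> n) f \<in> U"
          using U Basis s by (auto dest: topological_tendstoD)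
        then show ?case using s mu by (auto elim: eventually_mono)
      qed
    qed
    then show "limitin weak_topology \<mu> \<nu> sequentially"
      using nu by (auto simp: limitin_def topspace_weak_topology)
  qed
qed


section \<open>Empirical measures\<close>

definition empirical_measure :: "nat \<Rightarrow> (nat \<Rightarrow> real) \<Rightarrow> real measure" where
  "empirical_measure r s =
     measure_of UNIV (sets borel) (\<lambda>A. (\<Sum>k=1..r. emeasure (return borel (s k)) A) / of_nat r)"

lemma space_empirical_measure [simp]: "space (empirical_measure r s) = UNIV"
  by (simp add: empirical_measure_def space_measure_of_conv)

lemma sets_empirical_measure [simp, measurable_cong]: "sets (empirical_measure r s) = sets borel"
proof -
  have "sigma_sets UNIV (sets borel) = sets (borel :: real measure)"
    using sets.sigma_sets_eq[of "borel :: real measure"] by simp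
  then show ?thesis by (simp add: empirical_measure_def sets_measure_of_conv)
qed

lemma emeasure_empirical_measure:
  assumes "A \<in> sets borel"
  shows "emeasure (empirical_measure r s) A = (\<Sum>k=1..r. emeasure (return borel (s k)) A) / of_nat r"
proof (rule emeasure_measure_of[OF empirical_measure_def])
  show "countably_additive (sets (empirical_measure r s))
      (\<lambda>A. (\<Sum>k=1..r. emeasure (return borel (s k)) A) / of_nat r)"
  proof (rule countably_additiveI)
    fix A :: "nat \<Rightarrow> real set"
    assume A: "range A \<subseteq> sets (empirical_measure r s)" "disjoint_family A"
    have "(\<Sum>i. (\<Sum>k=1..r. emeasure (return borel (s k)) (A i)) / of_nat r)
        = (\<Sum>k=1..r. \<Sum>i. emeasure (return borel (s k)) (A i)) / of_nat r"
      by (simp add: divide_ennreal_def suminf_sum)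
    also have "\<dots> = (\<Sum>k=1..r. emeasure (return borel (s k)) (\<Union>i. A i)) / of_nat r"
      using A by (intro arg_cong2[where f="(/)"] sum.cong refl suminf_emeasure) auto
    finally show "(\<Sum>i. (\<Sum>k=1..r. emeasure (return borel (s k)) (A i)) / of_nat r)
        = (\<Sum>k=1..r. emeasure (return borel (s k)) (\<Union>i. A i)) / of_nat r" .
  qed
qed (use assms in \<open>auto simp: positive_def\<close>)

lemma empirical_measure_eq_distr:
  assumes "r > 0"
  shows "empirical_measure r s = distr (uniform_count_measure {1..r}) borel s"
proof (rule measure_eqI)
  fix A assume "A \<in> sets (empirical_measure r s)"
  then have A: "A \<in> sets borel" by simp
  have "(\<Sum>k=1..r. emeasure (return borel (s k)) A) = (\<Sum>k\<in>{1..r}. indicator (s -` A) k)"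
    using A by (intro sum.cong) (auto simp: indicator_def)
  also have "\<dots> = of_nat (card (s -` A \<inter> {1..r}))"
    by (simp add: indicator_def sum.If_cases Int_commute vimage_def)
  finally show "emeasure (empirical_measure r s) A
      = emeasure (distr (uniform_count_measure {1..r}) borel s) A"
    using A assms by (subst emeasure_distr)
      (auto simp: emeasure_empirical_measure space_uniform_count_measure emeasure_uniform_count_measure
        ennreal_of_nat_eq_real_of_nat divide_ennreal)
qed simp

lemma empirical_measure_in_space:
  assumes "r > 0"
  shows "empirical_measure r s \<in> space (prob_algebra borel)"
proof -
  have "prob_space (uniform_count_measure {1..r})"
    using assms by (intro prob_space_uniform_count_measure) auto
  then have "prob_space (empirical_measure r s)"
    unfolding empirical_measure_eq_distr[OF assms]
    by (rule prob_space.prob_space_distr) simp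
  then show ?thesis by (simp add: space_prob_algebra)
qed

lemma integral_empirical_measure:
  fixes f :: "real \<Rightarrow> real"
  assumes "r > 0" and [measurable]: "f \<in> borel_measurable borel"
  shows "(\<integral>x. f x \<partial>empirical_measure r s) = (\<Sum>k=1..r. f (s k)) / real r"
  using assms unfolding empirical_measure_eq_distr[OF assms(1)]
  by (subst integral_distr) (auto simp: uniform_count_measure_def lebesgue_integral_point_measure_finite sum_divide_distrib)

text \<open>Events of the form \<open>{\<mu> \<in> G}\<close> with \<open>G\<close> weakly open or closed are measurable.\<close>

lemma continuous_map_empirical_measure:
  assumes "r > 0"
  shows "continuous_map euclidean weak_topology (empirical_measure r)"
proof (rule continuous_map_into_weak_topology)
  fix f :: "real \<Rightarrow> real"
  assume f: "continuous_on UNIV f"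
  then have [measurable]: "f \<in> borel_measurable borel" by (rule borel_measurable_continuous_onI)
  have "continuous_on UNIV (\<lambda>s :: nat \<Rightarrow> real. (\<Sum>k=1..r. f (s k)) / real r)"
    using assms by (intro continuous_intros continuous_on_compose2[OF f]) auto
  then show "continuous_map euclidean euclideanreal (\<lambda>s. \<integral>y. f y \<partial>empirical_measure r s)"
    using assms by (simp add: integral_empirical_measure)
qed (rule empirical_measure_in_space[OF assms])

lemma sets_empirical_measure_event:
  assumes "r > 0" and [measurable]: "\<And>k. S k \<in> borel_measurable M"
    and G: "openin weak_topology G \<or> closedin weak_topology G"
  shows "{\<omega> \<in> space M. empirical_measure r (\<lambda>k. S k \<omega>) \<in> G} \<in> sets M"
proof -
  let ?P = "{s :: nat \<Rightarrow> real. empirical_measure r s \<in> G}"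
  have "open ?P \<or> closed ?P"
    using G openin_continuous_map_preimage[OF continuous_map_empirical_measure[OF assms(1)], of G]
      closedin_continuous_map_preimage[OF continuous_map_empirical_measure[OF assms(1)], of G] by auto
  then have [measurable]: "?P \<in> sets borel" by auto
  have [measurable]: "(\<lambda>\<omega> k. S k \<omega>) \<in> borel_measurable M"
    by (rule measurable_coordinatewise_then_product) simp
  have "(\<lambda>\<omega> k. S k \<omega>) -` ?P \<inter> space M \<in> sets M" by measurable
  also have "(\<lambda>\<omega> k. S k \<omega>) -` ?P \<inter> space M = {\<omega> \<in> space M. empirical_measure r (\<lambda>k. S k \<omega>) \<in> G}"
    by auto
  finally show ?thesis .
qed


section \<open>Relative entropy with respect to the standard normal law\<close>

text \<open>
  The convention \<open>0 \<cdot> ln 0 = 0\<close> holds automatically.  Densities are only unique almost everywhere;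
  lemma \<open>gauss_entropy_eq\<close> below shows that the value does not depend on the choice.
\<close>

definition finite_entropy_density :: "real measure \<Rightarrow> (real \<Rightarrow> real) \<Rightarrow> bool" where
  "finite_entropy_density \<nu> f \<longleftrightarrow>
     f \<in> borel_measurable borel \<and> (\<forall>x. 0 \<le> f x) \<and> \<nu> = density lborel (\<lambda>x. ennreal (f x)) \<and>
     integrable lborel (\<lambda>x. ln (f x / std_normal_density x) * f x)"

definition gauss_entropy :: "real measure \<Rightarrow> ereal" where
  "gauss_entropy \<nu> =
     (if \<exists>f. finite_entropy_density \<nu> f
      then ereal (THE c. \<exists>f. finite_entropy_density \<nu> f \<and>
                    c = (\<integral>x. ln (f x / std_normal_density x) * f x \<partial>lborel))
      else \<infinity>)"

lemma gauss_entropy_eq: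
  assumes "finite_entropy_density \<nu> f"
  shows "gauss_entropy \<nu> = ereal (\<integral>x. ln (f x / std_normal_density x) * f x \<partial>lborel)"
proof -
  have eq: "(\<integral>x. ln (g x / std_normal_density x) * g x \<partial>lborel)
      = (\<integral>x. ln (f x / std_normal_density x) * f x \<partial>lborel)"
    if g: "finite_entropy_density \<nu> g" for g
  proof -
    have [measurable]: "f \<in> borel_measurable borel" "g \<in> borel_measurable borel"
      and nn: "\<And>x. 0 \<le> f x" "\<And>x. 0 \<le> g x"
      and d: "density lborel (\<lambda>x. ennreal (g x)) = density lborel (\<lambda>x. ennreal (f x))"
      using assms g by (auto simp: finite_entropy_density_def)
    have "AE x in lborel. ennreal (g x) = ennreal (f x)"
      using d by (intro sigma_finite_measure.density_unique[OF sigma_finite_lborel]) auto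
    then have "AE x in lborel. g x = f x" using nn by simp
    then show ?thesis by (intro integral_cong_AE) auto
  qed
  then have "(THE c. \<exists>f. finite_entropy_density \<nu> f \<and>
        c = (\<integral>x. ln (f x / std_normal_density x) * f x \<partial>lborel))
      = (\<integral>x. ln (f x / std_normal_density x) * f x \<partial>lborel)"
    using assms by (intro the_equality) blast+
  then show ?thesis using assms by (auto simp: gauss_entropy_def)
qed

lemma gauss_entropy_eq_infinity:
  "(\<And>f. \<not> finite_entropy_density \<nu> f) \<Longrightarrow> gauss_entropy \<nu> = \<infinity>"
  by (auto simp: gauss_entropy_def)

lemma gauss_entropy_nonneg:
  assumes "\<nu> \<in> space (prob_algebra borel)"
  shows "0 \<le> gauss_entropy \<nu>"
proof (cases "\<exists>f. finite_entropy_density \<nu> f")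
  case False then show ?thesis by (simp add: gauss_entropy_def)
next
  case True
  then obtain f where f: "finite_entropy_density \<nu> f" by blast
  then have [measurable]: "f \<in> borel_measurable borel" and nn: "\<And>x. 0 \<le> f x"
    and nu: "\<nu> = density lborel (\<lambda>x. ennreal (f x))"
    and int: "integrable lborel (\<lambda>x. ln (f x / std_normal_density x) * f x)"
    by (auto simp: finite_entropy_density_def)
  have pos: "0 < std_normal_density x" for x by (rule normal_density_pos) simp
  have f_int: "integrable lborel f" "(\<integral>x. f x \<partial>lborel) = 1"
  proof -
    have "prob_space \<nu>" using assms by (simp add: space_prob_algebra)
    then have "emeasure \<nu> (space \<nu>) = 1" by (rule prob_space.emeasure_space_1)
    then have "(\<integral>\<^sup>+x. ennreal (f x) \<partial>lborel) = 1" by (simp add: nu emeasure_density)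
    then have nni: "(\<integral>\<^sup>+x. ennreal (f x) \<partial>lborel) = ennreal 1" by simp
    show "integrable lborel f"
      by (rule integrableI_nn_integral_finite[OF _ _ nni]) (use nn in simp_all)
    show "(\<integral>x. f x \<partial>lborel) = 1"
      by (subst integral_eq_nn_integral) (use nn nni in simp_all)
  qed
  have g_int: "integrable lborel std_normal_density" "(\<integral>x. std_normal_density x \<partial>lborel) = 1"
    by (auto intro: integrable_normal_density integral_normal_density)
  have "f x - std_normal_density x \<le> ln (f x / std_normal_density x) * f x" for x
  proof (cases "f x = 0")
    case True then show ?thesis using pos[of x] by simp
  next
    case False
    with nn[of x] have fx: "0 < f x" by simp
    have "ln (std_normal_density x / f x) \<le> std_normal_density x / f x - 1"
      using fx pos[of x] by (intro ln_le_minus_one) simp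
    then have "1 - std_normal_density x / f x \<le> ln (f x / std_normal_density x)"
      using fx pos[of x] by (simp add: ln_div)
    then have "(1 - std_normal_density x / f x) * f x \<le> ln (f x / std_normal_density x) * f x"
      using fx by (intro mult_right_mono) auto
    moreover have "(1 - std_normal_density x / f x) * f x = f x - std_normal_density x"
      using fx by (simp add: left_diff_distrib)
    ultimately show ?thesis by simp
  qed
  then have "(\<integral>x. f x - std_normal_density x \<partial>lborel)
      \<le> (\<integral>x. ln (f x / std_normal_density x) * f x \<partial>lborel)"
    using f_int g_int int by (intro integral_mono) auto
  then show ?thesis using f_int g_int gauss_entropy_eq[OF f] by simp
qed


section \<open>Logarithms of probabilities and the cosine transform\<close>

text \<open>On reals \<^term>\<open>ln 0 = (0::real)\<close>; for large deviations \<open>ln 0\<close> has to be \<open>- \<infinity>\<close>.\<close>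

definition ln_prob :: "real \<Rightarrow> ereal" where
  "ln_prob p = (if p = 0 then - \<infinity> else ereal (ln p))"

definition cosine_sum :: "(nat \<Rightarrow> 'a \<Rightarrow> real) \<Rightarrow> nat \<Rightarrow> nat \<Rightarrow> 'a \<Rightarrow> real" where
  "cosine_sum X n k \<omega> =
     sqrt (2 / real n) * (\<Sum>j=1..n. cos (2 * pi * real j * real k / real n) * X j \<omega>)"

end

theory Submission
  imports Defs
begin

text \<open>
  The vector \<open>(S\<^sub>n\<^sub>,\<^sub>1, \<dots>, S\<^sub>n\<^sub>,\<^sub>r)\<close> is a sum of \<open>n\<close> independent vectors \<open>X\<^sub>j v\<^sub>j\<close>, where \<open>v\<^sub>j\<close> has entries
  \<open>sqrt (2 / n) cos (2 \<pi> j k / n)\<close>, and by the orthogonality of the cosines its covariance matrix is the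
  identity.  The proof shows that the exponential moments
  \<open>E (exp (\<Sum>k\<le>r. f (S\<^sub>n\<^sub>,\<^sub>k)))\<close> behave as if the \<open>S\<^sub>n\<^sub>,\<^sub>k\<close> were independent standard normal variables, namely like
  \<open>exp (r \<Lambda> f + o(r))\<close> with \<open>\<Lambda> f = ln (\<integral> exp f d\<gamma>)\<close> and \<open>\<gamma>\<close> the standard normal law, and it derives the large
  deviation principle from these moments alone.

  The exponential moments come from Lindeberg's method, which replaces the \<open>X\<^sub>j\<close> one after another by standard
  normal variables.  If \<open>f\<close> has three bounded derivatives, then along the line in direction \<open>v\<^sub>j\<close> the exponent
  \<open>\<Sum> f\<close> has derivatives bounded by \<open>\<kappa>\<close>, \<open>\<kappa>\<^sup>2\<close>, \<open>\<kappa>\<^sup>3\<close> with \<open>\<kappa> = O(r / sqrt n)\<close>.  The first two moments of \<open>X\<^sub>j\<close> are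
  those of the normal law, so that one replacement changes the expectation by a factor \<open>1 + O(\<kappa>\<^sup>3)\<close>, uniformly in \<open>j\<close>
  by the bound on \<open>E (\<bar>X\<^sub>j\<bar>\<^sup>3 exp (\<bar>X\<^sub>j\<bar> / \<tau>))\<close>.  All replacements together cost \<open>exp (O(r\<^sup>3 / sqrt n))\<close>, which is
  \<open>exp (o(r))\<close> precisely because \<open>r\<^sup>4 / n\<close> tends to \<open>0\<close> (\<open>exp_cosine_sum_asymptotics\<close>).  After the replacement the
  moments are exact: a Gaussian average is invariant under rotations, and Givens rotations bring any
  system with Gram matrix equal to the identity into the standard form (\<open>normal_avgs_orthonormal\<close>).

  For the upper bound, Chernoff's inequality gives the half space \<open>{\<nu>. \<integral> f d\<nu> \<ge> \<Lambda> f + a}\<close> a probability of at most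
  \<open>exp (- r a + o(r))\<close>.  The duality of entropy and exponential moments (\<open>gauss_entropy_le\<close>) puts every \<open>\<nu>\<close> with
  entropy greater than \<open>a\<close> into such an open half space, with \<open>f\<close> from a countable family.  The functional
  \<open>\<integral> ln cosh d\<nu>\<close> has exponential moments of the same kind and confines the empirical measures to a sequentially
  compact set, up to a negligible probability; as the family is countable, finitely many half spaces cover what
  lies in it (\<open>tilted_upper_bound\<close>).

  For the lower bound, the law is tilted by \<open>exp (\<Sum>k\<le>r. f (S\<^sub>n\<^sub>,\<^sub>k))\<close>.  The same upper bound under the tilted law makes the
  empirical measure concentrate at the law with density proportional to \<open>exp f\<close> with respect to \<open>\<gamma>\<close>, and undoing
  the tilt costs the entropy of that law (\<open>tilted_lower_tanh_sum\<close>).  Bounded pointwise limits carry the bound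
  from the countable family to all bounded Borel \<open>f\<close>, and truncation of \<open>ln g\<close> carries it to every density \<open>g\<close> of
  finite entropy (\<open>lower_rate_entropy\<close>).  The condition \<open>log n / r \<longrightarrow> 0\<close> serves to make \<open>r\<close> tend to infinity.
\<close>

section \<open>Averages along lines\<close>

text \<open>The values are extended nonnegative reals so that, by Tonelli's theorem, any two of these partial
  expectations commute without integrability conditions.\<close>

definition line_avg :: "real measure \<Rightarrow> (nat \<Rightarrow> real) \<Rightarrow> ((nat \<Rightarrow> real) \<Rightarrow> ennreal) \<Rightarrow> (nat \<Rightarrow> real) \<Rightarrow> ennreal"
  where "line_avg \<rho> v F w = (\<integral>\<^sup>+y. F (\<lambda>k. w k + y * v k) \<partial>\<rho>)"

definition line_avgs :: "(real measure \<times> (nat \<Rightarrow> real)) list \<Rightarrow> ((nat \<Rightarrow> real) \<Rightarrow> ennreal) \<Rightarrow> (nat \<Rightarrow> real) \<Rightarrow> ennreal"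
  where "line_avgs = foldr (\<lambda>(\<rho>, v). line_avg \<rho> v)"

lemma line_avgs_Nil [simp]: "line_avgs [] F = F"
  and line_avgs_Cons [simp]: "line_avgs ((\<rho>, v) # ps) F = line_avg \<rho> v (line_avgs ps F)"
  and line_avgs_append: "line_avgs (ps @ qs) F = line_avgs ps (line_avgs qs F)"
  by (auto simp: line_avgs_def)

lemma measurable_line [measurable]:
  assumes [measurable]: "f \<in> borel_measurable N" "g \<in> N \<rightarrow>\<^sub>M borel"
  shows "(\<lambda>x. (\<lambda>k. g x k + f x * v k) :: nat \<Rightarrow> real) \<in> N \<rightarrow>\<^sub>M borel"
proof (rule measurable_coordinatewise_then_product)
  fix k
  have "(\<lambda>w::nat \<Rightarrow> real. w k) \<in> borel_measurable borel"
    by (rule measurable_product_coordinates)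
  from measurable_compose[OF assms(2) this] have [measurable]: "(\<lambda>x. g x k) \<in> borel_measurable N" .
  show "(\<lambda>x. g x k + f x * v k) \<in> borel_measurable N" by measurable
qed

abbreviation (input) line_measures :: "(real measure \<times> (nat \<Rightarrow> real)) list \<Rightarrow> bool"
  where "line_measures ps \<equiv> \<forall>p\<in>set ps. fst p \<in> space (prob_algebra borel)"

lemma real_distribution_prob_algebra:
  "\<rho> \<in> space (prob_algebra borel) \<longleftrightarrow> real_distribution \<rho>"
  by (auto simp: space_prob_algebra real_distribution_def real_distribution_axioms_def
      dest: sets_eq_imp_space_eq)

lemma measurable_line_avg:
  assumes "\<rho> \<in> space (prob_algebra borel)" and [measurable]: "F \<in> borel_measurable borel"
  shows "line_avg \<rho> v F \<in> borel_measurable borel"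
proof -
  interpret real_distribution \<rho> using assms(1) by (simp add: real_distribution_prob_algebra)
  show ?thesis unfolding line_avg_def by measurable
qed

lemma measurable_line_avgs:
  "line_measures ps \<Longrightarrow> F \<in> borel_measurable borel \<Longrightarrow> line_avgs ps F \<in> borel_measurable borel"
  by (induction ps) (auto intro!: measurable_line_avg)

lemma line_avg_mono: "(\<And>w. F w \<le> G w) \<Longrightarrow> line_avg \<rho> v F w \<le> line_avg \<rho> v G w"
  unfolding line_avg_def by (intro nn_integral_mono)

lemma line_avgs_mono: "(\<And>w. F w \<le> G w) \<Longrightarrow> line_avgs ps F w \<le> line_avgs ps G w"
  by (induction ps arbitrary: w) (auto intro!: line_avg_mono)

lemma line_avg_cmult:
  assumes "\<rho> \<in> space (prob_algebra borel)" and [measurable]: "F \<in> borel_measurable borel"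
  shows "line_avg \<rho> v (\<lambda>w. c * F w) = (\<lambda>w. c * line_avg \<rho> v F w)"
proof -
  interpret real_distribution \<rho> using assms(1) by (simp add: real_distribution_prob_algebra)
  show ?thesis unfolding line_avg_def by (intro ext nn_integral_cmult) measurable
qed

lemma line_avgs_cmult:
  "line_measures ps \<Longrightarrow> F \<in> borel_measurable borel \<Longrightarrow>
    line_avgs ps (\<lambda>w. c * F w) = (\<lambda>w. c * line_avgs ps F w)"
  by (induction ps) (auto simp: line_avg_cmult measurable_line_avgs)

lemma line_avg_commute:
  assumes "\<rho> \<in> space (prob_algebra borel)" "\<sigma> \<in> space (prob_algebra borel)"
    and [measurable]: "F \<in> borel_measurable borel"
  shows "line_avg \<rho> u (line_avg \<sigma> v F) = line_avg \<sigma> v (line_avg \<rho> u F)"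
proof
  fix w
  interpret R: real_distribution \<rho> using assms(1) by (simp add: real_distribution_prob_algebra)
  interpret S: real_distribution \<sigma> using assms(2) by (simp add: real_distribution_prob_algebra)
  interpret pair_sigma_finite \<sigma> \<rho> ..
  have "(\<lambda>p. (\<lambda>k. (w k + snd p * u k) + fst p * v k)) \<in> \<sigma> \<Otimes>\<^sub>M \<rho> \<rightarrow>\<^sub>M (borel :: (nat \<Rightarrow> real) measure)"
    by (intro measurable_line) measurable
  then have "case_prod (\<lambda>y z. F (\<lambda>k. w k + z * u k + y * v k)) \<in> borel_measurable (\<sigma> \<Otimes>\<^sub>M \<rho>)"
    unfolding case_prod_beta by (rule measurable_compose) measurable
  from Fubini'[OF this]
  show "line_avg \<rho> u (line_avg \<sigma> v F) w = line_avg \<sigma> v (line_avg \<rho> u F) w"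
    unfolding line_avg_def by (simp add: algebra_simps)
qed

lemma line_avg_line_avgs_commute:
  assumes "\<rho> \<in> space (prob_algebra borel)" "line_measures ps" "F \<in> borel_measurable borel"
  shows "line_avg \<rho> v (line_avgs ps F) = line_avgs ps (line_avg \<rho> v F)"
  using assms(2)
proof (induction ps)
  case (Cons p ps)
  obtain \<sigma> u where p: "p = (\<sigma>, u)" by (cases p)
  with Cons show ?case using assms
    by (simp add: line_avg_commute[OF assms(1)] measurable_line_avgs)
qed simp

text \<open>The Lindeberg exchange.  Because the operators commute, each replacement can be made next to the
  original function \<open>F\<close>; so the comparison is required for \<open>F\<close> only, not for its averages.\<close>

lemma line_avgs_exchange:
  assumes "line_measures ps" "line_measures qs" and F: "F \<in> borel_measurable borel"
    and "list_all2 (\<lambda>p q. \<forall>w. line_avg (fst p) (snd p) F w \<le> c * line_avg (fst q) (snd q) F w) ps qs"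
  shows "line_avgs ps F w \<le> c ^ length ps * line_avgs qs F w"
  using assms(4,1,2)
proof (induction ps qs arbitrary: w rule: list_all2_induct)
  case (Cons p ps q qs)
  obtain \<rho> u where p: "p = (\<rho>, u)" by (cases p)
  obtain \<sigma> v where q: "q = (\<sigma>, v)" by (cases q)
  note F = measurable_line_avgs measurable_line_avg F
  have "line_avgs (p # ps) F w \<le> line_avg \<rho> u (\<lambda>w. c ^ length ps * line_avgs qs F w) w"
    using Cons unfolding p line_avgs_Cons by (intro line_avg_mono) auto
  also have "\<dots> = c ^ length ps * line_avgs qs (line_avg \<rho> u F) w"
    using Cons.prems F by (simp add: p line_avg_cmult line_avg_line_avgs_commute)
  also have "\<dots> \<le> c ^ length ps * line_avgs qs (\<lambda>w. c * line_avg \<sigma> v F w) w"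
    using Cons.hyps by (intro mult_left_mono line_avgs_mono) (auto simp: p q)
  also have "\<dots> = c ^ length (p # ps) * line_avgs (q # qs) F w"
    using Cons.prems F by (simp add: q line_avgs_cmult line_avg_line_avgs_commute mult_ac)
  finally show ?case .
qed simp

text \<open>The last summand is independent of the sum of the others, so it can be integrated first, inside.\<close>

lemma (in prob_space) indep_line_avgs:
  assumes "indep_vars (\<lambda>_. borel) X {1..m}" and [measurable]: "F \<in> borel_measurable borel"
  shows "(\<integral>\<^sup>+\<omega>. F (\<lambda>k. \<Sum>j=1..m. X j \<omega> * v j k) \<partial>M)
    = line_avgs (map (\<lambda>j. (distr M borel (X j), v j)) [1..<Suc m]) F (\<lambda>_. 0)"
  using assms
proof (induction m arbitrary: F)
  case 0 then show ?case by (simp add: emeasure_space_1)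
next
  case (Suc m)
  note [measurable] = Suc.prems(2)
  let ?W = "\<lambda>\<omega> k. \<Sum>j=1..m. X j \<omega> * v j k"
  \<comment> \<open>\<open>indep_var\<close> relates two variables with values in the same type, hence the constant sequence\<close>
  let ?V = "\<lambda>\<omega> (_::nat). X (Suc m) \<omega>"
  let ?\<rho> = "distr M borel (X (Suc m))"
  have ind: "indep_vars (\<lambda>_. borel) X {1..m}"
    using Suc.prems(1) by (rule indep_vars_subset) auto
  have [measurable]: "X (Suc m) \<in> borel_measurable M"
    using Suc.prems(1) by (auto simp: indep_vars_def)
  have "indep_vars (\<lambda>_. borel) X (insert (Suc m) {1..m})"
    using Suc.prems(1) by (rule indep_vars_subset) auto
  then have "indep_var
    borel ((\<lambda>f (_::nat). f (Suc m)) \<circ> (\<lambda>\<omega>. restrict (\<lambda>i. X i \<omega>) {Suc m}))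
    borel ((\<lambda>f k. \<Sum>j\<in>{1..m}. f j * v j k) \<circ> (\<lambda>\<omega>. restrict (\<lambda>i. X i \<omega>) {1..m}))"
    by (intro indep_var_compose[OF indep_var_restrict] measurable_coordinatewise_then_product) auto
  also have "(\<lambda>f (_::nat). f (Suc m)) \<circ> (\<lambda>\<omega>. restrict (\<lambda>i. X i \<omega>) {Suc m}) = ?V" by auto
  also have "(\<lambda>f k. \<Sum>j\<in>{1..m}. f j * v j k) \<circ> (\<lambda>\<omega>. restrict (\<lambda>i. X i \<omega>) {1..m}) = ?W"
    by (auto intro!: ext sum.cong)
  finally have iv: "indep_var borel ?V borel ?W" .
  then have [measurable]: "?V \<in> borel_measurable M" "?W \<in> borel_measurable M"
    and D: "distr M (borel \<Otimes>\<^sub>M borel) (\<lambda>x. (?V x, ?W x)) = distr M borel ?V \<Otimes>\<^sub>M distr M borel ?W"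
    by (auto simp: indep_var_distribution_eq)
  have VW: "(\<lambda>x. (?V x, ?W x)) \<in> M \<rightarrow>\<^sub>M borel \<Otimes>\<^sub>M borel"
    by (rule measurable_Pair) fact+
  interpret V: prob_space "distr M borel ?V" by (rule prob_space_distr) measurable
  interpret W: prob_space "distr M borel ?W" by (rule prob_space_distr) measurable
  interpret R: prob_space ?\<rho> by (rule prob_space_distr) measurable
  interpret pair_sigma_finite "distr M borel ?V" "distr M borel ?W" ..
  have rho: "?\<rho> \<in> space (prob_algebra borel)" by (simp add: space_prob_algebra R.prob_space_axioms)
  have coord: "(\<lambda>w::nat \<Rightarrow> real. w 0) \<in> borel_measurable borel"
    by (rule measurable_product_coordinates)
  have "(\<lambda>p. (\<lambda>k. snd p k + fst p (0::nat) * v (Suc m) k)) \<in> borel \<Otimes>\<^sub>M borel \<rightarrow>\<^sub>M (borel :: (nat \<Rightarrow> real) measure)"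
    by (rule measurable_line[where f="\<lambda>p. fst p (0::nat)" and g=snd])
      (rule measurable_compose[OF measurable_fst coord], rule measurable_snd)
  then have FM: "(\<lambda>p. F (\<lambda>k. snd p k + fst p (0::nat) * v (Suc m) k)) \<in> borel_measurable (borel \<Otimes>\<^sub>M borel)"
    by (rule measurable_compose) measurable
  have lin: "(\<lambda>x. F (\<lambda>k. w k + x * v (Suc m) k)) \<in> borel_measurable borel" for w
    by (rule measurable_compose[OF measurable_line]) auto
  have lin0: "(\<lambda>x. F (\<lambda>k. w k + x (0::nat) * v (Suc m) k)) \<in> borel_measurable borel" for w
    by (rule measurable_compose[OF coord lin])
  have inner: "(\<integral>\<^sup>+x. F (\<lambda>k. w k + x (0::nat) * v (Suc m) k) \<partial>distr M borel ?V) = line_avg ?\<rho> (v (Suc m)) F w" for w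
    unfolding line_avg_def using lin lin0 by (simp add: nn_integral_distr)
  have "(\<integral>\<^sup>+\<omega>. F (\<lambda>k. \<Sum>j=1..Suc m. X j \<omega> * v j k) \<partial>M)
      = (\<integral>\<^sup>+p. F (\<lambda>k. snd p k + fst p (0::nat) * v (Suc m) k) \<partial>(distr M borel ?V \<Otimes>\<^sub>M distr M borel ?W))"
    unfolding D[symmetric] by (subst nn_integral_distr[OF VW]) (use FM in simp_all)
  also have "\<dots> = (\<integral>\<^sup>+w. \<integral>\<^sup>+x. F (\<lambda>k. w k + x (0::nat) * v (Suc m) k) \<partial>distr M borel ?V \<partial>distr M borel ?W)"
    using FM by (subst nn_integral_snd[symmetric]) (auto simp: case_prod_beta cong: measurable_cong_sets)
  also have "\<dots> = (\<integral>\<^sup>+\<omega>. line_avg ?\<rho> (v (Suc m)) F (?W \<omega>) \<partial>M)"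
  proof -
    have "line_avg ?\<rho> (v (Suc m)) F \<in> borel_measurable borel"
      by (intro measurable_line_avg rho Suc.prems)
    then show ?thesis unfolding inner by (subst nn_integral_distr[OF \<open>?W \<in> borel_measurable M\<close>]) simp_all
  qed
  also have "\<dots> = line_avgs (map (\<lambda>j. (distr M borel (X j), v j)) [1..<Suc m])
      (line_avg ?\<rho> (v (Suc m)) F) (\<lambda>_. 0)"
    using rho ind by (intro Suc.IH measurable_line_avg) auto
  finally show ?case by (simp add: line_avgs_append)
qed

section \<open>Rotations of Gaussian averages\<close>

lemma std_normal_in_space: "std_normal_distribution \<in> space (prob_algebra borel)"
  using real_dist_normal_dist by (simp add: real_distribution_prob_algebra)

lemma nn_integral_std_normal:
  "f \<in> borel_measurable borel \<Longrightarrow>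
    (\<integral>\<^sup>+x. f x \<partial>std_normal_distribution) = (\<integral>\<^sup>+x. ennreal (std_normal_density x) * f x \<partial>lborel)"
  by (subst nn_integral_density) auto

lemma nn_integral_std_normal_uminus:
  assumes [measurable]: "f \<in> borel_measurable borel"
  shows "(\<integral>\<^sup>+x. f (- x) \<partial>std_normal_distribution) = (\<integral>\<^sup>+x. f x \<partial>std_normal_distribution)"
proof -
  have "(\<integral>\<^sup>+x. f (- x) \<partial>std_normal_distribution) = (\<integral>\<^sup>+x. ennreal (std_normal_density (- x)) * f (- x) \<partial>lborel)"
    by (subst nn_integral_std_normal) (auto simp: normal_density_def)
  also have "\<dots> = (\<integral>\<^sup>+x. ennreal (std_normal_density x) * f x \<partial>lborel)"
    using nn_integral_real_affine[of "\<lambda>x. ennreal (std_normal_density x) * f x" "-1" 0] by simp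
  finally show ?thesis by (simp add: nn_integral_std_normal)
qed

lemma nn_integral_lborel_shift:
  fixes f :: "real \<Rightarrow> ennreal"
  assumes [measurable]: "f \<in> borel_measurable borel"
  shows "(\<integral>\<^sup>+x. f (x + a) \<partial>lborel) = (\<integral>\<^sup>+x. f x \<partial>lborel)"
  using nn_integral_real_affine[of f 1 a] by (simp add: add.commute)

lemma nn_integral_shear1:
  fixes h :: "real \<Rightarrow> real \<Rightarrow> ennreal"
  assumes [measurable]: "case_prod h \<in> borel_measurable borel"
  shows "(\<integral>\<^sup>+x. \<integral>\<^sup>+y. h (x + a * y) y \<partial>lborel \<partial>lborel) = (\<integral>\<^sup>+x. \<integral>\<^sup>+y. h x y \<partial>lborel \<partial>lborel)"
proof -
  have [measurable]: "case_prod h \<in> borel_measurable (borel \<Otimes>\<^sub>M borel)"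
    using assms by (simp add: borel_prod)
  have "(\<integral>\<^sup>+x. \<integral>\<^sup>+y. h (x + a * y) y \<partial>lborel \<partial>lborel) = (\<integral>\<^sup>+y. \<integral>\<^sup>+x. h (x + a * y) y \<partial>lborel \<partial>lborel)"
    by (rule lborel_pair.Fubini'[symmetric]) measurable
  also have "\<dots> = (\<integral>\<^sup>+y. \<integral>\<^sup>+x. h x y \<partial>lborel \<partial>lborel)"
    by (intro nn_integral_cong nn_integral_lborel_shift[of "\<lambda>x. h x _"]) measurable
  also have "\<dots> = (\<integral>\<^sup>+x. \<integral>\<^sup>+y. h x y \<partial>lborel \<partial>lborel)"
    by (rule lborel_pair.Fubini') measurable
  finally show ?thesis .
qed

lemma nn_integral_shear2:
  fixes h :: "real \<Rightarrow> real \<Rightarrow> ennreal"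
  assumes [measurable]: "case_prod h \<in> borel_measurable borel"
  shows "(\<integral>\<^sup>+x. \<integral>\<^sup>+y. h x (y + a * x) \<partial>lborel \<partial>lborel) = (\<integral>\<^sup>+x. \<integral>\<^sup>+y. h x y \<partial>lborel \<partial>lborel)"
proof -
  have [measurable]: "case_prod h \<in> borel_measurable (borel \<Otimes>\<^sub>M borel)"
    using assms by (simp add: borel_prod)
  show ?thesis by (intro nn_integral_cong nn_integral_lborel_shift) measurable
qed

text \<open>A rotation by an angle \<open>\<theta>\<close> with \<open>sin \<theta> \<noteq> 0\<close> is a product of three shears, and shears preserve
  Lebesgue measure by translation invariance alone.\<close>

lemma nn_integral_lborel_rotation:
  fixes h :: "real \<Rightarrow> real \<Rightarrow> ennreal"
  assumes "case_prod h \<in> borel_measurable borel" "c\<^sup>2 + s\<^sup>2 = 1" "s \<noteq> 0"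
  shows "(\<integral>\<^sup>+x. \<integral>\<^sup>+y. h (c * x - s * y) (s * x + c * y) \<partial>lborel \<partial>lborel)
    = (\<integral>\<^sup>+x. \<integral>\<^sup>+y. h x y \<partial>lborel \<partial>lborel)"
proof -
  \<comment> \<open>\<open>a = - tan (\<theta> / 2)\<close>; the rotation is the shear by \<open>a\<close>, then by \<open>s\<close>, then by \<open>a\<close>\<close>
  define a where "a = (c - 1) / s"
  have [measurable]: "case_prod h \<in> borel_measurable (borel \<Otimes>\<^sub>M borel)"
    using assms(1) by (simp add: borel_prod)
  have as: "1 + a * s = c" using assms(3) by (simp add: a_def)
  have "s * (a + a * c + s) = (c - 1) * (1 + c) + s\<^sup>2"
    using assms(3) by (simp add: a_def field_simps power2_eq_square)
  also have "\<dots> = 0" using assms(2) by (simp add: algebra_simps power2_eq_square)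
  finally have ac: "a + a * c = - s" using assms(3) by simp
  have 1: "(x + a * y) + a * (s * x + c * y) = c * x - s * y" for x y
  proof -
    have "(x + a * y) + a * (s * x + c * y) = (1 + a * s) * x + (a + a * c) * y"
      by (simp add: algebra_simps)
    then show ?thesis by (simp add: as ac)
  qed
  have 2: "y + s * (x + a * y) = s * x + c * y" for x y
    by (simp add: as[symmetric] algebra_simps)
  let ?h1 = "\<lambda>x y. h (x + a * y) y"
  let ?h2 = "\<lambda>x y. ?h1 x (y + s * x)"
  have "(\<integral>\<^sup>+x. \<integral>\<^sup>+y. h (c * x - s * y) (s * x + c * y) \<partial>lborel \<partial>lborel)
      = (\<integral>\<^sup>+x. \<integral>\<^sup>+y. ?h2 (x + a * y) y \<partial>lborel \<partial>lborel)"
    by (simp only: 2 1)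
  also have "\<dots> = (\<integral>\<^sup>+x. \<integral>\<^sup>+y. ?h2 x y \<partial>lborel \<partial>lborel)"
    by (rule nn_integral_shear1) (simp add: borel_prod[symmetric])
  also have "\<dots> = (\<integral>\<^sup>+x. \<integral>\<^sup>+y. ?h1 x y \<partial>lborel \<partial>lborel)"
    by (rule nn_integral_shear2[of ?h1]) (simp add: borel_prod[symmetric])
  also have "\<dots> = (\<integral>\<^sup>+x. \<integral>\<^sup>+y. h x y \<partial>lborel \<partial>lborel)"
    by (rule nn_integral_shear1) fact
  finally show ?thesis .
qed

lemma line_avg_normal_rotation:
  assumes [measurable]: "F \<in> borel_measurable borel" and cs: "c\<^sup>2 + s\<^sup>2 = 1" "s \<noteq> 0"
  shows "line_avg std_normal_distribution (\<lambda>k. c * u k + s * v k)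
      (line_avg std_normal_distribution (\<lambda>k. c * v k - s * u k) F)
    = line_avg std_normal_distribution u (line_avg std_normal_distribution v F)"
proof
  fix w
  let ?\<phi> = "std_normal_density"
  define h where "h x y = ennreal (?\<phi> x) * (ennreal (?\<phi> y) * F (\<lambda>k. (w k + x * u k) + y * v k))" for x y
  have F_line: "(\<lambda>p. F (\<lambda>k. (w k + fst p * u k) + snd p * v k)) \<in> borel_measurable (borel \<Otimes>\<^sub>M borel)" for u v
  proof -
    have "(\<lambda>p. (\<lambda>k. (w k + fst p * u k) + snd p * v k)) \<in> borel \<Otimes>\<^sub>M borel \<rightarrow>\<^sub>M (borel :: (nat \<Rightarrow> real) measure)"
      by (intro measurable_line) measurable
    then show ?thesis by (rule measurable_compose) measurable
  qed
  have twice: "line_avg std_normal_distribution u (line_avg std_normal_distribution v F) w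
      = (\<integral>\<^sup>+x. \<integral>\<^sup>+y. ennreal (?\<phi> x) * (ennreal (?\<phi> y) * F (\<lambda>k. (w k + x * u k) + y * v k)) \<partial>lborel \<partial>lborel)" for u v
  proof -
    have [measurable]: "line_avg std_normal_distribution v F \<in> borel_measurable borel"
      by (intro measurable_line_avg std_normal_in_space) measurable
    have "line_avg std_normal_distribution u (line_avg std_normal_distribution v F) w
      = (\<integral>\<^sup>+x. ennreal (?\<phi> x) * line_avg std_normal_distribution v F (\<lambda>k. w k + x * u k) \<partial>lborel)"
      unfolding line_avg_def[of _ u] by (subst nn_integral_std_normal) measurable
    also have "\<dots> = (\<integral>\<^sup>+x. ennreal (?\<phi> x) * (\<integral>\<^sup>+y. ennreal (?\<phi> y) * F (\<lambda>k. (w k + x * u k) + y * v k) \<partial>lborel) \<partial>lborel)"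
      unfolding line_avg_def by (subst nn_integral_std_normal) measurable
    also have "\<dots> = (\<integral>\<^sup>+x. \<integral>\<^sup>+y. ennreal (?\<phi> x) * (ennreal (?\<phi> y) * F (\<lambda>k. (w k + x * u k) + y * v k)) \<partial>lborel \<partial>lborel)"
      by (intro nn_integral_cong nn_integral_cmult[symmetric]) measurable
    finally show ?thesis .
  qed
  have \<phi>: "ennreal (?\<phi> (c * x - s * y)) * (ennreal (?\<phi> (s * x + c * y)) * b) = ennreal (?\<phi> x) * (ennreal (?\<phi> y) * b)" for x y b
  proof -
    have "(c * x - s * y)\<^sup>2 + (s * x + c * y)\<^sup>2 = (c\<^sup>2 + s\<^sup>2) * (x\<^sup>2 + y\<^sup>2)"
      by (simp add: power2_eq_square algebra_simps)
    then have "- (c * x - s * y)\<^sup>2 / 2 + - (s * x + c * y)\<^sup>2 / 2 = - x\<^sup>2 / 2 + - y\<^sup>2 / 2"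
      using cs by simp
    then have "exp (- (c * x - s * y)\<^sup>2 / 2) * exp (- (s * x + c * y)\<^sup>2 / 2) = exp (- x\<^sup>2 / 2) * exp (- y\<^sup>2 / 2)"
      by (simp only: exp_add[symmetric])
    then have "?\<phi> (c * x - s * y) * ?\<phi> (s * x + c * y) = ?\<phi> x * ?\<phi> y"
      by (simp add: std_normal_density_def)
    then show ?thesis
      by (simp add: mult.assoc[symmetric] ennreal_mult[symmetric])
  qed
  have h: "ennreal (?\<phi> x) * (ennreal (?\<phi> y) * F (\<lambda>k. (w k + x * (c * u k + s * v k)) + y * (c * v k - s * u k)))
      = h (c * x - s * y) (s * x + c * y)" for x y
    unfolding h_def \<phi> by (simp add: algebra_simps)
  have "case_prod h \<in> borel_measurable (borel \<Otimes>\<^sub>M borel)"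
    using F_line[of u v] unfolding h_def case_prod_beta by measurable
  then have "case_prod h \<in> borel_measurable borel" by (simp add: borel_prod)
  from nn_integral_lborel_rotation[OF this cs]
  show "line_avg std_normal_distribution (\<lambda>k. c * u k + s * v k)
      (line_avg std_normal_distribution (\<lambda>k. c * v k - s * u k) F) w
    = line_avg std_normal_distribution u (line_avg std_normal_distribution v F) w"
    unfolding twice h by (simp add: h_def)
qed

text \<open>The covariance matrix of a sum of the vectors with independent standard normal coefficients.\<close>

definition gram :: "(nat \<Rightarrow> real) list \<Rightarrow> nat \<Rightarrow> nat \<Rightarrow> real"
  where "gram vs k l = (\<Sum>v\<leftarrow>vs. v k * v l)"

abbreviation normal_avgs :: "(nat \<Rightarrow> real) list \<Rightarrow> ((nat \<Rightarrow> real) \<Rightarrow> ennreal) \<Rightarrow> (nat \<Rightarrow> real) \<Rightarrow> ennreal"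
  where "normal_avgs vs \<equiv> line_avgs (map (\<lambda>v. (std_normal_distribution, v)) vs)"

lemma line_measures_normal: "line_measures (map (\<lambda>v. (std_normal_distribution, v)) vs)"
  using std_normal_in_space by simp

lemma measurable_normal_avgs: "F \<in> borel_measurable borel \<Longrightarrow> normal_avgs vs F \<in> borel_measurable borel"
  by (rule measurable_line_avgs[OF line_measures_normal])

text \<open>One Givens rotation of the head with each other vector clears the \<open>m\<close>-th coordinate of that
  vector.  Rotations preserve Gaussian averages and Gram matrices.\<close>

lemma rotate_coordinate_into_head:
  "\<exists>v' vs'. length vs' = length vs \<and> (\<forall>x\<in>set vs'. x m = 0) \<and>
     (\<forall>k l. gram (v' # vs') k l = gram (v # vs) k l) \<and>
     (\<forall>F\<in>borel_measurable borel. normal_avgs (v' # vs') F = normal_avgs (v # vs) F)"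
proof (induction vs arbitrary: v)
  case Nil then show ?case by auto
next
  case (Cons u vs)
  let ?N = "std_normal_distribution"
  have rot: "\<exists>v1 u1. u1 m = 0 \<and> (\<forall>k l. v1 k * v1 l + u1 k * u1 l = v k * v l + u k * u l) \<and>
    (\<forall>F\<in>borel_measurable borel. line_avg ?N v1 (line_avg ?N u1 F) = line_avg ?N v (line_avg ?N u F))"
  proof (cases "u m = 0")
    case True then show ?thesis by blast
  next
    case False
    define \<rho> where "\<rho> = sqrt ((v m)\<^sup>2 + (u m)\<^sup>2)"
    define c s where "c = v m / \<rho>" and "s = u m / \<rho>"
    have \<rho>: "\<rho>\<^sup>2 = (v m)\<^sup>2 + (u m)\<^sup>2" "\<rho> > 0"
      using False by (auto simp: \<rho>_def sum_power2_gt_zero_iff)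
    have cs: "c\<^sup>2 + s\<^sup>2 = 1" "s \<noteq> 0"
      using \<rho> False by (auto simp: c_def s_def power_divide add_divide_distrib[symmetric])
    have "(c * v k + s * u k) * (c * v l + s * u l) + (c * u k - s * v k) * (c * u l - s * v l)
        = (c\<^sup>2 + s\<^sup>2) * (v k * v l + u k * u l)" for k l
      by (simp add: power2_eq_square algebra_simps)
    then have "(c * v k + s * u k) * (c * v l + s * u l) + (c * u k - s * v k) * (c * u l - s * v l)
        = v k * v l + u k * u l" for k l using cs by simp
    moreover have "c * u m - s * v m = 0" by (simp add: c_def s_def)
    ultimately show ?thesis using line_avg_normal_rotation[OF _ cs, of _ v u]
      by (intro exI[of _ "\<lambda>k. c * v k + s * u k"] exI[of _ "\<lambda>k. c * u k - s * v k"]) auto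
  qed
  then obtain v1 u1 where u1: "u1 m = 0"
    and g1: "\<And>k l. v1 k * v1 l + u1 k * u1 l = v k * v l + u k * u l"
    and r1: "\<And>F. F \<in> borel_measurable borel \<Longrightarrow>
      line_avg ?N v1 (line_avg ?N u1 F) = line_avg ?N v (line_avg ?N u F)" by blast
  from Cons.IH[of v1] obtain v' vs' where IH: "length vs' = length vs" "\<forall>x\<in>set vs'. x m = 0"
     "\<And>k l. gram (v' # vs') k l = gram (v1 # vs) k l"
     "\<And>F. F \<in> borel_measurable borel \<Longrightarrow> normal_avgs (v' # vs') F = normal_avgs (v1 # vs) F" by blast
  have "gram (v' # u1 # vs') k l = gram (v # u # vs) k l" for k l
    using IH(3)[of k l] g1[of k l] by (simp add: gram_def)
  moreover have "normal_avgs (v' # u1 # vs') F = normal_avgs (v # u # vs) F"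
    if F: "F \<in> borel_measurable borel" for F
  proof -
    note mF = measurable_normal_avgs[OF F]
    note comm = line_avg_commute[OF std_normal_in_space std_normal_in_space mF]
    have "normal_avgs (v' # u1 # vs') F = line_avg ?N u1 (normal_avgs (v' # vs') F)"
      unfolding list.map line_avgs_Cons by (rule comm)
    also have "\<dots> = line_avg ?N u1 (normal_avgs (v1 # vs) F)" by (simp only: IH(4)[OF F])
    also have "\<dots> = line_avg ?N v1 (line_avg ?N u1 (normal_avgs vs F))"
      unfolding list.map line_avgs_Cons by (rule comm)
    also have "\<dots> = normal_avgs (v # u # vs) F" using r1[OF mF] by simp
    finally show ?thesis .
  qed
  ultimately show ?case using IH(1,2) u1
    by (intro exI[of _ v'] exI[of _ "u1 # vs'"]) auto
qed

lemma normal_avgs_cong_coords: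
  assumes "\<And>w w'. (\<And>k. k \<in> K \<Longrightarrow> w k = w' k) \<Longrightarrow> F w = F w'" "\<And>k. k \<in> K \<Longrightarrow> w k = w' k"
  shows "normal_avgs vs F w = normal_avgs vs F w'"
  using assms(2)
proof (induction vs arbitrary: w w')
  case Nil
  have "F w = F w'" by (rule assms(1)) (rule Nil)
  then show ?case by simp
next
  case (Cons v vs)
  have "normal_avgs vs F (\<lambda>k. w k + y * v k) = normal_avgs vs F (\<lambda>k. w' k + y * v k)" for y
    by (rule Cons.IH) (simp add: Cons.prems)
  then show ?case unfolding list.map line_avgs_Cons line_avg_def[of _ v] by (simp only:)
qed

lemma normal_avgs_factor:
  assumes "\<And>v. v \<in> set vs \<Longrightarrow> v m = 0" and F: "F \<in> borel_measurable borel"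
    and [measurable]: "g \<in> borel_measurable borel"
  shows "normal_avgs vs (\<lambda>w. g (w m) * F w) w = g (w m) * normal_avgs vs F w"
  using assms(1)
proof (induction vs arbitrary: w)
  case (Cons v vs)
  have vm: "v m = 0" using Cons.prems by simp
  define G where "G = normal_avgs vs F"
  have [measurable]: "G \<in> borel_measurable borel"
    unfolding G_def by (rule measurable_normal_avgs[OF F])
  have "normal_avgs (v # vs) (\<lambda>w. g (w m) * F w) w
      = (\<integral>\<^sup>+y. g (w m) * G (\<lambda>k. w k + y * v k) \<partial>std_normal_distribution)"
  proof -
    have "normal_avgs vs (\<lambda>w. g (w m) * F w) w = g (w m) * G w" for w
      unfolding G_def using Cons.prems by (intro Cons.IH) auto
    then show ?thesis unfolding list.map line_avgs_Cons line_avg_def[of _ v] by (simp only: vm) simp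
  qed
  also have "\<dots> = g (w m) * (\<integral>\<^sup>+y. G (\<lambda>k. w k + y * v k) \<partial>std_normal_distribution)"
    by (rule nn_integral_cmult) measurable
  finally show ?case unfolding list.map line_avgs_Cons line_avg_def[of _ v] G_def .
qed simp

text \<open>If the Gram matrix is the identity on the first \<open>r\<close> coordinates, these are independent standard
  normal.  Removing one coordinate by rotations leaves a vector whose other coordinates vanish and
  which contributes the last factor.\<close>

lemma normal_avgs_orthonormal:
  assumes [measurable]: "g \<in> borel_measurable borel"
    and "\<And>k l. k \<in> {1..r} \<Longrightarrow> l \<in> {1..r} \<Longrightarrow> gram vs k l = (if k = l then 1 else 0)"
  shows "normal_avgs vs (\<lambda>w. \<Prod>k=1..r. g (w k)) (\<lambda>_. 0) = (\<integral>\<^sup>+x. g x \<partial>std_normal_distribution) ^ r"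
  using assms(2)
proof (induction r arbitrary: vs)
  case 0
  interpret N: real_distribution std_normal_distribution by (rule real_dist_normal_dist)
  have one: "(\<integral>\<^sup>+y. 1 \<partial>std_normal_distribution) = 1"
    unfolding nn_integral_const using N.emeasure_space_1 by simp
  have "normal_avgs vs (\<lambda>w. 1) w = 1" for w
  proof (induction vs arbitrary: w)
    case (Cons v vs)
    then show ?case unfolding list.map line_avgs_Cons line_avg_def[of _ v] by (simp only: one)
  qed simp
  then show ?case by simp
next
  case (Suc r)
  let ?N = "std_normal_distribution"
  define F where "F w = (\<Prod>k=1..r. g (w k))" for w :: "nat \<Rightarrow> real"
  have coord: "(\<lambda>w::nat \<Rightarrow> real. w k) \<in> borel_measurable borel" for k
    by (rule measurable_product_coordinates)
  have mF [measurable]: "F \<in> borel_measurable borel" unfolding F_def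
    by (intro borel_measurable_prod_ennreal measurable_compose[OF coord]) measurable
  obtain v vs1 where vs: "vs = v # vs1" using Suc.prems[of "Suc r" "Suc r"] by (cases vs) (simp_all add: gram_def)
  from rotate_coordinate_into_head[of vs1 "Suc r" v, folded vs] obtain v' vs'
    where R: "\<forall>x\<in>set vs'. x (Suc r) = 0" "\<forall>k l. gram (v' # vs') k l = gram vs k l"
      "\<forall>F\<in>borel_measurable borel. normal_avgs (v' # vs') F = normal_avgs vs F"
    by (elim exE conjE) (rule that)
  have head: "gram (v' # vs') (Suc r) k = v' (Suc r) * v' k" for k
  proof -
    have "(\<Sum>x\<leftarrow>vs'. x (Suc r) * x k) = 0" using R(1) by (induction vs') auto
    then show ?thesis by (simp add: gram_def)
  qed
  have "v' (Suc r) * v' (Suc r) = 1" using head[of "Suc r"] R(2) Suc.prems by simp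
  define c where "c = v' (Suc r)"
  have v1: "v' (Suc r) = 1 \<or> v' (Suc r) = -1"
    using \<open>v' (Suc r) * v' (Suc r) = 1\<close> by (simp add: square_eq_1_iff)
  have v0: "v' k = 0" if "k \<in> {1..r}" for k
    using head[of k] R(2)[rule_format, of "Suc r" k] Suc.prems[of "Suc r" k] that v1 by auto
  have gram': "gram vs' k l = (if k = l then 1 else 0)" if "k \<in> {1..r}" "l \<in> {1..r}" for k l
    using R(2)[rule_format, of k l] Suc.prems[of k l] that v0 by (auto simp: gram_def)
  have split: "(\<lambda>w. \<Prod>k=1..Suc r. g (w k)) = (\<lambda>w. g (w (Suc r)) * F w)"
    by (simp add: F_def mult.commute)
  have "(\<lambda>w. g (w (Suc r)) * F w) \<in> borel_measurable borel"
    by (rule borel_measurable_times_ennreal[OF measurable_compose[OF coord assms(1)] mF])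
  from R(3)[rule_format, OF this]
  have "normal_avgs vs (\<lambda>w. \<Prod>k=1..Suc r. g (w k)) (\<lambda>_. 0)
      = normal_avgs (v' # vs') (\<lambda>w. g (w (Suc r)) * F w) (\<lambda>_. 0)"
    unfolding split by simp
  also have "\<dots> = (\<integral>\<^sup>+y. g (y * c) * normal_avgs vs' F (\<lambda>k. y * v' k) \<partial>?N)"
  proof -
    have "normal_avgs vs' (\<lambda>w. g (w (Suc r)) * F w) w = g (w (Suc r)) * normal_avgs vs' F w" for w
      using R(1) by (intro normal_avgs_factor mF assms(1)) blast
    then show ?thesis
      unfolding list.map line_avgs_Cons line_avg_def[of _ v'] by (simp only: c_def add_0)
  qed
  also have "\<dots> = (\<integral>\<^sup>+y. g (y * c) * normal_avgs vs' F (\<lambda>_. 0) \<partial>?N)"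
  proof -
    have "normal_avgs vs' F (\<lambda>k. y * v' k) = normal_avgs vs' F (\<lambda>_. 0)" for y
    proof (rule normal_avgs_cong_coords[of "{1..r}"])
      show "F w = F w'" if "\<And>k. k \<in> {1..r} \<Longrightarrow> w k = w' k" for w w'
        unfolding F_def using that by (intro prod.cong) auto
    qed (simp add: v0)
    then show ?thesis by (simp only:)
  qed
  also have "\<dots> = (\<integral>\<^sup>+y. g (y * c) \<partial>?N) * normal_avgs vs' F (\<lambda>_. 0)"
    by (rule nn_integral_multc) measurable
  also have "(\<integral>\<^sup>+y. g (y * c) \<partial>?N) = (\<integral>\<^sup>+y. g y \<partial>?N)"
    using v1 nn_integral_std_normal_uminus[OF assms(1)] unfolding c_def[symmetric]
    by (elim disjE) (simp_all only: mult_1_right mult_minus1_right)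
  also have "normal_avgs vs' F (\<lambda>_. 0) = (\<integral>\<^sup>+x. g x \<partial>?N) ^ r"
    unfolding F_def by (rule Suc.IH) (rule gram')
  finally show ?case by (simp only: power_Suc)
qed

section \<open>Comparison with the Gaussian law\<close>

text \<open>The remainder is relative to \<open>exp (\<phi> 0)\<close>: the third derivative of \<open>exp \<phi>\<close> is \<open>exp \<phi>\<close> times a polynomial
  in the derivatives of \<open>\<phi>\<close>, and \<open>exp \<phi>\<close> itself varies by the factor \<open>exp (\<kappa> \<bar>y\<bar>)\<close> at most.\<close>

lemma exp_taylor_bound:
  fixes \<phi> \<phi>1 \<phi>2 \<phi>3 :: "real \<Rightarrow> real"
  assumes D: "\<And>t. (\<phi> has_real_derivative \<phi>1 t) (at t)" "\<And>t. (\<phi>1 has_real_derivative \<phi>2 t) (at t)"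
      "\<And>t. (\<phi>2 has_real_derivative \<phi>3 t) (at t)"
    and B: "\<And>t. \<bar>\<phi>1 t\<bar> \<le> \<kappa>" "\<And>t. \<bar>\<phi>2 t\<bar> \<le> \<kappa>\<^sup>2" "\<And>t. \<bar>\<phi>3 t\<bar> \<le> \<kappa> ^ 3"
  shows "\<bar>\<phi> y - \<phi> 0\<bar> \<le> \<kappa> * \<bar>y\<bar>"
    and "\<bar>exp (\<phi> y) - exp (\<phi> 0) * (1 + \<phi>1 0 * y + ((\<phi>1 0)\<^sup>2 + \<phi>2 0) / 2 * y\<^sup>2)\<bar>
      \<le> exp (\<phi> 0) * (\<kappa> ^ 3 * (\<bar>y\<bar> ^ 3 * exp (\<kappa> * \<bar>y\<bar>)))"
proof -
  have \<kappa>: "0 \<le> \<kappa>" using B(1)[of 0] by simp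
  have lip: "\<bar>\<phi> t - \<phi> 0\<bar> \<le> \<kappa> * \<bar>t\<bar>" for t
  proof -
    have "norm (\<phi> t - \<phi> 0) \<le> \<kappa> * norm (t - 0)"
      by (rule field_differentiable_bound[of UNIV \<phi> \<phi>1]) (use D(1) B(1) in auto)
    then show ?thesis by simp
  qed
  then show "\<bar>\<phi> y - \<phi> 0\<bar> \<le> \<kappa> * \<bar>y\<bar>" .
  define h where "h m t = (if m = 0 then exp (\<phi> t) else if m = 1 then exp (\<phi> t) * \<phi>1 t
    else if m = 2 then exp (\<phi> t) * ((\<phi>1 t)\<^sup>2 + \<phi>2 t)
    else exp (\<phi> t) * ((\<phi>1 t) ^ 3 + 3 * \<phi>1 t * \<phi>2 t + \<phi>3 t))" for m :: nat and t
  have dh: "(h m has_real_derivative h (Suc m) t) (at t)" if m: "m < 3" for m t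
  proof -
    consider "m = 0" | "m = 1" | "m = 2" using m by linarith
    then show ?thesis
    proof cases
      case 1 then show ?thesis unfolding h_def by (auto intro!: derivative_eq_intros D)
    next
      case 2 then show ?thesis unfolding h_def
        by (auto intro!: derivative_eq_intros D simp: power2_eq_square algebra_simps)
    next
      case 3 then show ?thesis unfolding h_def
        by (auto intro!: derivative_eq_intros D simp: power2_eq_square power3_eq_cube algebra_simps)
    qed
  qed
  have "\<exists>t. \<bar>t\<bar> \<le> \<bar>y\<bar> \<and> exp (\<phi> y) = (\<Sum>m<3. h m 0 / fact m * y ^ m) + h 3 t / fact 3 * y ^ 3"
  proof (rule Maclaurin_bi_le)
    show "h 0 = (\<lambda>t. exp (\<phi> t))" by (simp add: h_def fun_eq_iff)
    show "\<forall>m t. m < 3 \<and> \<bar>t\<bar> \<le> \<bar>y\<bar> \<longrightarrow> (h m has_real_derivative h (Suc m) t) (at t)"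
      using dh by blast
  qed
  then obtain t where t: "\<bar>t\<bar> \<le> \<bar>y\<bar>" "exp (\<phi> y) = (\<Sum>m<3. h m 0 / fact m * y ^ m) + h 3 t / fact 3 * y ^ 3"
    by blast
  have "(\<Sum>m<3. h m 0 / fact m * y ^ m) = exp (\<phi> 0) * (1 + \<phi>1 0 * y + ((\<phi>1 0)\<^sup>2 + \<phi>2 0) / 2 * y\<^sup>2)"
    by (simp add: eval_nat_numeral h_def algebra_simps)
  with t(2) have eq: "exp (\<phi> y) - exp (\<phi> 0) * (1 + \<phi>1 0 * y + ((\<phi>1 0)\<^sup>2 + \<phi>2 0) / 2 * y\<^sup>2) = h 3 t / 6 * y ^ 3"
    by (simp add: eval_nat_numeral)
  have "\<bar>(\<phi>1 t) ^ 3 + 3 * \<phi>1 t * \<phi>2 t + \<phi>3 t\<bar> \<le> \<bar>\<phi>1 t\<bar> ^ 3 + 3 * (\<bar>\<phi>1 t\<bar> * \<bar>\<phi>2 t\<bar>) + \<bar>\<phi>3 t\<bar>"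
    by (rule order_trans[OF abs_triangle_ineq add_mono[OF order_trans[OF abs_triangle_ineq]]])
      (auto simp: power_abs abs_mult)
  also have "\<dots> \<le> \<kappa> ^ 3 + 3 * (\<kappa> * \<kappa>\<^sup>2) + \<kappa> ^ 3"
    using B[of t] \<kappa> by (intro add_mono mult_mono power_mono) auto
  finally have "\<bar>(\<phi>1 t) ^ 3 + 3 * \<phi>1 t * \<phi>2 t + \<phi>3 t\<bar> \<le> 6 * \<kappa> ^ 3"
    using \<kappa> by (simp add: power2_eq_square power3_eq_cube)
  moreover have "exp (\<phi> t) \<le> exp (\<phi> 0) * exp (\<kappa> * \<bar>y\<bar>)"
    using lip[of t] mult_left_mono[OF t(1) \<kappa>] by (simp add: exp_add[symmetric])
  ultimately have "\<bar>h 3 t\<bar> \<le> (exp (\<phi> 0) * exp (\<kappa> * \<bar>y\<bar>)) * (6 * \<kappa> ^ 3)"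
    unfolding h_def by (simp add: abs_mult) (intro mult_mono, auto)
  then have "\<bar>h 3 t\<bar> / 6 * \<bar>y\<bar> ^ 3 \<le> (exp (\<phi> 0) * exp (\<kappa> * \<bar>y\<bar>)) * \<kappa> ^ 3 * \<bar>y\<bar> ^ 3"
    by (intro mult_right_mono) auto
  then show "\<bar>exp (\<phi> y) - exp (\<phi> 0) * (1 + \<phi>1 0 * y + ((\<phi>1 0)\<^sup>2 + \<phi>2 0) / 2 * y\<^sup>2)\<bar>
      \<le> exp (\<phi> 0) * (\<kappa> ^ 3 * (\<bar>y\<bar> ^ 3 * exp (\<kappa> * \<bar>y\<bar>)))"
    unfolding eq by (simp add: abs_mult power_abs mult_ac)
qed

text \<open>The weighted third moment is what the remainder of \<open>exp_taylor_bound\<close> calls for.\<close>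

definition standardized :: "real \<Rightarrow> real \<Rightarrow> real measure \<Rightarrow> bool" where
  "standardized \<kappa> K \<rho> \<longleftrightarrow> \<rho> \<in> space (prob_algebra borel) \<and> integrable \<rho> (\<lambda>y. y\<^sup>2) \<and>
     (\<integral>y. y \<partial>\<rho>) = 0 \<and> (\<integral>y. y\<^sup>2 \<partial>\<rho>) = 1 \<and>
     (\<integral>\<^sup>+y. ennreal (\<bar>y\<bar> ^ 3 * exp (\<kappa> * \<bar>y\<bar>)) \<partial>\<rho>) \<le> ennreal K"

text \<open>The main term depends on the first two moments only.  The error and the lower bound are relative
  to \<open>exp (\<phi> 0)\<close>, so that two standardized laws give expectations with a ratio close to 1.\<close>

lemma standardized_exp_expectation:
  fixes \<phi> \<phi>1 \<phi>2 \<phi>3 :: "real \<Rightarrow> real"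
  assumes D: "\<And>t. (\<phi> has_real_derivative \<phi>1 t) (at t)" "\<And>t. (\<phi>1 has_real_derivative \<phi>2 t) (at t)"
      "\<And>t. (\<phi>2 has_real_derivative \<phi>3 t) (at t)"
    and B: "\<And>t. \<bar>\<phi>1 t\<bar> \<le> \<kappa>" "\<And>t. \<bar>\<phi>2 t\<bar> \<le> \<kappa>\<^sup>2" "\<And>t. \<bar>\<phi>3 t\<bar> \<le> \<kappa> ^ 3"
    and \<kappa>: "\<kappa> \<le> 1 / 2" and K: "0 \<le> K" and std: "standardized \<kappa> K \<rho>"
  shows "integrable \<rho> (\<lambda>y. exp (\<phi> y))"
    and "\<bar>(\<integral>y. exp (\<phi> y) \<partial>\<rho>) - exp (\<phi> 0) * (1 + ((\<phi>1 0)\<^sup>2 + \<phi>2 0) / 2)\<bar> \<le> exp (\<phi> 0) * (\<kappa> ^ 3 * K)"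
    and "exp (\<phi> 0) / 2 \<le> (\<integral>y. exp (\<phi> y) \<partial>\<rho>)"
proof -
  interpret real_distribution \<rho> using std by (simp add: standardized_def real_distribution_prob_algebra)
  have i2: "integrable \<rho> (\<lambda>y. y\<^sup>2)" and m1: "(\<integral>y. y \<partial>\<rho>) = 0" and m2: "(\<integral>y. y\<^sup>2 \<partial>\<rho>) = 1"
    and m3: "(\<integral>\<^sup>+y. ennreal (\<bar>y\<bar> ^ 3 * exp (\<kappa> * \<bar>y\<bar>)) \<partial>\<rho>) \<le> ennreal K"
    using std by (auto simp: standardized_def)
  have "\<bar>y\<bar> \<le> 1 + y\<^sup>2" for y :: real
    using zero_le_power2[of "\<bar>y\<bar> - 1"] by (simp add: power2_eq_square algebra_simps)
  then have i1: "integrable \<rho> (\<lambda>y. y)"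
    by (intro Bochner_Integration.integrable_bound[OF Bochner_Integration.integrable_add[OF integrable_const[of 1] i2]])
      (auto simp: abs_le_iff)
  let ?R = "\<lambda>y. \<bar>y\<bar> ^ 3 * exp (\<kappa> * \<bar>y\<bar>)"
  let ?P = "\<lambda>y. exp (\<phi> 0) * (1 + \<phi>1 0 * y + ((\<phi>1 0)\<^sup>2 + \<phi>2 0) / 2 * y\<^sup>2)"
  have [measurable]: "\<phi> \<in> borel_measurable borel"
    using D(1) by (intro borel_measurable_continuous_onI continuous_at_imp_continuous_on ballI DERIV_isCont)
  have i3: "integrable \<rho> ?R"
    by (rule integrableI_bounded) (use m3 in \<open>auto simp: abs_mult intro: le_less_trans\<close>)
  have m3': "(\<integral>y. ?R y \<partial>\<rho>) \<le> K"
    using m3 K by (subst (asm) nn_integral_eq_integral[OF i3]) auto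
  note T = exp_taylor_bound[OF D B]
  have u: "prob UNIV = 1" using prob_space by simp
  have \<kappa>0: "0 \<le> \<kappa>" using B(1)[of 0] by simp
  have iP: "integrable \<rho> ?P" using i1 i2 by simp
  have iD: "integrable \<rho> (\<lambda>y. exp (\<phi> y) - ?P y)"
    by (rule Bochner_Integration.integrable_bound[OF integrable_mult_right[OF integrable_mult_right[OF i3, of "\<kappa> ^ 3"], of "exp (\<phi> 0)"]])
      (use T(2) \<kappa>0 in \<open>auto simp: abs_mult power_abs\<close>)
  show ie: "integrable \<rho> (\<lambda>y. exp (\<phi> y))"
    using Bochner_Integration.integrable_add[OF iD iP] by simp
  have P: "(\<integral>y. ?P y \<partial>\<rho>) = exp (\<phi> 0) * (1 + ((\<phi>1 0)\<^sup>2 + \<phi>2 0) / 2)"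
    using i1 i2 by (simp add: m1 m2 u)
  have "\<bar>(\<integral>y. exp (\<phi> y) - ?P y \<partial>\<rho>)\<bar> \<le> (\<integral>y. exp (\<phi> 0) * (\<kappa> ^ 3 * ?R y) \<partial>\<rho>)"
    by (rule order_trans[OF integral_abs_bound integral_mono[OF integrable_abs[OF iD]]])
      (use i3 T(2) in auto)
  also have "\<dots> = exp (\<phi> 0) * (\<kappa> ^ 3 * (\<integral>y. ?R y \<partial>\<rho>))" by simp
  also have "\<dots> \<le> exp (\<phi> 0) * (\<kappa> ^ 3 * K)"
    using m3' B(1)[of 0] by (intro mult_left_mono) auto
  also have "(\<integral>y. exp (\<phi> y) - ?P y \<partial>\<rho>) = (\<integral>y. exp (\<phi> y) \<partial>\<rho>) - exp (\<phi> 0) * (1 + ((\<phi>1 0)\<^sup>2 + \<phi>2 0) / 2)"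
    using ie iP P by simp
  finally show "\<bar>(\<integral>y. exp (\<phi> y) \<partial>\<rho>) - exp (\<phi> 0) * (1 + ((\<phi>1 0)\<^sup>2 + \<phi>2 0) / 2)\<bar> \<le> exp (\<phi> 0) * (\<kappa> ^ 3 * K)" .
  have "\<bar>y\<bar> \<le> (1 + y\<^sup>2) / 2" for y :: real
    using zero_le_power2[of "\<bar>y\<bar> - 1"] by (simp add: power2_eq_square algebra_simps)
  then have "(\<integral>y. \<bar>y\<bar> \<partial>\<rho>) \<le> (\<integral>y. (1 + y\<^sup>2) / 2 \<partial>\<rho>)"
    using i1 i2 by (intro integral_mono) auto
  also have "\<dots> = 1" using i2 by (simp add: m2 u)
  finally have "\<kappa> * (\<integral>y. \<bar>y\<bar> \<partial>\<rho>) \<le> 1 / 2 * 1"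
    using \<kappa> by (intro mult_mono) auto
  then have "exp (\<phi> 0) / 2 \<le> exp (\<phi> 0) * (1 - \<kappa> * (\<integral>y. \<bar>y\<bar> \<partial>\<rho>))" by simp
  also have "\<dots> = (\<integral>y. exp (\<phi> 0) * (1 - \<kappa> * \<bar>y\<bar>) \<partial>\<rho>)"
    using i1 by (simp add: u)
  also have "\<dots> \<le> (\<integral>y. exp (\<phi> y) \<partial>\<rho>)"
  proof (rule integral_mono[OF _ ie])
    fix y
    have "exp (\<phi> 0) * (1 - \<kappa> * \<bar>y\<bar>) \<le> exp (\<phi> 0) * exp (- (\<kappa> * \<bar>y\<bar>))"
      using exp_ge_add_one_self[of "- (\<kappa> * \<bar>y\<bar>)"] by (intro mult_left_mono) auto
    also have "\<dots> \<le> exp (\<phi> y)" using T(1)[of y] by (simp add: exp_add[symmetric])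
    finally show "exp (\<phi> 0) * (1 - \<kappa> * \<bar>y\<bar>) \<le> exp (\<phi> y)" .
  qed (use i1 in simp)
  finally show "exp (\<phi> 0) / 2 \<le> (\<integral>y. exp (\<phi> y) \<partial>\<rho>)" .
qed

lemma standardized_exp_compare:
  fixes \<phi> \<phi>1 \<phi>2 \<phi>3 :: "real \<Rightarrow> real"
  assumes D: "\<And>t. (\<phi> has_real_derivative \<phi>1 t) (at t)" "\<And>t. (\<phi>1 has_real_derivative \<phi>2 t) (at t)"
      "\<And>t. (\<phi>2 has_real_derivative \<phi>3 t) (at t)"
    and B: "\<And>t. \<bar>\<phi>1 t\<bar> \<le> \<kappa>" "\<And>t. \<bar>\<phi>2 t\<bar> \<le> \<kappa>\<^sup>2" "\<And>t. \<bar>\<phi>3 t\<bar> \<le> \<kappa> ^ 3"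
    and \<kappa>: "\<kappa> \<le> 1 / 2" and K: "0 \<le> K" and std: "standardized \<kappa> K \<rho>" "standardized \<kappa> K \<sigma>"
  shows "(\<integral>\<^sup>+y. ennreal (exp (\<phi> y)) \<partial>\<rho>) \<le> ennreal (1 + 4 * K * \<kappa> ^ 3) * (\<integral>\<^sup>+y. ennreal (exp (\<phi> y)) \<partial>\<sigma>)"
proof -
  note R = standardized_exp_expectation[OF D B \<kappa> K std(1)]
  note S = standardized_exp_expectation[OF D B \<kappa> K std(2)]
  have \<kappa>0: "0 \<le> \<kappa>" using B(1)[of 0] by simp
  have "(\<integral>y. exp (\<phi> y) \<partial>\<rho>) \<le> (\<integral>y. exp (\<phi> y) \<partial>\<sigma>) + 4 * K * \<kappa> ^ 3 * (exp (\<phi> 0) / 2)"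
    using R(2) S(2) by (simp add: abs_le_iff algebra_simps)
  also have "\<dots> \<le> (\<integral>y. exp (\<phi> y) \<partial>\<sigma>) + 4 * K * \<kappa> ^ 3 * (\<integral>y. exp (\<phi> y) \<partial>\<sigma>)"
    using S(3) K \<kappa>0 by (intro add_mono mult_left_mono) auto
  finally have "(\<integral>y. exp (\<phi> y) \<partial>\<rho>) \<le> (1 + 4 * K * \<kappa> ^ 3) * (\<integral>y. exp (\<phi> y) \<partial>\<sigma>)"
    by (simp add: algebra_simps)
  then have "ennreal (\<integral>y. exp (\<phi> y) \<partial>\<rho>) \<le> ennreal ((1 + 4 * K * \<kappa> ^ 3) * (\<integral>y. exp (\<phi> y) \<partial>\<sigma>))"
    by (rule ennreal_leI)
  also have "\<dots> = ennreal (1 + 4 * K * \<kappa> ^ 3) * ennreal (\<integral>y. exp (\<phi> y) \<partial>\<sigma>)"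
    using K \<kappa>0 by (intro ennreal_mult integral_nonneg) auto
  finally show ?thesis
    by (simp only: nn_integral_eq_integral[OF R(1) AE_I2[OF exp_ge_zero]]
        nn_integral_eq_integral[OF S(1) AE_I2[OF exp_ge_zero]])
qed

text \<open>Because of \<open>1 \<le> C\<close>, the derivatives of orders 1, 2, 3 along a line are bounded by the powers
  of a single number.\<close>

definition smooth_test :: "real \<Rightarrow> (real \<Rightarrow> real) \<Rightarrow> bool" where
  "smooth_test C f \<longleftrightarrow> 1 \<le> C \<and> (\<exists>f1 f2 f3. \<forall>x. (f has_real_derivative f1 x) (at x) \<and>
     (f1 has_real_derivative f2 x) (at x) \<and> (f2 has_real_derivative f3 x) (at x) \<and>
     \<bar>f1 x\<bar> \<le> C \<and> \<bar>f2 x\<bar> \<le> C \<and> \<bar>f3 x\<bar> \<le> C)"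

lemma smooth_test_measurable:
  assumes "smooth_test C f" shows "f \<in> borel_measurable borel"
proof -
  obtain f1 where "\<And>x. (f has_real_derivative f1 x) (at x)" using assms by (auto simp: smooth_test_def)
  then show ?thesis
    by (intro borel_measurable_continuous_onI continuous_at_imp_continuous_on ballI DERIV_isCont)
qed

text \<open>In a direction with entries of size \<open>b\<close>, the \<open>m\<close>-th derivative of \<open>\<Sum>k\<le>r. f (w k)\<close> is at most \<open>C r b\<^sup>m\<close>,
  and hence at most \<open>(C r b)\<^sup>m\<close>.\<close>

lemma line_avg_exp_sum_compare:
  assumes f: "smooth_test C f" and v: "\<And>k. k \<in> {1..r} \<Longrightarrow> \<bar>v k\<bar> \<le> b" and r: "1 \<le> r"
    and \<kappa>: "\<kappa> = C * real r * b" "\<kappa> \<le> 1 / 2" and K: "0 \<le> K"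
    and std: "standardized \<kappa> K \<rho>" "standardized \<kappa> K \<sigma>"
  shows "line_avg \<rho> v (\<lambda>w. ennreal (exp (\<Sum>k=1..r. f (w k)))) w
    \<le> ennreal (1 + 4 * K * \<kappa> ^ 3) * line_avg \<sigma> v (\<lambda>w. ennreal (exp (\<Sum>k=1..r. f (w k)))) w"
proof -
  obtain f1 f2 f3 where C: "1 \<le> C" and d: "\<And>x. (f has_real_derivative f1 x) (at x)"
     "\<And>x. (f1 has_real_derivative f2 x) (at x)" "\<And>x. (f2 has_real_derivative f3 x) (at x)"
     and bd: "\<And>x. \<bar>f1 x\<bar> \<le> C" "\<And>x. \<bar>f2 x\<bar> \<le> C" "\<And>x. \<bar>f3 x\<bar> \<le> C"
    using f unfolding smooth_test_def by metis
  have b: "0 \<le> b" using v[of 1] r by fastforce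
  have Cr: "1 \<le> C * real r" using C r mult_mono[of 1 C 1 "real r"] by simp
  have bound: "\<bar>\<Sum>k=1..r. g (w k + t * v k) * v k ^ m\<bar> \<le> \<kappa> ^ m"
    if g: "\<And>x. \<bar>g x\<bar> \<le> C" and m: "1 \<le> m" for g t m
  proof -
    have "\<bar>\<Sum>k=1..r. g (w k + t * v k) * v k ^ m\<bar> \<le> (\<Sum>k=1..r. C * b ^ m)"
      using g v C by (intro order_trans[OF sum_abs sum_mono]) (auto simp: abs_mult power_abs intro!: mult_mono power_mono)
    also have "\<dots> = (C * real r) ^ 1 * b ^ m" by simp
    also have "\<dots> \<le> (C * real r) ^ m * b ^ m"
      using Cr b m by (intro mult_right_mono power_increasing) auto
    finally show ?thesis by (simp add: \<kappa> power_mult_distrib)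
  qed
  let ?\<phi> = "\<lambda>(g::real \<Rightarrow> real) m t. \<Sum>k=1..r. g (w k + t * v k) * v k ^ m"
  have der: "(?\<phi> g m has_real_derivative ?\<phi> g' (Suc m) t) (at t)"
    if "\<And>x. (g has_real_derivative g' x) (at x)" for g g' m t
  proof -
    have "((\<lambda>t. g (w k + t * v k)) has_real_derivative g' (w k + t * v k) * v k) (at t)" for k
      by (rule DERIV_chain2[OF that]) (auto intro!: derivative_eq_intros)
    then show ?thesis
      by (intro DERIV_sum) (auto intro!: derivative_eq_intros simp: mult_ac)
  qed
  have b1: "\<bar>?\<phi> f1 (Suc 0) t\<bar> \<le> \<kappa>" for t using bound[where g=f1 and m="Suc 0" and t=t, OF bd(1)] by simp
  have b2: "\<bar>?\<phi> f2 (Suc (Suc 0)) t\<bar> \<le> \<kappa>\<^sup>2" for t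
    unfolding numeral_2_eq_2 by (rule bound[where g=f2, OF bd(2)]) simp
  have b3: "\<bar>?\<phi> f3 (Suc (Suc (Suc 0))) t\<bar> \<le> \<kappa> ^ 3" for t
    unfolding numeral_3_eq_3 by (rule bound[where g=f3, OF bd(3)]) simp
  have "(\<integral>\<^sup>+y. ennreal (exp (?\<phi> f 0 y)) \<partial>\<rho>) \<le> ennreal (1 + 4 * K * \<kappa> ^ 3) * (\<integral>\<^sup>+y. ennreal (exp (?\<phi> f 0 y)) \<partial>\<sigma>)"
  proof (rule standardized_exp_compare)
    show "(?\<phi> f 0 has_real_derivative ?\<phi> f1 (Suc 0) t) (at t)" for t by (rule der) (rule d)
    show "(?\<phi> f1 (Suc 0) has_real_derivative ?\<phi> f2 (Suc (Suc 0)) t) (at t)" for t by (rule der) (rule d)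
    show "(?\<phi> f2 (Suc (Suc 0)) has_real_derivative ?\<phi> f3 (Suc (Suc (Suc 0))) t) (at t)" for t by (rule der) (rule d)
  qed (fact b1 b2 b3 \<kappa>(2) K std)+
  then show ?thesis by (simp only: line_avg_def power_0 mult_1_right)
qed

text \<open>Multiplication by \<open>2 sin (\<pi> m / n)\<close> makes the sum telescope.\<close>

lemma sum_cos_equidistant:
  assumes "0 < m" "m < n"
  shows "(\<Sum>j=1..n. cos (2 * pi * real j * real m / real n)) = 0"
proof -
  define a where "a = pi * real m / real n"
  have a: "0 < a" "a < pi" using assms by (auto simp: a_def field_simps)
  then have s: "sin a > 0" by (rule sin_gt_zero)
  have "2 * sin a * (\<Sum>j=1..N. cos (2 * real j * a)) = sin ((2 * real N + 1) * a) - sin a" for N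
  proof (induction N)
    case (Suc N)
    have "sin (2 * real (Suc N) * a + a) - sin (2 * real (Suc N) * a - a) = 2 * sin a * cos (2 * real (Suc N) * a)"
      by (simp only: sin_add sin_diff) (simp add: algebra_simps)
    moreover have "2 * real (Suc N) * a + a = (2 * real (Suc N) + 1) * a" "2 * real (Suc N) * a - a = (2 * real N + 1) * a"
      by (simp_all add: algebra_simps)
    ultimately have "2 * sin a * cos (2 * real (Suc N) * a) = sin ((2 * real (Suc N) + 1) * a) - sin ((2 * real N + 1) * a)"
      by simp
    moreover have "2 * sin a * (\<Sum>j=1..Suc N. cos (2 * real j * a))
        = 2 * sin a * (\<Sum>j=1..N. cos (2 * real j * a)) + 2 * sin a * cos (2 * real (Suc N) * a)"
      by (simp add: distrib_left)
    ultimately show ?case using Suc by simp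
  qed simp
  from this[of n] have "2 * sin a * (\<Sum>j=1..n. cos (2 * real j * a)) = sin (2 * real m * pi + a) - sin a"
    using assms by (simp add: a_def field_simps)
  also have "\<dots> = 0" by (simp only: sin_add sin_2npi cos_2npi)
  finally have "(\<Sum>j=1..n. cos (2 * real j * a)) = 0" using s by simp
  then show ?thesis by (simp add: a_def mult_ac)
qed

definition cosine_direction :: "nat \<Rightarrow> nat \<Rightarrow> nat \<Rightarrow> real" where
  "cosine_direction n j k = sqrt (2 / real n) * cos (2 * pi * real j * real k / real n)"

text \<open>The product of two cosines is half the sum of those with frequencies \<open>k + l\<close> and \<open>k - l\<close>.  The
  condition \<open>k + l < n\<close> keeps the first frequency away from the multiples of \<open>n\<close>.\<close>

lemma gram_cosine_direction:
  assumes "1 \<le> k" "1 \<le> l" "k + l < n"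
  shows "gram (map (cosine_direction n) [1..<Suc n]) k l = (if k = l then 1 else 0)"
proof -
  have *: "(\<Sum>j=1..n. cos (2 * pi * real j * real k / real n) * cos (2 * pi * real j * real l / real n))
      = (if k = l then real n / 2 else 0)" if "l \<le> k" "1 \<le> l" "k + l < n" for k l
  proof -
    let ?c = "\<lambda>m j. cos (2 * pi * real j * real m / real n)"
    have "?c k j * ?c l j = (?c (k - l) j + ?c (k + l) j) / 2" for j
    proof -
      have "2 * pi * real j * real k / real n - 2 * pi * real j * real l / real n = 2 * pi * real j * real (k - l) / real n"
        "2 * pi * real j * real k / real n + 2 * pi * real j * real l / real n = 2 * pi * real j * real (k + l) / real n"
        using that(1) by (simp_all add: of_nat_diff right_diff_distrib distrib_left diff_divide_distrib add_divide_distrib)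
      then show ?thesis by (simp only: cos_times_cos)
    qed
    then have "(\<Sum>j=1..n. ?c k j * ?c l j) = ((\<Sum>j=1..n. ?c (k - l) j) + (\<Sum>j=1..n. ?c (k + l) j)) / 2"
      by (simp only: sum_divide_distrib[symmetric] sum.distrib)
    moreover have "(\<Sum>j=1..n. ?c (k + l) j) = 0"
      using that by (intro sum_cos_equidistant) auto
    moreover have "(\<Sum>j=1..n. ?c (k - l) j) = (if k = l then real n else 0)"
    proof (cases "k = l")
      case False
      then have "(\<Sum>j=1..n. ?c (k - l) j) = 0"
        using that by (intro sum_cos_equidistant) auto
      then show ?thesis using False by (simp only: if_False)
    qed simp
    ultimately have "(\<Sum>j=1..n. ?c k j * ?c l j) = ((if k = l then real n else 0) + 0) / 2"
      by (simp only:)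
    moreover have "((if k = l then real n else 0) + 0) / 2 = (if k = l then real n / 2 else 0)"
      by (cases "k = l") simp_all
    ultimately show ?thesis by (rule trans)
  qed
  have "(\<Sum>j=1..n. cos (2 * pi * real j * real k / real n) * cos (2 * pi * real j * real l / real n))
      = (if k = l then real n / 2 else 0)"
  proof (cases "l \<le> k")
    case True then show ?thesis using assms by (intro *) auto
  next
    case False
    have "(\<Sum>j=1..n. cos (2 * pi * real j * real k / real n) * cos (2 * pi * real j * real l / real n))
      = (\<Sum>j=1..n. cos (2 * pi * real j * real l / real n) * cos (2 * pi * real j * real k / real n))"
      by (rule sum.cong[OF refl mult.commute])
    also have "\<dots> = (if l = k then real n / 2 else 0)"
      using False assms by (intro *) auto
    also have "\<dots> = (if k = l then real n / 2 else 0)" using False by simp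
    finally show ?thesis .
  qed
  moreover have "gram (map (cosine_direction n) [1..<Suc n]) k l
    = 2 / real n * (\<Sum>j=1..n. cos (2 * pi * real j * real k / real n) * cos (2 * pi * real j * real l / real n))"
  proof -
    have "gram (map (cosine_direction n) [1..<Suc n]) k l = (\<Sum>j=1..n. cosine_direction n j k * cosine_direction n j l)"
      unfolding gram_def map_map comp_def
      by (simp only: interv_sum_list_conv_sum_set_nat set_upt atLeastLessThanSuc_atLeastAtMost)
    also have "\<dots> = (\<Sum>j=1..n. 2 / real n * (cos (2 * pi * real j * real k / real n) * cos (2 * pi * real j * real l / real n)))"
    proof (rule sum.cong[OF refl])
      have "sqrt (2 / real n) * sqrt (2 / real n) = 2 / real n" by simp
      moreover have "(s * a) * (s * b) = (s * s) * (a * b)" for s a b :: real by (simp add: mult_ac)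
      ultimately show "cosine_direction n j k * cosine_direction n j l
        = 2 / real n * (cos (2 * pi * real j * real k / real n) * cos (2 * pi * real j * real l / real n))" for j
        unfolding cosine_direction_def by (simp only:)
    qed
    finally show ?thesis by (simp only: sum_distrib_left)
  qed
  ultimately have "gram (map (cosine_direction n) [1..<Suc n]) k l = 2 / real n * (if k = l then real n / 2 else 0)"
    by (simp only:)
  also have "\<dots> = (if k = l then 1 else 0)" using assms(3) by simp
  finally show ?thesis .
qed

lemma cosine_sum_eq_direction:
  "cosine_sum X n k \<omega> = (\<Sum>j=1..n. X j \<omega> * cosine_direction n j k)"
  by (simp add: cosine_sum_def cosine_direction_def sum_distrib_left mult_ac)

text \<open>One exchange turns every \<open>X\<^sub>j\<close> into a standard normal variable.  The exchange works in both directions, since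
  the hypotheses on the two laws are the same.\<close>

lemma (in prob_space) exp_cosine_sum_compare:
  assumes indep: "indep_vars (\<lambda>_. borel) X {1..n}"
    and std: "\<And>j. j \<in> {1..n} \<Longrightarrow> standardized \<kappa> K (distr M borel (X j))"
    and stdN: "standardized \<kappa> K std_normal_distribution" and K: "0 \<le> K"
    and f: "smooth_test C f" and r: "1 \<le> r" "2 * r < n"
    and \<kappa>: "\<kappa> = C * real r * sqrt (2 / real n)" "\<kappa> \<le> 1 / 2"
  defines "E \<equiv> (\<integral>\<^sup>+\<omega>. ennreal (exp (\<Sum>k=1..r. f (cosine_sum X n k \<omega>))) \<partial>M)"
    and "G \<equiv> (\<integral>\<^sup>+x. ennreal (exp (f x)) \<partial>std_normal_distribution)"
  shows "E \<le> ennreal (1 + 4 * K * \<kappa> ^ 3) ^ n * G ^ r" and "G ^ r \<le> ennreal (1 + 4 * K * \<kappa> ^ 3) ^ n * E"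
proof -
  have fm: "f \<in> borel_measurable borel" by (rule smooth_test_measurable[OF f])
  have coord: "(\<lambda>w::nat \<Rightarrow> real. w k) \<in> borel_measurable borel" for k
    by (rule measurable_product_coordinates)
  note fc = measurable_compose[OF coord fm]
  define F where "F w = ennreal (exp (\<Sum>k=1..r. f (w k)))" for w :: "nat \<Rightarrow> real"
  have mF: "F \<in> borel_measurable borel"
    unfolding F_def using fc by measurable
  let ?N = std_normal_distribution
  let ?v = "cosine_direction n"
  let ?ps = "map (\<lambda>j. (distr M borel (X j), ?v j)) [1..<Suc n]"
  let ?qs = "map (\<lambda>v. (?N, v)) (map ?v [1..<Suc n])"
  have E: "E = line_avgs ?ps F (\<lambda>_. 0)"
    unfolding E_def cosine_sum_eq_direction using indep_line_avgs[OF indep mF, of ?v] by (simp only: F_def)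
  have "F = (\<lambda>w. \<Prod>k=1..r. ennreal (exp (f (w k))))"
    by (simp add: F_def exp_sum prod_ennreal fun_eq_iff)
  moreover have "(\<lambda>x. ennreal (exp (f x))) \<in> borel_measurable borel" using fm by measurable
  ultimately have G: "line_avgs ?qs F (\<lambda>_. 0) = G ^ r"
    unfolding G_def using r
    by (simp only:) (intro normal_avgs_orthonormal gram_cosine_direction, auto)
  have v: "\<bar>?v j k\<bar> \<le> sqrt (2 / real n)" for j k
    by (simp add: cosine_direction_def abs_mult mult_left_le)
  have len: "length ?ps = n" "length ?qs = n" by simp_all
  have lp: "line_measures ?ps" using std by (auto simp: standardized_def)
  have lq: "line_measures ?qs" by (rule line_measures_normal)
  have cmp: "line_avg \<rho> (?v j) F w \<le> ennreal (1 + 4 * K * \<kappa> ^ 3) * line_avg \<sigma> (?v j) F w"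
    if "standardized \<kappa> K \<rho>" "standardized \<kappa> K \<sigma>" for \<rho> \<sigma> j w
    unfolding F_def by (rule line_avg_exp_sum_compare[OF f v r(1) \<kappa> K that])
  have "list_all2 (\<lambda>p q. \<forall>w. line_avg (fst p) (snd p) F w \<le> ennreal (1 + 4 * K * \<kappa> ^ 3) * line_avg (fst q) (snd q) F w) ?ps ?qs"
    using cmp[OF std stdN] by (auto simp: list_all2_map1 list_all2_map2 list_all2_same simp del: upt_Suc)
  from line_avgs_exchange[OF lp lq mF this, of "\<lambda>_. 0"]
  show "E \<le> ennreal (1 + 4 * K * \<kappa> ^ 3) ^ n * G ^ r" by (simp only: E G len)
  have "list_all2 (\<lambda>p q. \<forall>w. line_avg (fst p) (snd p) F w \<le> ennreal (1 + 4 * K * \<kappa> ^ 3) * line_avg (fst q) (snd q) F w) ?qs ?ps"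
    using cmp[OF stdN std] by (auto simp: list_all2_map1 list_all2_map2 list_all2_same simp del: upt_Suc)
  from line_avgs_exchange[OF lq lp mF this, of "\<lambda>_. 0"]
  show "G ^ r \<le> ennreal (1 + 4 * K * \<kappa> ^ 3) ^ n * E" by (simp only: E G len)
qed

lemma integrable_normal_exp_abs: "integrable std_normal_distribution (\<lambda>x. exp (c * \<bar>x\<bar>))"
proof -
  have shift: "(\<integral>\<^sup>+x. ennreal (exp (a * x)) \<partial>std_normal_distribution) = ennreal (exp (a\<^sup>2 / 2))" for a
  proof -
    have "std_normal_density x * exp (a * x) = exp (a\<^sup>2 / 2) * normal_density a 1 x" for x
    proof -
      have "- x\<^sup>2 / 2 + a * x = a\<^sup>2 / 2 + - (x - a)\<^sup>2 / 2" by (simp add: power2_eq_square field_simps)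
      then show ?thesis by (simp add: normal_density_def exp_add[symmetric])
    qed
    then have "(\<integral>\<^sup>+x. ennreal (exp (a * x)) \<partial>std_normal_distribution)
        = (\<integral>\<^sup>+x. ennreal (exp (a\<^sup>2 / 2)) * ennreal (normal_density a 1 x) \<partial>lborel)"
      by (simp add: nn_integral_std_normal ennreal_mult[symmetric])
    also have "\<dots> = ennreal (exp (a\<^sup>2 / 2)) * (\<integral>\<^sup>+x. ennreal (normal_density a 1 x) \<partial>lborel)"
      by (rule nn_integral_cmult) measurable
    also have "(\<integral>\<^sup>+x. ennreal (normal_density a 1 x) \<partial>lborel) = 1"
      using prob_space.emeasure_space_1[OF prob_space_normal_density[of 1 a]] by (simp add: emeasure_density)
    finally show ?thesis by simp
  qed
  have i: "integrable std_normal_distribution (\<lambda>x. exp (a * x))" for a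
    by (rule integrableI_bounded) (simp_all add: shift)
  have "exp (c * \<bar>x\<bar>) \<le> \<bar>exp (c * x) + exp (- c * x)\<bar>" for x
    by (rule order_trans[OF _ abs_ge_self]) (simp add: abs_if)
  then show ?thesis
    by (intro Bochner_Integration.integrable_bound[OF Bochner_Integration.integrable_add[OF i[of c] i[of "- c"]]] AE_I2)
      auto
qed

lemma standardized_normal:
  assumes "\<kappa> \<le> 1" "6 * (\<integral>x. exp (2 * \<bar>x\<bar>) \<partial>std_normal_distribution) \<le> K"
  shows "standardized \<kappa> K std_normal_distribution"
proof -
  interpret N: real_distribution std_normal_distribution by (rule real_dist_normal_dist)
  have b: "\<bar>y\<bar> ^ 3 * exp (\<kappa> * \<bar>y\<bar>) \<le> 6 * exp (2 * \<bar>y\<bar>)" for y :: real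
  proof -
    have "\<bar>y\<bar> ^ 3 / fact 3 \<le> exp \<bar>y\<bar>"
      using exp_lower_Taylor_quadratic[of "\<bar>y\<bar>"] sum_le_suminf[OF summable_exp[of "\<bar>y\<bar>"], of "{3}"]
      by (simp add: exp_def scaleR_conv_of_real inverse_eq_divide)
    then have "\<bar>y\<bar> ^ 3 \<le> 6 * exp \<bar>y\<bar>" by (simp add: eval_nat_numeral)
    moreover have "exp (\<kappa> * \<bar>y\<bar>) \<le> exp \<bar>y\<bar>" using mult_right_mono[OF assms(1) abs_ge_zero[of y]] by simp
    ultimately have "\<bar>y\<bar> ^ 3 * exp (\<kappa> * \<bar>y\<bar>) \<le> 6 * exp \<bar>y\<bar> * exp \<bar>y\<bar>"
      by (intro mult_mono) auto
    then show ?thesis by (simp add: exp_double power2_eq_square mult.assoc)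
  qed
  have "(\<integral>\<^sup>+y. ennreal (\<bar>y\<bar> ^ 3 * exp (\<kappa> * \<bar>y\<bar>)) \<partial>std_normal_distribution)
      \<le> (\<integral>\<^sup>+y. ennreal (6 * exp (2 * \<bar>y\<bar>)) \<partial>std_normal_distribution)"
    using b by (intro nn_integral_mono ennreal_leI) auto
  also have "\<dots> = ennreal (\<integral>y. 6 * exp (2 * \<bar>y\<bar>) \<partial>std_normal_distribution)"
    by (intro nn_integral_eq_integral integrable_mult_right integrable_normal_exp_abs) auto
  also have "\<dots> \<le> ennreal K" using assms(2) by (intro ennreal_leI) simp
  finally show ?thesis
    using std_normal_in_space integrable_std_normal_distribution_moment[of 2]
      integral_std_normal_distribution_moment_odd[of 1] std_normal_distribution_even_moments(1)[of 1]
    by (simp add: standardized_def)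
qed

lemma (in prob_space) standardized_distr:
  assumes [measurable]: "Y \<in> borel_measurable M" and "(\<integral>\<omega>. Y \<omega> \<partial>M) = 0" "(\<integral>\<omega>. (Y \<omega>)\<^sup>2 \<partial>M) = 1"
    and "(\<integral>\<^sup>+\<omega>. ennreal (\<bar>Y \<omega>\<bar> ^ 3 * exp (\<bar>Y \<omega>\<bar> / \<tau>)) \<partial>M) \<le> ennreal K" and "\<kappa> \<le> 1 / \<tau>"
  shows "standardized \<kappa> K (distr M borel Y)"
proof -
  have "prob_space (distr M borel Y)" by (rule prob_space_distr) measurable
  moreover have "integrable M (\<lambda>\<omega>. (Y \<omega>)\<^sup>2)"
    using assms(3) not_integrable_integral_eq[of M "\<lambda>\<omega>. (Y \<omega>)\<^sup>2"] by fastforce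
  moreover have "(\<integral>\<^sup>+\<omega>. ennreal (\<bar>Y \<omega>\<bar> ^ 3 * exp (\<kappa> * \<bar>Y \<omega>\<bar>)) \<partial>M)
      \<le> (\<integral>\<^sup>+\<omega>. ennreal (\<bar>Y \<omega>\<bar> ^ 3 * exp (\<bar>Y \<omega>\<bar> / \<tau>)) \<partial>M)"
    using mult_right_mono[OF assms(5) abs_ge_zero]
    by (intro nn_integral_mono ennreal_leI mult_left_mono) auto
  ultimately show ?thesis using assms(2-4)
    by (auto simp: standardized_def space_prob_algebra integrable_distr_eq integral_distr nn_integral_distr intro: order_trans)
qed

definition gauss_log_mgf :: "(real \<Rightarrow> real) \<Rightarrow> real" where
  "gauss_log_mgf f = ln (\<integral>x. exp (f x) \<partial>std_normal_distribution)"

lemma smooth_test_integrable_exp: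
  assumes f: "smooth_test C f" shows "integrable std_normal_distribution (\<lambda>x. exp (f x))"
proof -
  have [measurable]: "f \<in> borel_measurable borel" by (rule smooth_test_measurable[OF f])
  obtain f1 where d: "\<And>x. (f has_real_derivative f1 x) (at x)" and bd: "\<And>x. \<bar>f1 x\<bar> \<le> C"
    using f unfolding smooth_test_def by metis
  have "f x \<le> f 0 + C * \<bar>x\<bar>" for x
  proof -
    have "norm (f x - f 0) \<le> C * norm (x - 0)"
      by (rule field_differentiable_bound[of UNIV f f1]) (use d bd in auto)
    then show ?thesis by simp
  qed
  then have "exp (f x) \<le> exp (f 0) * exp (C * \<bar>x\<bar>)" for x by (simp add: exp_add[symmetric])
  then show ?thesis
    by (intro Bochner_Integration.integrable_bound[OF integrable_mult_right[OF integrable_normal_exp_abs[of C], of "exp (f 0)"]]) auto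
qed

lemma integral_exp_pos:
  fixes f :: "'a \<Rightarrow> real"
  assumes "prob_space N" "integrable N (\<lambda>x. exp (f x))"
  shows "0 < (\<integral>x. exp (f x) \<partial>N)"
proof -
  interpret prob_space N by fact
  have "(\<integral>x. exp (f x) \<partial>N) \<noteq> 0"
  proof
    assume "(\<integral>x. exp (f x) \<partial>N) = 0"
    then have "AE x in N. exp (f x) = 0"
      using assms(2) by (subst (asm) integral_nonneg_eq_0_iff_AE) auto
    then show False by simp
  qed
  moreover have "0 \<le> (\<integral>x. exp (f x) \<partial>N)" by (rule Bochner_Integration.integral_nonneg) simp
  ultimately show ?thesis by linarith
qed

text \<open>The hypothesis \<open>r\<^sup>4 / n \<longrightarrow> 0\<close> enters exactly here: the \<open>n\<close> exchanges cost a factor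
  \<open>exp (O (n \<kappa>\<^sup>3))\<close> with \<open>n \<kappa>\<^sup>3 = O (r\<^sup>3 / sqrt n)\<close>, which has to be \<open>exp (o (r))\<close>.\<close>

lemma (in prob_space) exp_cosine_sum_asymptotics:
  assumes indep: "indep_vars (\<lambda>_. borel) X {1..}"
    and mean: "\<And>j. 1 \<le> j \<Longrightarrow> (\<integral>\<omega>. X j \<omega> \<partial>M) = 0"
    and var: "\<And>j. 1 \<le> j \<Longrightarrow> (\<integral>\<omega>. (X j \<omega>)\<^sup>2 \<partial>M) = 1"
    and \<tau>: "0 < \<tau>"
    and third: "\<And>j. 1 \<le> j \<Longrightarrow> (\<integral>\<^sup>+\<omega>. ennreal (\<bar>X j \<omega>\<bar> ^ 3 * exp (\<bar>X j \<omega>\<bar> / \<tau>)) \<partial>M) \<le> ennreal \<tau>"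
    and rpos: "\<And>n. 1 \<le> n \<Longrightarrow> 0 < r n"
    and r4: "(\<lambda>n. real (r n) ^ 4 / real n) \<longlonglongrightarrow> 0"
    and f: "smooth_test C f" and \<eta>: "0 < \<eta>"
  shows "\<forall>\<^sub>F n in sequentially.
      ennreal (exp (real (r n) * (gauss_log_mgf f - \<eta>)))
        \<le> (\<integral>\<^sup>+\<omega>. ennreal (exp (\<Sum>k=1..r n. f (cosine_sum X n k \<omega>))) \<partial>M) \<and>
      (\<integral>\<^sup>+\<omega>. ennreal (exp (\<Sum>k=1..r n. f (cosine_sum X n k \<omega>))) \<partial>M)
        \<le> ennreal (exp (real (r n) * (gauss_log_mgf f + \<eta>)))"
proof -
  interpret N: real_distribution std_normal_distribution by (rule real_dist_normal_dist)
  \<comment> \<open>one bound for the weighted third moments of all \<open>X\<^sub>j\<close> and of the normal law\<close>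
  define K where "K = max \<tau> (6 * (\<integral>x. exp (2 * \<bar>x\<bar>) \<partial>std_normal_distribution))"
  have K: "\<tau> \<le> K" "6 * (\<integral>x. exp (2 * \<bar>x\<bar>) \<partial>std_normal_distribution) \<le> K" "0 \<le> K"
    using \<tau> by (auto simp: K_def)
  define \<kappa> where "\<kappa> n = C * real (r n) * sqrt (2 / real n)" for n
  have C: "1 \<le> C" using f by (simp add: smooth_test_def)
  \<comment> \<open>up to a constant, \<open>\<kappa>\<^sup>4\<close> is the product of \<open>r\<^sup>4 / n\<close> and \<open>1 / n\<close>\<close>
  have \<kappa>4: "(\<kappa> n) ^ 4 = 4 * C ^ 4 * (real (r n) ^ 4 / real n) / real n" for n
    by (simp add: \<kappa>_def power_mult_distrib power_divide eval_nat_numeral field_simps flip: real_sqrt_mult)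
  have inv: "(\<lambda>n. 1 / real n) \<longlonglongrightarrow> 0" by (rule lim_1_over_n)
  have "(\<lambda>n. (\<kappa> n) ^ 4) \<longlonglongrightarrow> 4 * C ^ 4 * 0 * 0"
    unfolding \<kappa>4 using tendsto_mult[OF tendsto_mult[OF tendsto_const r4, of "4 * C ^ 4"] inv] by simp
  then have "(\<lambda>n. root 4 ((\<kappa> n) ^ 4)) \<longlonglongrightarrow> root 4 0" by (intro tendsto_real_root) simp
  moreover have "root 4 (\<kappa> n ^ 4) = \<kappa> n" for n
    using C by (intro real_root_power_cancel) (auto simp: \<kappa>_def)
  ultimately have \<kappa>0: "\<kappa> \<longlonglongrightarrow> 0" by simp
  have e1: "\<forall>\<^sub>F n in sequentially. \<kappa> n < min (1 / 2) (1 / \<tau>)"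
    using \<tau> by (intro order_tendstoD(2)[OF \<kappa>0]) simp
  have e2: "\<forall>\<^sub>F n in sequentially. real (r n) ^ 4 / real n < 1 / 2"
    by (rule order_tendstoD(2)[OF r4]) simp
  have "(\<lambda>n. 4 * K * (C ^ 3 * (2 * sqrt 2)) * sqrt (real (r n) ^ 4 / real n)) \<longlonglongrightarrow> 4 * K * (C ^ 3 * (2 * sqrt 2)) * sqrt 0"
    by (intro tendsto_intros r4)
  then have e3: "\<forall>\<^sub>F n in sequentially. 4 * K * (C ^ 3 * (2 * sqrt 2)) * sqrt (real (r n) ^ 4 / real n) < \<eta>"
    using \<eta> by (intro order_tendstoD(2)) auto
  have intf: "integrable std_normal_distribution (\<lambda>x. exp (f x))" by (rule smooth_test_integrable_exp[OF f])
  define G where "G = (\<integral>x. exp (f x) \<partial>std_normal_distribution)"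
  have Gpos: "0 < G" unfolding G_def by (rule integral_exp_pos[OF N.prob_space_axioms intf])
  have Gr: "(\<integral>\<^sup>+x. ennreal (exp (f x)) \<partial>std_normal_distribution) ^ m = ennreal (exp (real m * gauss_log_mgf f))" for m
  proof -
    have "(\<integral>\<^sup>+x. ennreal (exp (f x)) \<partial>std_normal_distribution) = ennreal G"
      unfolding G_def by (rule nn_integral_eq_integral[OF intf]) simp
    then show ?thesis
      using Gpos by (simp add: ennreal_power gauss_log_mgf_def G_def[symmetric] exp_of_nat_mult)
  qed
  show ?thesis
    using e1 e2 e3 eventually_ge_at_top[of "1::nat"]
  proof eventually_elim
    case (elim n)
    note rn = rpos[OF elim(4)]
    have r2: "2 * r n < n"
    proof -
      have "real (r n) ^ 1 \<le> real (r n) ^ 4" using rn by (intro power_increasing) auto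
      also have "\<dots> < real n / 2" using elim(2,4) by (simp add: field_simps)
      finally show ?thesis by simp
    qed
    have stdX: "standardized (\<kappa> n) K (distr M borel (X j))" if j: "j \<in> {1..n}" for j
    proof (rule standardized_distr)
      show "X j \<in> borel_measurable M" using indep j by (auto simp: indep_vars_def)
      show "(\<integral>\<^sup>+\<omega>. ennreal (\<bar>X j \<omega>\<bar> ^ 3 * exp (\<bar>X j \<omega>\<bar> / \<tau>)) \<partial>M) \<le> ennreal K"
        using third[of j] j ennreal_leI[OF K(1)] by auto
    qed (use mean var j elim(1) in auto)
    have stdN: "standardized (\<kappa> n) K std_normal_distribution"
      using elim(1) K(2) by (intro standardized_normal) auto
    have ind: "indep_vars (\<lambda>_. borel) X {1..n}" using indep by (rule indep_vars_subset) auto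
    let ?c = "1 + 4 * K * \<kappa> n ^ 3"
    have \<kappa>n: "0 \<le> \<kappa> n" using C by (simp add: \<kappa>_def)
    have "real n * (4 * K * \<kappa> n ^ 3) = real (r n) * (4 * K * (C ^ 3 * (2 * sqrt 2)) * sqrt (real (r n) ^ 4 / real n))"
    proof -
      have "sqrt (2 / real n) ^ 3 = 2 / real n * sqrt (2 / real n)" by (simp add: power3_eq_cube)
      moreover have "sqrt (real (r n) ^ 4 / real n) = real (r n) ^ 2 / sqrt (real n)"
        by (simp add: real_sqrt_divide real_sqrt_power[symmetric] power4_eq_xxxx power2_eq_square real_sqrt_mult)
      ultimately show ?thesis using elim(4)
        by (simp add: \<kappa>_def power_mult_distrib real_sqrt_divide field_simps power2_eq_square power3_eq_cube)
    qed
    also have "\<dots> \<le> real (r n) * \<eta>" using elim(3) by (intro mult_left_mono) auto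
    finally have small: "real n * (4 * K * \<kappa> n ^ 3) \<le> real (r n) * \<eta>" .
    have "?c ^ n \<le> exp (4 * K * \<kappa> n ^ 3) ^ n"
      using exp_ge_add_one_self[of "4 * K * \<kappa> n ^ 3"] K(3) \<kappa>n by (intro power_mono) auto
    also have "\<dots> = exp (real n * (4 * K * \<kappa> n ^ 3))" by (simp only: exp_of_nat_mult)
    also have "\<dots> \<le> exp (real (r n) * \<eta>)" using small by simp
    finally have c: "ennreal ?c ^ n \<le> ennreal (exp (real (r n) * \<eta>))"
      using K(3) \<kappa>n by (subst ennreal_power) (auto intro: ennreal_leI)
    note cmp = exp_cosine_sum_compare[OF ind stdX stdN K(3) f _ r2 \<kappa>_def[of n], unfolded Gr]
    let ?E = "\<integral>\<^sup>+\<omega>. ennreal (exp (\<Sum>k=1..r n. f (cosine_sum X n k \<omega>))) \<partial>M"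
    have "?E \<le> ennreal ?c ^ n * ennreal (exp (real (r n) * gauss_log_mgf f))"
      using rn elim(1) by (intro cmp) auto
    also have "\<dots> \<le> ennreal (exp (real (r n) * \<eta>)) * ennreal (exp (real (r n) * gauss_log_mgf f))"
      by (rule mult_right_mono[OF c]) simp
    also have "\<dots> = ennreal (exp (real (r n) * (gauss_log_mgf f + \<eta>)))"
      by (simp add: ennreal_mult[symmetric] exp_add[symmetric] algebra_simps)
    finally have upper: "?E \<le> ennreal (exp (real (r n) * (gauss_log_mgf f + \<eta>)))" .
    have "ennreal (exp (real (r n) * gauss_log_mgf f)) \<le> ennreal ?c ^ n * ?E"
      using rn elim(1) by (intro cmp) auto
    also have "\<dots> \<le> ennreal (exp (real (r n) * \<eta>)) * ?E" by (rule mult_right_mono[OF c]) simp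
    finally have "ennreal (exp (- (real (r n) * \<eta>))) * ennreal (exp (real (r n) * gauss_log_mgf f))
        \<le> ennreal (exp (- (real (r n) * \<eta>))) * (ennreal (exp (real (r n) * \<eta>)) * ?E)"
      by (rule mult_left_mono) simp
    then have "ennreal (exp (real (r n) * (gauss_log_mgf f - \<eta>))) \<le> ?E"
      by (simp add: mult.assoc[symmetric] ennreal_mult[symmetric] exp_add[symmetric] algebra_simps)
    with upper show ?case by simp
  qed
qed

section \<open>A countable family of test functions\<close>

lemma smooth_testI:
  assumes "1 \<le> C" "\<And>x. (f has_real_derivative f1 x) (at x)" "\<And>x. (f1 has_real_derivative f2 x) (at x)"
    "\<And>x. (f2 has_real_derivative f3 x) (at x)" "\<And>x. \<bar>f1 x\<bar> \<le> C" "\<And>x. \<bar>f2 x\<bar> \<le> C" "\<And>x. \<bar>f3 x\<bar> \<le> C"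
  shows "smooth_test C f"
  unfolding smooth_test_def using assms by blast

lemma smooth_test_add:
  assumes "smooth_test C f" "smooth_test D g" shows "smooth_test (C + D) (\<lambda>x. f x + g x)"
proof -
  obtain f1 f2 f3 where f: "1 \<le> C" "\<And>x. (f has_real_derivative f1 x) (at x)"
     "\<And>x. (f1 has_real_derivative f2 x) (at x)" "\<And>x. (f2 has_real_derivative f3 x) (at x)"
     "\<And>x. \<bar>f1 x\<bar> \<le> C" "\<And>x. \<bar>f2 x\<bar> \<le> C" "\<And>x. \<bar>f3 x\<bar> \<le> C"
    using assms(1) unfolding smooth_test_def by metis
  obtain g1 g2 g3 where g: "1 \<le> D" "\<And>x. (g has_real_derivative g1 x) (at x)"
     "\<And>x. (g1 has_real_derivative g2 x) (at x)" "\<And>x. (g2 has_real_derivative g3 x) (at x)"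
     "\<And>x. \<bar>g1 x\<bar> \<le> D" "\<And>x. \<bar>g2 x\<bar> \<le> D" "\<And>x. \<bar>g3 x\<bar> \<le> D"
    using assms(2) unfolding smooth_test_def by metis
  show ?thesis
  proof (rule smooth_testI)
    show "1 \<le> C + D" using f(1) g(1) by simp
    show "((\<lambda>x. f x + g x) has_real_derivative f1 x + g1 x) (at x)"
      "((\<lambda>x. f1 x + g1 x) has_real_derivative f2 x + g2 x) (at x)"
      "((\<lambda>x. f2 x + g2 x) has_real_derivative f3 x + g3 x) (at x)" for x
      by (rule DERIV_add[OF f(2) g(2)] DERIV_add[OF f(3) g(3)] DERIV_add[OF f(4) g(4)])+
    show "\<bar>f1 x + g1 x\<bar> \<le> C + D" for x by (rule order_trans[OF abs_triangle_ineq add_mono[OF f(5) g(5)]])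
    show "\<bar>f2 x + g2 x\<bar> \<le> C + D" for x by (rule order_trans[OF abs_triangle_ineq add_mono[OF f(6) g(6)]])
    show "\<bar>f3 x + g3 x\<bar> \<le> C + D" for x by (rule order_trans[OF abs_triangle_ineq add_mono[OF f(7) g(7)]])
  qed
qed

lemma smooth_test_affine:
  assumes "smooth_test C f" shows "smooth_test (C * (1 + \<bar>c\<bar>) * (1 + \<bar>m\<bar>) ^ 3) (\<lambda>x. c * f (m * (x - s)))"
proof -
  obtain f1 f2 f3 where C: "1 \<le> C" and d: "\<And>x. (f has_real_derivative f1 x) (at x)"
     "\<And>x. (f1 has_real_derivative f2 x) (at x)" "\<And>x. (f2 has_real_derivative f3 x) (at x)"
     and b: "\<And>x. \<bar>f1 x\<bar> \<le> C" "\<And>x. \<bar>f2 x\<bar> \<le> C" "\<And>x. \<bar>f3 x\<bar> \<le> C"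
    using assms unfolding smooth_test_def by metis
  have der: "((\<lambda>x. c * m ^ i * g (m * (x - s))) has_real_derivative c * m ^ Suc i * g' (m * (x - s))) (at x)"
    if "\<And>x. (g has_real_derivative g' x) (at x)" for g g' i x
  proof -
    have "((\<lambda>x. g (m * (x - s))) has_real_derivative g' (m * (x - s)) * m) (at x)"
      by (rule DERIV_chain2[OF that]) (auto intro!: derivative_eq_intros)
    then show ?thesis by (auto intro!: derivative_eq_intros simp: mult_ac)
  qed
  have bnd: "\<bar>c * m ^ i * g x\<bar> \<le> C * (1 + \<bar>c\<bar>) * (1 + \<bar>m\<bar>) ^ 3" if g: "\<And>x. \<bar>g x\<bar> \<le> C" and i: "i \<le> 3" for g x i
  proof -
    have "\<bar>m\<bar> ^ i \<le> (1 + \<bar>m\<bar>) ^ i" by (intro power_mono) auto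
    also have "\<dots> \<le> (1 + \<bar>m\<bar>) ^ 3" using i by (intro power_increasing) auto
    finally have "\<bar>g x\<bar> * \<bar>c\<bar> * \<bar>m\<bar> ^ i \<le> C * (1 + \<bar>c\<bar>) * (1 + \<bar>m\<bar>) ^ 3"
      using g[of x] C by (intro mult_mono) auto
    then show ?thesis by (simp add: abs_mult power_abs mult_ac)
  qed
  have "1 * 1 * 1 ^ 3 \<le> C * (1 + \<bar>c\<bar>) * (1 + \<bar>m\<bar>) ^ 3"
    using C by (intro mult_mono power_mono) auto
  then have C': "1 \<le> C * (1 + \<bar>c\<bar>) * (1 + \<bar>m\<bar>) ^ 3" by simp
  show ?thesis
  proof (rule smooth_testI[OF C'])
    show "((\<lambda>x. c * f (m * (x - s))) has_real_derivative c * m ^ Suc 0 * f1 (m * (x - s))) (at x)" for x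
      using der[OF d(1), of 0 x] by simp
    show "((\<lambda>x. c * m ^ Suc 0 * f1 (m * (x - s))) has_real_derivative c * m ^ Suc (Suc 0) * f2 (m * (x - s))) (at x)" for x
      by (rule der) (rule d)
    show "((\<lambda>x. c * m ^ Suc (Suc 0) * f2 (m * (x - s))) has_real_derivative c * m ^ Suc (Suc (Suc 0)) * f3 (m * (x - s))) (at x)" for x
      by (rule der) (rule d)
    show "\<bar>c * m ^ Suc 0 * f1 (m * (x - s))\<bar> \<le> C * (1 + \<bar>c\<bar>) * (1 + \<bar>m\<bar>) ^ 3" for x
      by (rule bnd) (rule b, simp)
    show "\<bar>c * m ^ Suc (Suc 0) * f2 (m * (x - s))\<bar> \<le> C * (1 + \<bar>c\<bar>) * (1 + \<bar>m\<bar>) ^ 3" for x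
      by (rule bnd) (rule b, simp)
    show "\<bar>c * m ^ Suc (Suc (Suc 0)) * f3 (m * (x - s))\<bar> \<le> C * (1 + \<bar>c\<bar>) * (1 + \<bar>m\<bar>) ^ 3" for x
      by (rule bnd) (rule b, simp)
  qed
qed

lemma tanh_square_le_1: "(tanh x)\<^sup>2 \<le> (1::real)"
  using tanh_real_bounds[of x] by (auto simp: abs_square_le_1 abs_le_iff)

lemma tanh_abs_le_1: "\<bar>tanh x\<bar> \<le> (1::real)"
  using tanh_real_bounds[of x] by (auto simp: abs_le_iff)

lemma DERIV_tanh: "(tanh has_real_derivative 1 - (tanh x)\<^sup>2) (at x)"
  by (auto intro!: derivative_eq_intros)

lemma DERIV_tanh2: "((\<lambda>x. 1 - (tanh x)\<^sup>2) has_real_derivative - 2 * tanh x * (1 - (tanh x)\<^sup>2)) (at x)"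
  by (auto intro!: derivative_eq_intros simp: algebra_simps)

lemma DERIV_tanh3: "((\<lambda>x. - 2 * tanh x * (1 - (tanh x)\<^sup>2)) has_real_derivative (6 * (tanh x)\<^sup>2 - 2) * (1 - (tanh x)\<^sup>2)) (at x)"
  by (auto intro!: derivative_eq_intros simp: algebra_simps power2_eq_square)

lemma tanh_bounds2: "\<bar>1 - (tanh x)\<^sup>2\<bar> \<le> 1" "\<bar>- 2 * tanh x * (1 - (tanh x)\<^sup>2)\<bar> \<le> (2::real)"
  "\<bar>(6 * (tanh x)\<^sup>2 - 2) * (1 - (tanh x)\<^sup>2)\<bar> \<le> (4::real)"
proof -
  note t = tanh_square_le_1[of x] zero_le_power2[of "tanh x"]
  show 1: "\<bar>1 - (tanh x)\<^sup>2\<bar> \<le> 1" using t by simp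
  have "\<bar>2 * tanh x\<bar> * \<bar>1 - (tanh x)\<^sup>2\<bar> \<le> 2 * 1"
    using 1 tanh_abs_le_1[of x] by (intro mult_mono) auto
  then show "\<bar>- 2 * tanh x * (1 - (tanh x)\<^sup>2)\<bar> \<le> 2" by (simp add: abs_mult)
  have "\<bar>6 * (tanh x)\<^sup>2 - 2\<bar> * \<bar>1 - (tanh x)\<^sup>2\<bar> \<le> 4 * 1"
  proof (intro mult_mono 1)
    show "\<bar>6 * (tanh x)\<^sup>2 - 2\<bar> \<le> 4" using t by (intro abs_leI) linarith+
  qed auto
  then show "\<bar>(6 * (tanh x)\<^sup>2 - 2) * (1 - (tanh x)\<^sup>2)\<bar> \<le> 4" by (simp add: abs_mult)
qed

lemma smooth_test_tanh: "smooth_test 4 tanh"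
  by (rule smooth_testI[OF _ DERIV_tanh DERIV_tanh2 DERIV_tanh3
      order_trans[OF tanh_bounds2(1)] order_trans[OF tanh_bounds2(2)] tanh_bounds2(3)]) simp_all

text \<open>A smooth substitute for \<open>\<bar>x\<bar>\<close>, whose exponential moments detect mass far from the origin.\<close>

definition ln_cosh :: "real \<Rightarrow> real" where "ln_cosh x = ln (cosh x)"

lemma ln_cosh_nonneg: "0 \<le> ln_cosh x"
  unfolding ln_cosh_def by (intro ln_ge_zero cosh_real_ge_1)

lemma ln_cosh_ge: "\<bar>x\<bar> - 1 \<le> ln_cosh x"
proof -
  have "exp \<bar>x\<bar> \<le> 2 * cosh x" by (simp add: cosh_def abs_if)
  also have "\<dots> \<le> exp 1 * cosh x"
    using exp_ge_add_one_self[of 1] cosh_real_pos[of x] by (intro mult_right_mono) auto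
  finally have "ln (exp \<bar>x\<bar>) \<le> ln (exp 1 * cosh x)"
    using cosh_real_pos[of x] by (intro ln_mono) auto
  then show ?thesis using cosh_real_pos[of x] by (simp add: ln_mult ln_cosh_def)
qed

lemma smooth_test_ln_cosh: "smooth_test 4 ln_cosh"
proof -
  have "(ln_cosh has_real_derivative tanh x) (at x)" for x
    unfolding ln_cosh_def using cosh_real_pos[of x]
    by (auto intro!: derivative_eq_intros simp: tanh_def)
  from _ this DERIV_tanh DERIV_tanh2 show ?thesis
    by (rule smooth_testI[OF _ _ _ _ order_trans[OF tanh_abs_le_1] order_trans[OF tanh_bounds2(1)]
      order_trans[OF tanh_bounds2(2)]]) simp_all
qed

text \<open>Rational parameters make the family countable, and concatenation of lists adds the functions.\<close>

definition tanh_sum :: "(rat \<times> rat \<times> rat) list \<Rightarrow> real \<Rightarrow> real" where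
  "tanh_sum l x = (\<Sum>(c, m, s)\<leftarrow>l. of_rat c * tanh (of_rat m * (x - of_rat s)))"

lemma tanh_sum_Nil [simp]: "tanh_sum [] x = 0"
  and tanh_sum_Cons [simp]: "tanh_sum ((c, m, s) # l) x = of_rat c * tanh (of_rat m * (x - of_rat s)) + tanh_sum l x"
  and tanh_sum_append: "tanh_sum (k @ l) x = tanh_sum k x + tanh_sum l x"
  by (auto simp: tanh_sum_def)

lemma smooth_test_tanh_sum: "\<exists>C. smooth_test C (tanh_sum l)"
proof (induction l)
  case Nil
  have "smooth_test 1 (tanh_sum [])"
    by (rule smooth_testI[of _ _ "\<lambda>_. 0" "\<lambda>_. 0" "\<lambda>_. 0"]) (simp_all add: tanh_sum_def[abs_def])
  then show ?case by blast
next
  case (Cons p l)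
  obtain c m s where p: "p = (c, m, s)" by (cases p)
  from Cons obtain C where "smooth_test C (tanh_sum l)" by blast
  from smooth_test_add[OF smooth_test_affine[OF smooth_test_tanh, of "of_rat c" "of_rat m" "of_rat s"] this]
  show ?case unfolding p tanh_sum_Cons[abs_def] by blast
qed

lemma tanh_sum_measurable [measurable]: "tanh_sum l \<in> borel_measurable borel"
  using smooth_test_tanh_sum smooth_test_measurable by blast

lemma tanh_sum_bounded: "\<exists>B. \<forall>x. \<bar>tanh_sum l x\<bar> \<le> B"
proof (induction l)
  case (Cons p l)
  obtain c m s where p: "p = (c, m, s)" by (cases p)
  from Cons obtain B where B: "\<And>x. \<bar>tanh_sum l x\<bar> \<le> B" by blast
  have "\<bar>tanh_sum (p # l) x\<bar> \<le> \<bar>of_rat c\<bar> * 1 + B" for x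
    unfolding p tanh_sum_Cons
  proof (rule order_trans[OF abs_triangle_ineq add_mono[OF _ B]])
    show "\<bar>of_rat c * tanh (of_rat m * (x - of_rat s))\<bar> \<le> \<bar>of_rat c\<bar> * (1::real)"
      unfolding abs_mult by (rule mult_left_mono[OF tanh_abs_le_1 abs_ge_zero])
  qed
  then show ?case by blast
qed (intro exI[of _ 0], simp)

text \<open>Properties that survive bounded pointwise limits extend from the countable family to all bounded
  Borel functions, by a monotone class argument.\<close>

inductive_set bounded_closure :: "(real \<Rightarrow> real) set" where
  base: "tanh_sum l \<in> bounded_closure"
| lim: "(\<And>n. f n \<in> bounded_closure) \<Longrightarrow> (\<And>n x. \<bar>f n x\<bar> \<le> B) \<Longrightarrow>
    (\<And>x. (\<lambda>n::nat. f n x) \<longlonglongrightarrow> g x) \<Longrightarrow> g \<in> bounded_closure"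

lemma bounded_closure_bounded: "f \<in> bounded_closure \<Longrightarrow> \<exists>B. \<forall>x. \<bar>f x\<bar> \<le> B"
proof (induction rule: bounded_closure.induct)
  case (base l) show ?case by (rule tanh_sum_bounded)
next
  case (lim f B g)
  have "\<bar>g x\<bar> \<le> B" for x
    by (intro LIMSEQ_le_const2[OF tendsto_rabs[OF lim.hyps(3)]] exI allI impI lim.hyps(2))
  then show ?case by blast
qed

lemma bounded_closure_measurable: "f \<in> bounded_closure \<Longrightarrow> f \<in> borel_measurable borel"
proof (induction rule: bounded_closure.induct)
  case (lim f B g)
  show ?case by (rule borel_measurable_LIMSEQ_real[OF lim.hyps(3) lim.IH])
qed (rule tanh_sum_measurable)

lemma bounded_closure_add:
  assumes f: "f \<in> bounded_closure" and g: "g \<in> bounded_closure"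
  shows "(\<lambda>x. f x + g x) \<in> bounded_closure"
proof -
  have base_add: "(\<lambda>x. tanh_sum l x + g x) \<in> bounded_closure" for l
    using g
  proof (induction rule: bounded_closure.induct)
    case (base k)
    have "(\<lambda>x. tanh_sum l x + tanh_sum k x) = tanh_sum (l @ k)" by (simp add: tanh_sum_append fun_eq_iff)
    then show ?case using bounded_closure.base by metis
  next
    case (lim f B g)
    obtain B' where B': "\<And>x. \<bar>tanh_sum l x\<bar> \<le> B'" using tanh_sum_bounded by blast
    have "\<bar>tanh_sum l x + f n x\<bar> \<le> B' + B" for n x
      by (rule order_trans[OF abs_triangle_ineq add_mono[OF B' lim.hyps(2)]])
    from lim.IH this show ?case
      by (rule bounded_closure.lim[of "\<lambda>n x. tanh_sum l x + f n x" "B' + B"]) (intro tendsto_intros lim.hyps)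
  qed
  obtain B' where B': "\<And>x. \<bar>g x\<bar> \<le> B'" using bounded_closure_bounded[OF g] by blast
  show ?thesis using f
  proof (induction rule: bounded_closure.induct)
    case (base l) show ?case by (rule base_add)
  next
    case (lim f B h)
    have "\<bar>f n x + g x\<bar> \<le> B + B'" for n x
      by (rule order_trans[OF abs_triangle_ineq add_mono[OF lim.hyps(2) B']])
    from lim.IH this show ?case
      by (rule bounded_closure.lim[of "\<lambda>n x. f n x + g x" "B + B'"]) (intro tendsto_intros lim.hyps)
  qed
qed

lemma bounded_closure_scale_rat:
  assumes "f \<in> bounded_closure" shows "(\<lambda>x. of_rat q * f x) \<in> bounded_closure"
  using assms
proof (induction rule: bounded_closure.induct)
  case (base l)
  have "(\<lambda>x. of_rat q * tanh_sum l x) = tanh_sum (map (\<lambda>(c, m, s). (q * c, m, s)) l)"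
  proof
    show "of_rat q * tanh_sum l x = tanh_sum (map (\<lambda>(c, m, s). (q * c, m, s)) l) x" for x
      by (induction l) (auto simp: of_rat_mult algebra_simps)
  qed
  then show ?case using bounded_closure.base by metis
next
  case (lim f B g)
  have "\<bar>of_rat q * f n x\<bar> \<le> \<bar>of_rat q\<bar> * B" for n x
    unfolding abs_mult by (intro mult_left_mono lim.hyps(2)) simp
  from lim.IH this show ?case
    by (rule bounded_closure.lim[of "\<lambda>n x. of_rat q * f n x" "\<bar>of_rat q\<bar> * B"]) (intro tendsto_intros lim.hyps)
qed

text \<open>The bounds keep the sequence to the right of \<open>a\<close> at a known rate, as the smoothed jumps in
  \<open>bounded_closure_greaterThan\<close> require.\<close>

lemma rat_sequence: "\<exists>q :: nat \<Rightarrow> rat. \<forall>n. a + 1 / real (Suc n) < of_rat (q n) \<and> of_rat (q n) < a + 2 / real (Suc n)"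
proof -
  have "\<exists>q. a + 1 / real (Suc n) < of_rat q \<and> of_rat q < a + 2 / real (Suc n)" for n
    by (rule of_rat_dense) (simp add: divide_strict_right_mono)
  then show ?thesis by metis
qed

lemma rat_sequence_tendsto:
  assumes q: "\<And>n. a + 1 / real (Suc n) < of_rat (q n) \<and> of_rat (q n) < a + 2 / real (Suc n)"
  shows "(\<lambda>n. of_rat (q n)) \<longlonglongrightarrow> (a::real)"
proof (rule real_tendsto_sandwich)
  have "(\<lambda>n. a + 1 / real (Suc n)) \<longlonglongrightarrow> a + 0" by (intro tendsto_intros LIMSEQ_Suc[OF lim_1_over_n])
  then show "(\<lambda>n. a + 1 / real (Suc n)) \<longlonglongrightarrow> a" by simp
  have "(\<lambda>n. a + 2 * (1 / real (Suc n))) \<longlonglongrightarrow> a + 2 * 0" by (intro tendsto_intros LIMSEQ_Suc[OF lim_1_over_n])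
  then show "(\<lambda>n. a + 2 / real (Suc n)) \<longlonglongrightarrow> a" by simp
qed (use q less_imp_le in \<open>auto intro!: always_eventually\<close>)

lemma bounded_closure_scale:
  assumes f: "f \<in> bounded_closure" shows "(\<lambda>x. c * f x) \<in> bounded_closure"
proof -
  obtain q where q: "\<And>n. c + 1 / real (Suc n) < of_rat (q n) \<and> of_rat (q n) < c + 2 / real (Suc n)"
    using rat_sequence[of c] by blast
  obtain B where B: "\<And>x. \<bar>f x\<bar> \<le> B" using bounded_closure_bounded[OF f] by blast
  have "\<bar>of_rat (q n)\<bar> \<le> \<bar>c\<bar> + 2" for n
  proof -
    have "2 / real (Suc n) \<le> 2" "0 \<le> 1 / real (Suc n)" by (simp_all add: field_simps)
    then show ?thesis using q[of n] by linarith
  qed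
  then have "\<bar>of_rat (q n) * f x\<bar> \<le> (\<bar>c\<bar> + 2) * B" for n x
    using B unfolding abs_mult by (intro mult_mono) auto
  from bounded_closure_scale_rat[OF f] this show ?thesis
    by (rule bounded_closure.lim[of "\<lambda>n x. of_rat (q n) * f x" "(\<bar>c\<bar> + 2) * B"])
      (intro tendsto_intros rat_sequence_tendsto[OF q])
qed

lemma bounded_closure_one: "(\<lambda>_. 1) \<in> bounded_closure"
proof (rule bounded_closure.lim[of "\<lambda>n. tanh_sum [(1, of_nat n, - of_nat n)]" 1])
  show "\<bar>tanh_sum [(1, of_nat n, - of_nat n)] x\<bar> \<le> 1" for n x
    using tanh_abs_le_1 by simp
  have "filterlim (\<lambda>n. real n * (x + real n)) at_top sequentially" for x :: real
    by (intro filterlim_at_top_mult_at_top filterlim_real_sequentially filterlim_tendsto_add_at_top[OF tendsto_const])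
  then show "(\<lambda>n. tanh_sum [(1, of_nat n, - of_nat n)] x) \<longlonglongrightarrow> 1" for x
    by (simp add: of_rat_minus) (rule filterlim_compose[OF tanh_real_at_top])
qed (rule bounded_closure.base)

text \<open>The hyperbolic tangents steepen at the rate \<open>n\<^sup>2\<close> while their centres approach \<open>a\<close> from the right at the rate
  \<open>1 / n\<close>; so the limit at \<open>a\<close> itself is that from the left.\<close>

lemma bounded_closure_greaterThan: "indicator {a<..} \<in> bounded_closure"
proof -
  obtain q where q: "\<And>n. a + 1 / real (Suc n) < of_rat (q n) \<and> of_rat (q n) < a + 2 / real (Suc n)"
    using rat_sequence[of a] by blast
  have Suc_top: "filterlim (\<lambda>n. real (Suc n)) at_top sequentially"
    by (rule filterlim_compose[OF filterlim_real_sequentially filterlim_Suc])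
  define f where "f n = tanh_sum [(1, (of_nat (Suc n))\<^sup>2, q n)]" for n
  have f: "f n x = tanh ((real (Suc n))\<^sup>2 * (x - of_rat (q n)))" for n x
    by (simp add: f_def of_rat_power of_rat_add)
  have "(\<lambda>x. 2 * indicator {a<..} x + (-1) * 1) \<in> bounded_closure"
  proof (rule bounded_closure.lim[of f 1])
    show "f n \<in> bounded_closure" for n unfolding f_def by (rule bounded_closure.base)
    show "\<bar>f n x\<bar> \<le> 1" for n x unfolding f by (rule tanh_abs_le_1)
    show "(\<lambda>n. f n x) \<longlonglongrightarrow> 2 * indicator {a<..} x + (-1) * 1" for x
    proof (cases "a < x")
      case True
      define d where "d = x - a"
      have d: "0 < d" using True by (simp add: d_def)
      have lim: "filterlim (\<lambda>n. real (Suc n) * (- 2 + d * real (Suc n))) at_top sequentially"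
        by (intro filterlim_at_top_mult_at_top Suc_top filterlim_tendsto_add_at_top[OF tendsto_const]
            filterlim_tendsto_pos_mult_at_top[OF tendsto_const d])
      have "real (Suc n) * (- 2 + d * real (Suc n)) \<le> (real (Suc n))\<^sup>2 * (x - of_rat (q n))" for n
      proof -
        have "(real (Suc n))\<^sup>2 * (d - 2 / real (Suc n)) \<le> (real (Suc n))\<^sup>2 * (x - of_rat (q n))"
          using q[of n] by (intro mult_left_mono) (auto simp: d_def)
        moreover have "(real (Suc n))\<^sup>2 * (d - 2 / real (Suc n)) = real (Suc n) * (- 2 + d * real (Suc n))"
          by (simp add: right_diff_distrib distrib_left power2_eq_square mult_ac del: of_nat_Suc)
        ultimately show ?thesis by (simp only:)
      qed
      then have "filterlim (\<lambda>n. (real (Suc n))\<^sup>2 * (x - of_rat (q n))) at_top sequentially"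
        by (intro filterlim_at_top_mono[OF lim always_eventually] allI)
      from filterlim_compose[OF tanh_real_at_top this] show ?thesis using True by (simp add: f)
    next
      case False
      have "(real (Suc n))\<^sup>2 * (x - of_rat (q n)) \<le> - real (Suc n)" for n
      proof -
        have "(real (Suc n))\<^sup>2 * (x - of_rat (q n)) \<le> (real (Suc n))\<^sup>2 * (- (1 / real (Suc n)))"
          using q[of n] False by (intro mult_left_mono) auto
        then show ?thesis by (simp add: power2_eq_square)
      qed
      moreover have lim: "filterlim (\<lambda>n. - real (Suc n)) at_bot sequentially"
        using Suc_top by (simp only: filterlim_uminus_at_top)
      ultimately have "filterlim (\<lambda>n. (real (Suc n))\<^sup>2 * (x - of_rat (q n))) at_bot sequentially"
        by (intro filterlim_at_bot_mono[OF lim always_eventually] allI)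
      from filterlim_compose[OF tanh_real_at_bot this] show ?thesis using False by (simp add: f)
    qed
  qed
  from bounded_closure_scale[OF bounded_closure_add[OF this bounded_closure_one], of "1 / 2"]
  show ?thesis by simp
qed

lemma bounded_closure_sum:
  "finite I \<Longrightarrow> (\<And>i. i \<in> I \<Longrightarrow> f i \<in> bounded_closure) \<Longrightarrow> (\<lambda>x. \<Sum>i\<in>I. f i x) \<in> bounded_closure"
proof (induction I rule: finite_induct)
  case empty
  show ?case using bounded_closure_scale[OF bounded_closure_one, of 0] by simp
next
  case (insert i I)
  then show ?case using bounded_closure_add[of "f i" "\<lambda>x. \<Sum>i\<in>I. f i x"] by simp
qed

lemma bounded_closure_indicator:
  assumes "A \<in> sets borel" shows "indicator A \<in> bounded_closure"
proof -
  have gen: "sets borel = sigma_sets UNIV (range (\<lambda>a::real. {a<..}))"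
    unfolding borel_Ioi by simp
  have "Int_stable (range (\<lambda>a::real. {a<..}))"
  proof (rule Int_stableI, safe)
    fix a b :: real
    have "{a<..} \<inter> {b<..} = {max a b<..}" by auto
    then show "{a<..} \<inter> {b<..} \<in> range greaterThan" by (rule range_eqI)
  qed
  moreover have "range (\<lambda>a::real. {a<..}) \<subseteq> Pow UNIV" by simp
  moreover have "A \<in> sigma_sets UNIV (range (\<lambda>a::real. {a<..}))" using assms unfolding gen .
  ultimately show ?thesis
  proof (induction rule: sigma_sets_induct_disjoint)
    case (basic A) then show ?case using bounded_closure_greaterThan by auto
  next
    case empty show ?case using bounded_closure_scale[OF bounded_closure_one, of 0] by simp
  next
    case (compl A)
    have "(\<lambda>x. (-1) * indicator A x + 1) \<in> bounded_closure"
      using bounded_closure_add[OF bounded_closure_scale[OF compl.IH] bounded_closure_one] .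
    moreover have "(\<lambda>x. (-1) * indicator A x + 1) = (indicator (UNIV - A) :: real \<Rightarrow> real)"
      by (auto simp: indicator_def fun_eq_iff)
    ultimately show ?case by simp
  next
    case (union A)
    have sum: "(\<Sum>i<n. indicator (A i) x) = (indicator (\<Union>i<n. A i) x :: real)" for n x
      by (rule indicator_UN_disjoint[symmetric])
        (rule finite_lessThan, rule disjoint_family_on_mono[OF subset_UNIV union.hyps(1)])
    show ?case
    proof (rule bounded_closure.lim[of "\<lambda>n x. \<Sum>i<n. indicator (A i) x" 1])
      show "(\<lambda>x. \<Sum>i<n. indicator (A i) x) \<in> bounded_closure" for n
        by (intro bounded_closure_sum finite_lessThan union.IH)
      show "\<bar>\<Sum>i<n. indicator (A i) x\<bar> \<le> (1::real)" for n x unfolding sum by (simp add: indicator_def)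
      show "(\<lambda>n. \<Sum>i<n. indicator (A i) x) \<longlonglongrightarrow> (indicator (\<Union> (range A)) x :: real)" for x
        unfolding sum by (rule LIMSEQ_indicator_UN)
    qed
  qed
qed

lemma bounded_borel_in_closure:
  assumes [measurable]: "f \<in> borel_measurable borel" and B: "\<And>x. \<bar>f x\<bar> \<le> B"
  shows "f \<in> bounded_closure"
proof (rule bounded_closure.lim)
  define a where "a n = real (Suc n)" for n
  have a: "0 < a n" "1 \<le> a n" for n by (auto simp: a_def)
  let ?I = "\<lambda>n. {\<lfloor>- (a n * B)\<rfloor>..\<lfloor>a n * B\<rfloor>}"
  let ?A = "\<lambda>n k. {x. \<lfloor>a n * f x\<rfloor> = k}"
  let ?f = "\<lambda>n x. \<Sum>k\<in>?I n. real_of_int k / a n * indicator (?A n k) x"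
  have eq: "?f n x = real_of_int \<lfloor>a n * f x\<rfloor> / a n" for n x
  proof -
    have "a n * f x \<le> a n * B" "- (a n * B) \<le> a n * f x"
      using B[of x] a(1)[of n] mult_left_mono[of "f x" B "a n"] mult_left_mono[of "- B" "f x" "a n"]
      by (auto simp: abs_le_iff)
    then have "\<lfloor>a n * f x\<rfloor> \<in> ?I n" by (auto intro: floor_mono)
    then show ?thesis
      by (subst sum.mono_neutral_right[of _ "{\<lfloor>a n * f x\<rfloor>}"]) (auto simp: indicator_def)
  qed
  show "?f n \<in> bounded_closure" for n
    by (rule bounded_closure_sum[OF finite_atLeastAtMost_int])
      (rule bounded_closure_scale, rule bounded_closure_indicator, measurable)
  have err: "\<bar>?f n x - f x\<bar> \<le> 1 / a n" for n x
  proof -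
    define z where "z = real_of_int \<lfloor>a n * f x\<rfloor>"
    have "\<bar>z - a n * f x\<bar> \<le> 1" unfolding z_def by linarith
    then have "\<bar>z - a n * f x\<bar> / \<bar>a n\<bar> \<le> 1 / a n" using a(1)[of n] by (simp add: divide_right_mono)
    moreover have "z / a n - f x = (z - a n * f x) / a n" using a(1)[of n] by (simp add: field_simps)
    ultimately show ?thesis unfolding eq z_def[symmetric] by (simp only: abs_divide)
  qed
  show "\<bar>?f n x\<bar> \<le> B + 1" for n x
  proof -
    have "1 / a n \<le> 1" using a(2)[of n] by simp
    then show ?thesis using err[of n x] B[of x] by linarith
  qed
  show "(\<lambda>n. ?f n x) \<longlonglongrightarrow> f x" for x
  proof (rule Lim_null_comparison[THEN LIM_zero_cancel])
    show "\<forall>\<^sub>F n in sequentially. norm (?f n x - f x) \<le> 1 / a n" using err by (auto intro!: always_eventually)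
    show "(\<lambda>n. 1 / a n) \<longlonglongrightarrow> 0" unfolding a_def by (rule LIMSEQ_Suc[OF lim_1_over_n])
  qed
qed

section \<open>Duality between entropy and exponential moments\<close>

text \<open>Both sides are continuous under bounded pointwise limits.\<close>

lemma exp_moment_bound_extends:
  assumes nu: "real_distribution \<nu>" and beta: "real_distribution \<beta>"
    and base: "\<And>l. (\<integral>x. tanh_sum l x \<partial>\<nu>) \<le> a + ln (\<integral>x. exp (tanh_sum l x) \<partial>\<beta>)"
    and f: "f \<in> borel_measurable borel" "\<And>x. \<bar>f x\<bar> \<le> B"
  shows "(\<integral>x. f x \<partial>\<nu>) \<le> a + ln (\<integral>x. exp (f x) \<partial>\<beta>)"
proof -
  interpret nu: real_distribution \<nu> by fact
  interpret beta: real_distribution \<beta> by fact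
  have "f \<in> bounded_closure" by (rule bounded_borel_in_closure[OF f])
  then show ?thesis
  proof (induction rule: bounded_closure.induct)
    case (base l) show ?case by (rule assms(3))
  next
    case (lim f B g)
    note [measurable] = bounded_closure_measurable[OF lim.hyps(1)]
    have gc: "g \<in> bounded_closure" using lim.hyps by (rule bounded_closure.lim)
    note [measurable] = bounded_closure_measurable[OF gc]
    have gB: "\<bar>g x\<bar> \<le> B" for x
      by (intro LIMSEQ_le_const2[OF tendsto_rabs[OF lim.hyps(3)]] exI allI impI lim.hyps(2))
    have eB: "exp (f n x) \<le> exp B" for n x using lim.hyps(2)[of n x] by simp
    have 1: "(\<lambda>n. \<integral>x. f n x \<partial>\<nu>) \<longlonglongrightarrow> (\<integral>x. g x \<partial>\<nu>)"
      by (rule integral_dominated_convergence[where w="\<lambda>_. B"]) (use lim.hyps in auto)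
    have 2: "(\<lambda>n. \<integral>x. exp (f n x) \<partial>\<beta>) \<longlonglongrightarrow> (\<integral>x. exp (g x) \<partial>\<beta>)"
      by (rule integral_dominated_convergence[where w="\<lambda>_. exp B"])
        (use eB lim.hyps(3) in \<open>auto intro!: AE_I2 tendsto_exp\<close>)
    have "integrable \<beta> (\<lambda>x. exp (g x))"
      by (rule beta.integrable_const_bound[where B="exp B"]) (use gB in \<open>auto simp: abs_le_iff\<close>)
    then have "0 < (\<integral>x. exp (g x) \<partial>\<beta>)" by (rule integral_exp_pos[OF beta.prob_space_axioms])
    then have "(\<lambda>n. a + ln (\<integral>x. exp (f n x) \<partial>\<beta>)) \<longlonglongrightarrow> a + ln (\<integral>x. exp (g x) \<partial>\<beta>)"
      using 2 by (intro tendsto_intros) auto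
    from LIMSEQ_le[OF 1 this] lim.IH show ?case by blast
  qed
qed

text \<open>The test function is \<open>t \<cdot> 1\<^sub>A\<close>, together with \<open>ln (1 + x) \<le> x\<close>.\<close>

lemma exp_moment_bound_indicator:
  assumes nu: "real_distribution \<nu>" and beta: "real_distribution \<beta>"
    and base: "\<And>l. (\<integral>x. tanh_sum l x \<partial>\<nu>) \<le> a + ln (\<integral>x. exp (tanh_sum l x) \<partial>\<beta>)"
    and A[measurable]: "A \<in> sets borel" and t: "0 < t"
  shows "t * measure \<nu> A \<le> a + (exp t - 1) * measure \<beta> A"
proof -
  interpret nu: real_distribution \<nu> by fact
  interpret beta: real_distribution \<beta> by fact
  have "(\<integral>x. t * indicator A x \<partial>\<nu>) \<le> a + ln (\<integral>x. exp (t * indicator A x) \<partial>\<beta>)"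
    by (rule exp_moment_bound_extends[OF nu beta base, where B=t]) (use t in \<open>auto simp: indicator_def\<close>)
  also have "(\<lambda>x. exp (t * indicator A x)) = (\<lambda>x. 1 + (exp t - 1) * indicator A x)"
    by (auto simp: indicator_def)
  also have "(\<integral>x. 1 + (exp t - 1) * indicator A x \<partial>\<beta>) = 1 + (exp t - 1) * measure \<beta> A"
  proof -
    have "integrable \<beta> (indicat_real A)"
      by (rule integrable_real_indicator) (auto simp: beta.emeasure_eq_measure)
    then show ?thesis using beta.prob_space by simp
  qed
  also have "ln (1 + (exp t - 1) * measure \<beta> A) \<le> (exp t - 1) * measure \<beta> A"
    using t by (intro ln_add_one_self_le_self mult_nonneg_nonneg) auto
  finally show ?thesis by simp
qed

text \<open>For \<open>a = 0\<close> the bound for \<open>t \<cdot> 1\<^sub>A\<close> gives \<open>\<nu> A \<le> \<beta> A\<close> to first order in \<open>t\<close>.\<close>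

lemma exp_moment_bound_imp_eq:
  assumes nu: "real_distribution \<nu>" and beta: "real_distribution \<beta>"
    and base: "\<And>l. (\<integral>x. tanh_sum l x \<partial>\<nu>) \<le> ln (\<integral>x. exp (tanh_sum l x) \<partial>\<beta>)"
  shows "\<nu> = \<beta>"
proof -
  interpret nu: real_distribution \<nu> by fact
  interpret beta: real_distribution \<beta> by fact
  have le: "measure \<nu> A \<le> measure \<beta> A" if A: "A \<in> sets borel" for A
  proof -
    have inv: "filterlim (\<lambda>n. 1 / real (Suc n)) (at 0) sequentially"
      using LIMSEQ_Suc[OF lim_1_over_n] by (auto simp: filterlim_at)
    have "((\<lambda>z::real. (exp z - 1) / z) \<longlongrightarrow> 1) (at 0)" by (rule lim_exp_minus_1)
    from tendsto_mult[OF filterlim_compose[OF this inv] tendsto_const]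
    have lim: "(\<lambda>n. (exp (1 / real (Suc n)) - 1) / (1 / real (Suc n)) * measure \<beta> A) \<longlonglongrightarrow> 1 * measure \<beta> A" .
    have "measure \<nu> A \<le> (exp (1 / real (Suc n)) - 1) / (1 / real (Suc n)) * measure \<beta> A" for n
    proof -
      define t where "t = 1 / real (Suc n)"
      have t: "0 < t" by (simp add: t_def)
      have "t * measure \<nu> A \<le> 0 + (exp t - 1) * measure \<beta> A"
        by (rule exp_moment_bound_indicator[OF nu beta _ A t]) (use base in simp)
      then have "measure \<nu> A \<le> (exp t - 1) / t * measure \<beta> A" using t by (simp add: field_simps)
      then show ?thesis by (simp only: t_def)
    qed
    then show ?thesis using LIMSEQ_le_const[OF lim, of "measure \<nu> A"] by auto
  qed
  show ?thesis
  proof (rule measure_eqI)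
    fix A assume "A \<in> sets \<nu>"
    then have A: "A \<in> sets borel" by simp
    then have "measure \<nu> (UNIV - A) \<le> measure \<beta> (UNIV - A)" by (intro le) auto
    then have "measure \<beta> A \<le> measure \<nu> A"
      using A nu.prob_compl[of A] beta.prob_compl[of A] by simp
    with le[OF A] show "emeasure \<nu> A = emeasure \<beta> A"
      by (simp add: nu.emeasure_eq_measure beta.emeasure_eq_measure)
  qed simp
qed

text \<open>The argument, not the value, is clipped: so \<open>y = 0\<close> gives \<open>- n\<close>, whereas \<open>ln 0 = 0\<close>.\<close>

definition clip_ln :: "nat \<Rightarrow> real \<Rightarrow> real" where
  "clip_ln n y = ln (max (exp (- real n)) (min y (exp (real n))))"

lemma clip_ln_measurable [measurable]: "clip_ln n \<in> borel_measurable borel"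
  unfolding clip_ln_def[abs_def] by measurable

lemma exp_clip_ln: "exp (clip_ln n y) = max (exp (- real n)) (min y (exp (real n)))"
  unfolding clip_ln_def by (subst exp_ln) (auto simp: less_max_iff_disj)

lemma abs_clip_ln_le: "\<bar>clip_ln n y\<bar> \<le> real n"
proof -
  have "exp (- real n) \<le> exp (clip_ln n y)" "exp (clip_ln n y) \<le> exp (real n)"
    unfolding exp_clip_ln by auto
  then show ?thesis by (simp add: abs_le_iff)
qed

lemma clip_ln_eq_ln: "exp (- real n) \<le> y \<Longrightarrow> y \<le> exp (real n) \<Longrightarrow> clip_ln n y = ln y"
  by (simp add: clip_ln_def)

lemma eventually_clip_ln:
  assumes "0 < y" shows "\<forall>\<^sub>F n in sequentially. clip_ln n y = ln y"
proof -
  obtain m where m: "\<bar>ln y\<bar> \<le> real m" using real_arch_simple by blast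
  have "clip_ln n y = ln y" if "m \<le> n" for n
  proof -
    have "- real n \<le> ln y" "ln y \<le> real n" using m that by auto
    then have "exp (- real n) \<le> y" "y \<le> exp (real n)"
      using assms exp_le_cancel_iff[of "- real n" "ln y"] exp_le_cancel_iff[of "ln y" "real n"] by simp_all
    then show ?thesis by (rule clip_ln_eq_ln)
  qed
  then show ?thesis by (auto simp: eventually_sequentially)
qed

text \<open>The bound for \<open>t \<cdot> 1\<^sub>A\<close> with large \<open>t\<close> gives absolute continuity.  For a density \<open>g\<close> with respect to
  the normal law the optimal test function is \<open>ln g\<close>; it is truncated, and Fatou's lemma removes the
  truncation.\<close>

lemma gauss_entropy_le:
  assumes nu: "real_distribution \<nu>"
    and base: "\<And>l. (\<integral>x. tanh_sum l x \<partial>\<nu>) \<le> a + gauss_log_mgf (tanh_sum l)"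
  shows "gauss_entropy \<nu> \<le> ereal a"
proof -
  let ?N = std_normal_distribution
  note N = real_dist_normal_dist
  interpret nu: real_distribution \<nu> by fact
  interpret N: real_distribution ?N by (rule N)
  note base' = base[unfolded gauss_log_mgf_def]
  have a0: "0 \<le> a" using base'[of "[]"] N.prob_space by simp
  have "measure \<nu> A = 0" if A: "A \<in> sets borel" and 0: "measure ?N A = 0" for A
  proof (rule ccontr)
    assume "measure \<nu> A \<noteq> 0"
    then have p: "0 < measure \<nu> A" by (simp add: zero_less_measure_iff)
    define t where "t = (a + 1) / measure \<nu> A"
    have "t * measure \<nu> A \<le> a + (exp t - 1) * measure ?N A"
      by (rule exp_moment_bound_indicator[OF nu N base' A]) (use a0 p in \<open>simp add: t_def\<close>)
    then show False using p 0 by (simp add: t_def)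
  qed
  then have ac: "absolutely_continuous ?N \<nu>"
    by (auto simp: absolutely_continuous_def null_sets_def N.emeasure_eq_measure nu.emeasure_eq_measure)
  obtain g where [measurable]: "g \<in> borel_measurable borel" and g: "AE x in ?N. RN_deriv ?N \<nu> x = ennreal (g x)"
    and g0: "\<And>x. 0 \<le> g x"
    using N.real_RN_deriv[OF nu.finite_measure_axioms ac] by auto
  have "density ?N (RN_deriv ?N \<nu>) = \<nu>" using ac by (intro N.density_RN_deriv) auto
  also have "density ?N (RN_deriv ?N \<nu>) = density ?N (\<lambda>x. ennreal (g x))"
    using g by (intro density_cong) auto
  finally have nug: "\<nu> = density ?N (\<lambda>x. ennreal (g x))" ..
  have ig: "(\<integral>\<^sup>+x. ennreal (g x) \<partial>?N) = ennreal 1"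
    using nu.emeasure_space_1 unfolding nug by (simp add: emeasure_density)
  have int_g: "integrable ?N g" by (rule integrableI_nn_integral_finite[OF _ _ ig]) (use g0 in auto)
  have g1: "(\<integral>x. g x \<partial>?N) = 1" by (subst integral_eq_nn_integral) (use g0 ig in auto)
  define h where "h n x = clip_ln n (g x)" for n x
  have hm [measurable]: "h n \<in> borel_measurable borel" for n unfolding h_def[abs_def] by measurable
  have eh: "exp (h n x) = max (exp (- real n)) (min (g x) (exp (real n)))" for n x
    unfolding h_def by (rule exp_clip_ln)
  have hb: "\<bar>h n x\<bar> \<le> real n" for n x
    unfolding h_def by (rule abs_clip_ln_le)
  \<comment> \<open>adding 1 makes Fatou's lemma applicable, by \<open>y ln y \<ge> y - 1\<close>\<close>
  have gh: "0 \<le> g x * h n x + 1" for n x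
  proof (cases "g x = 0")
    case False
    then have gp: "0 < g x" using g0[of x] by simp
    show ?thesis
    proof (cases "g x \<le> 1")
      case True
      have "min (g x) (exp (real n)) = g x" using True one_le_exp_iff[of "real n"] by linarith
      then have "ln (g x) \<le> h n x" unfolding h_def clip_ln_def using gp by (intro ln_mono) auto
      then have "g x * ln (g x) \<le> g x * h n x" using gp by (intro mult_left_mono) auto
      moreover have "ln (1 / g x) \<le> 1 / g x - 1" using gp by (intro ln_le_minus_one) auto
      then have "g x * (1 - 1 / g x) \<le> g x * ln (g x)" using gp by (intro mult_left_mono) (auto simp: ln_div)
      then have "g x - 1 \<le> g x * ln (g x)" using gp by (simp add: right_diff_distrib)
      ultimately show ?thesis using gp by linarith
    next
      case False
      then have "exp 0 \<le> exp (h n x)" unfolding eh by (simp add: le_max_iff_disj)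
      then have "0 \<le> h n x" by simp
      then show ?thesis using gp by simp
    qed
  qed simp
  have bnd: "(\<integral>\<^sup>+x. ennreal (g x * h n x + 1) \<partial>?N) \<le> ennreal (a + exp (- real n) + 1)" for n
  proof -
    have igh: "integrable ?N (\<lambda>x. g x * h n x)"
      by (rule Bochner_Integration.integrable_bound[OF integrable_mult_right[OF int_g, of "real n"]])
        (use mult_left_mono[OF hb g0] g0 in \<open>auto simp: abs_mult mult.commute intro!: AE_I2\<close>)
    have ieh: "integrable ?N (\<lambda>x. exp (h n x))"
      by (rule N.integrable_const_bound[where B="exp (real n)"]) (use hb in \<open>auto simp: abs_le_iff\<close>)
    have "(\<integral>x. exp (h n x) \<partial>?N) \<le> (\<integral>x. g x + exp (- real n) \<partial>?N)"
    proof (rule integral_mono[OF ieh])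
      show "exp (h n x) \<le> g x + exp (- real n)" for x
        unfolding eh using g0[of x] exp_gt_zero[of "- real n"] by linarith
    qed (use int_g in simp)
    also have "\<dots> = 1 + exp (- real n)"
      using int_g g1 N.prob_space by simp
    finally have up: "(\<integral>x. exp (h n x) \<partial>?N) \<le> 1 + exp (- real n)" .
    have "(\<integral>x. g x * h n x \<partial>?N) = (\<integral>x. h n x \<partial>\<nu>)"
      unfolding nug using g0 by (subst integral_density) auto
    also have "\<dots> \<le> a + ln (\<integral>x. exp (h n x) \<partial>?N)"
      by (rule exp_moment_bound_extends[OF nu N base' hm hb])
    also have "\<dots> \<le> a + ln (1 + exp (- real n))"
      by (intro add_left_mono ln_mono up integral_exp_pos[OF N.prob_space_axioms ieh])
    also have "\<dots> \<le> a + exp (- real n)" using ln_add_one_self_le_self[of "exp (- real n)"] by simp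
    finally have "(\<integral>x. g x * h n x + 1 \<partial>?N) \<le> a + exp (- real n) + 1"
      using igh N.prob_space by simp
    then show ?thesis using gh igh by (subst nn_integral_eq_integral) (auto intro: ennreal_leI)
  qed
  have lim: "(\<lambda>n. g x * h n x + 1) \<longlonglongrightarrow> g x * ln (g x) + 1" for x
  proof (cases "g x = 0")
    case False
    then have gp: "0 < g x" using g0[of x] by simp
    have "\<forall>\<^sub>F n in sequentially. g x * h n x + 1 = g x * ln (g x) + 1"
      using eventually_clip_ln[OF gp] by eventually_elim (simp add: h_def)
    then show ?thesis by (rule tendsto_eventually)
  qed simp
  have nn: "0 \<le> g x * ln (g x) + 1" for x using LIMSEQ_le_const[OF lim, of 0] gh by blast
  have "(\<integral>\<^sup>+x. ennreal (g x * ln (g x) + 1) \<partial>?N) = (\<integral>\<^sup>+x. liminf (\<lambda>n. ennreal (g x * h n x + 1)) \<partial>?N)"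
    using tendsto_ennrealI[OF lim] by (intro nn_integral_cong lim_imp_Liminf[symmetric]) auto
  also have "\<dots> \<le> liminf (\<lambda>n. \<integral>\<^sup>+x. ennreal (g x * h n x + 1) \<partial>?N)"
    by (rule nn_integral_liminf) measurable
  also have "\<dots> \<le> liminf (\<lambda>n. ennreal (a + exp (- real n) + 1))"
    by (intro Liminf_mono always_eventually allI bnd)
  also have "\<dots> = ennreal (a + 0 + 1)"
  proof (rule lim_imp_Liminf)
    have "filterlim (\<lambda>n. - real n) at_bot sequentially"
      using filterlim_real_sequentially by (simp only: filterlim_uminus_at_top)
    from filterlim_compose[OF exp_at_bot this]
    show "(\<lambda>n. ennreal (a + exp (- real n) + 1)) \<longlonglongrightarrow> ennreal (a + 0 + 1)"
      by (intro tendsto_ennrealI tendsto_intros)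
  qed simp
  finally have fin: "(\<integral>\<^sup>+x. ennreal (g x * ln (g x) + 1) \<partial>?N) \<le> ennreal (a + 1)" by simp
  have i1: "integrable ?N (\<lambda>x. g x * ln (g x) + 1)"
    by (rule integrableI_bounded) (use fin nn in \<open>auto intro: le_less_trans\<close>)
  have "integrable ?N (\<lambda>x. g x * ln (g x) + 1 - 1)" by (intro Bochner_Integration.integrable_diff i1) simp
  then have i2: "integrable ?N (\<lambda>x. g x * ln (g x))" by simp
  have "(\<integral>x. g x * ln (g x) + 1 \<partial>?N) \<le> a + 1"
  proof (rule ennreal_le_iff[THEN iffD1])
    have "(\<integral>\<^sup>+x. ennreal (g x * ln (g x) + 1) \<partial>?N) = ennreal (\<integral>x. g x * ln (g x) + 1 \<partial>?N)"
      by (intro nn_integral_eq_integral i1 AE_I2 nn)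
    then show "ennreal (\<integral>x. g x * ln (g x) + 1 \<partial>?N) \<le> ennreal (a + 1)" using fin by (simp only:)
  qed (use a0 in simp)
  then have le: "(\<integral>x. g x * ln (g x) \<partial>?N) \<le> a" using i2 N.prob_space by simp
  let ?f = "\<lambda>x. std_normal_density x * g x"
  have pos: "0 < std_normal_density x" for x by (rule normal_density_pos) simp
  have eq: "ln (?f x / std_normal_density x) * ?f x = std_normal_density x * (g x * ln (g x))" for x
    using pos[of x] by simp
  have "finite_entropy_density \<nu> ?f"
    unfolding finite_entropy_density_def eq
  proof (intro conjI allI)
    show "0 \<le> ?f x" for x using g0[of x] pos[of x] by simp
    show "\<nu> = density lborel (\<lambda>x. ennreal (?f x))"
      unfolding nug using g0 less_imp_le[OF pos] by (subst density_density_eq) (auto simp: ennreal_mult)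
    show "integrable lborel (\<lambda>x. std_normal_density x * (g x * ln (g x)))"
      using i2 less_imp_le[OF pos] by (subst (asm) integrable_density) auto
  qed measurable
  from gauss_entropy_eq[OF this]
  have "gauss_entropy \<nu> = ereal (\<integral>x. std_normal_density x * (g x * ln (g x)) \<partial>lborel)" by (simp only: eq)
  also have "(\<integral>x. std_normal_density x * (g x * ln (g x)) \<partial>lborel) = (\<integral>x. g x * ln (g x) \<partial>?N)"
    using less_imp_le[OF pos] by (subst integral_density) auto
  finally show ?thesis using le by simp
qed

section \<open>Finite subcovers on sets of bounded exponential moment\<close>

text \<open>By Markov's inequality the sets \<open>{\<nu>. \<integral> ln cosh d\<nu> \<le> b}\<close> are tight, and Helly's selection theorem makes
  them sequentially compact; for a countable cover that is enough.\<close>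

lemma finite_subcover_bounded_moment:
  assumes F: "closedin weak_topology F" and O: "\<And>i::nat. openin weak_topology (O' i)" "F \<subseteq> (\<Union>i. O' i)"
  shows "\<exists>m. \<forall>\<nu>\<in>F. (\<integral>\<^sup>+x. ennreal (ln_cosh x) \<partial>\<nu>) \<le> ennreal b \<longrightarrow> (\<exists>i<m. \<nu> \<in> O' i)"
proof (rule ccontr)
  assume "\<not> ?thesis"
  then obtain \<nu> where \<nu>: "\<And>m. \<nu> m \<in> F" "\<And>m. (\<integral>\<^sup>+x. ennreal (ln_cosh x) \<partial>\<nu> m) \<le> ennreal b"
     "\<And>m i. i < m \<Longrightarrow> \<nu> m \<notin> O' i" by metis
  have sp: "\<nu> m \<in> space (prob_algebra borel)" for m
    using \<nu>(1)[of m] closedin_subset[OF F] by (auto simp: topspace_weak_topology)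
  then have rd: "real_distribution (\<nu> m)" for m by (simp add: real_distribution_prob_algebra)
  have [measurable]: "ln_cosh \<in> borel_measurable borel"
    by (rule smooth_test_measurable[OF smooth_test_ln_cosh])
  have "tight \<nu>" unfolding tight_def
  proof (intro conjI allI impI rd)
    fix \<epsilon> :: real assume \<epsilon>: "0 < \<epsilon>"
    define L where "L = (\<bar>b\<bar> + 1) / \<epsilon>"
    have L: "0 < L" using \<epsilon> by (simp add: L_def add_pos_nonneg)
    have "measure (\<nu> m) {- (L + 1)<..L + 1} > 1 - \<epsilon>" for m
    proof -
      interpret real_distribution "\<nu> m" by (rule rd)
      have "emeasure (\<nu> m) {x \<in> UNIV. 1 \<le> ennreal (1 / L) * ennreal (ln_cosh x)}
          \<le> ennreal (1 / L) * (\<integral>\<^sup>+x. ennreal (ln_cosh x) * indicator UNIV x \<partial>\<nu> m)"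
        by (rule nn_integral_Markov_inequality) auto
      also have "\<dots> \<le> ennreal (1 / L) * ennreal b" using \<nu>(2)[of m] by (intro mult_left_mono) auto
      also have "\<dots> \<le> ennreal (1 / L) * ennreal \<bar>b\<bar>" by (intro mult_left_mono ennreal_leI) auto
      also have "\<dots> = ennreal (\<bar>b\<bar> / L)" using L by (simp add: ennreal_mult[symmetric])
      finally have "measure (\<nu> m) {x. 1 \<le> ennreal (1 / L) * ennreal (ln_cosh x)} \<le> \<bar>b\<bar> / L"
        using L by (simp add: emeasure_eq_measure)
      moreover have "{x. 1 \<le> ennreal (1 / L) * ennreal (ln_cosh x)} = {x. L \<le> ln_cosh x}"
        using L ln_cosh_nonneg by (auto simp: ennreal_mult[symmetric] field_simps)
      moreover have "measure (\<nu> m) {x. L \<le> ln_cosh x} = 1 - measure (\<nu> m) {x. ln_cosh x < L}"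
      proof -
        have "UNIV - {x. ln_cosh x < L} = {x. L \<le> ln_cosh x}" by auto
        then show ?thesis using prob_compl[of "{x. ln_cosh x < L}"] by simp
      qed
      moreover have "measure (\<nu> m) {x. ln_cosh x < L} \<le> measure (\<nu> m) {- (L + 1)<..L + 1}"
      proof (rule finite_measure_mono)
        show "{x. ln_cosh x < L} \<subseteq> {- (L + 1)<..L + 1}"
        proof
          fix x assume "x \<in> {x. ln_cosh x < L}"
          then show "x \<in> {- (L + 1)<..L + 1}" using ln_cosh_ge[of x] by auto
        qed
      qed simp
      moreover have "\<bar>b\<bar> / L < \<epsilon>" using \<epsilon> by (simp add: L_def field_simps)
      ultimately show ?thesis by simp
    qed
    then show "\<exists>a b. a < b \<and> (\<forall>n. measure (\<nu> n) {a<..b} > 1 - \<epsilon>)" using L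
      by (intro exI[of _ "- (L + 1)"] exI[of _ "L + 1"]) auto
  qed
  from tight_imp_convergent_subsubsequence[OF this strict_mono_id]
  obtain s N where s: "strict_mono (s :: nat \<Rightarrow> nat)" and N: "real_distribution N" "weak_conv_m (\<nu> \<circ> id \<circ> s) N"
    by blast
  have lim: "limitin weak_topology (\<nu> \<circ> s) N sequentially"
    using N sp by (subst limitin_weak_topology_iff) (auto simp: real_distribution_prob_algebra)
  have "N \<in> F" by (rule limitin_closedin[OF lim F]) (use \<nu>(1) in auto)
  then obtain i where i: "N \<in> O' i" using O(2) by blast
  have "\<forall>\<^sub>F n in sequentially. (\<nu> \<circ> s) n \<in> O' i"
    using lim O(1) i by (auto simp: limitin_def)
  moreover have "\<forall>\<^sub>F n in sequentially. i < n" by (rule eventually_gt_at_top)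
  ultimately have "\<forall>\<^sub>F n in sequentially. False"
  proof eventually_elim
    case (elim n)
    have "i < s n" using elim(2) seq_suble[OF s, of n] by linarith
    from \<nu>(3)[OF this] elim(1) show False by simp
  qed
  then show False by simp
qed

section \<open>From exponential moments to large deviations\<close>

lemma nn_integral_empirical:
  assumes [measurable]: "g \<in> borel_measurable borel" and g: "\<And>x. 0 \<le> g x" and rp: "0 < m"
  shows "(\<integral>\<^sup>+x. ennreal (g x) \<partial>empirical_measure m s) = ennreal ((\<Sum>k=1..m. g (s k)) / real m)"
proof -
  have "(\<integral>\<^sup>+x. ennreal (g x) \<partial>empirical_measure m s)
      = (\<integral>\<^sup>+k. ennreal (g (s k)) \<partial>point_measure {1..m} (\<lambda>_. ennreal (1 / real m)))"
    unfolding empirical_measure_eq_distr[OF rp] using rp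
    by (subst nn_integral_distr) (auto simp: uniform_count_measure_def)
  also have "\<dots> = (\<Sum>k=1..m. ennreal (1 / real m) * ennreal (g (s k)))"
    by (subst nn_integral_point_measure_finite) (auto simp: mult.commute)
  also have "\<dots> = (\<Sum>k=1..m. ennreal (g (s k) / real m))"
    using g by (intro sum.cong refl) (simp add: ennreal_mult[symmetric])
  also have "\<dots> = ennreal (\<Sum>k=1..m. g (s k) / real m)"
    using g by (subst sum_ennreal) auto
  finally show ?thesis by (simp add: sum_divide_distrib)
qed

lemma continuous_tanh_sum: "continuous_on UNIV (tanh_sum l)"
proof -
  obtain C f1 where "\<And>x. (tanh_sum l has_real_derivative f1 x) (at x)"
    using smooth_test_tanh_sum[of l] unfolding smooth_test_def by metis
  then show ?thesis by (intro continuous_at_imp_continuous_on ballI DERIV_isCont)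
qed

lemma continuous_map_tanh_sum: "continuous_map weak_topology euclideanreal (\<lambda>\<nu>. \<integral>x. tanh_sum l x \<partial>\<nu>)"
proof (rule continuous_map_weak_topology_integral[OF continuous_tanh_sum])
  show "bounded (range (tanh_sum l))" using tanh_sum_bounded[of l] by (auto simp: bounded_iff)
qed

lemma openin_tanh_sum_greater: "openin weak_topology {\<nu> \<in> topspace weak_topology. c < (\<integral>x. tanh_sum l x \<partial>\<nu>)}"
  using openin_continuous_map_preimage[OF continuous_map_tanh_sum, of "{c<..}" l] by simp

lemma openin_tanh_sum_less: "openin weak_topology {\<nu> \<in> topspace weak_topology. (\<integral>x. tanh_sum l x \<partial>\<nu>) < c}"
  using openin_continuous_map_preimage[OF continuous_map_tanh_sum, of "{..<c}" l] by simp

lemma real_distribution_normalized: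
  assumes [measurable]: "F \<in> borel_measurable borel" and F: "integrable std_normal_distribution F" "\<And>x. 0 \<le> F x"
    and W: "W = (\<integral>x. F x \<partial>std_normal_distribution)" "0 < W"
  shows "real_distribution (density std_normal_distribution (\<lambda>x. ennreal (F x / W)))" (is "real_distribution ?\<beta>")
proof -
  have "emeasure ?\<beta> (space ?\<beta>) = (\<integral>\<^sup>+x. ennreal (F x / W) \<partial>std_normal_distribution)"
    by (simp add: emeasure_density)
  also have "\<dots> = ennreal (\<integral>x. F x / W \<partial>std_normal_distribution)"
    using F W by (intro nn_integral_eq_integral) auto
  also have "(\<integral>x. F x / W \<partial>std_normal_distribution) = 1" using W by simp
  finally have "prob_space ?\<beta>" by (intro prob_spaceI) simp
  then show ?thesis by (auto simp: real_distribution_def real_distribution_axioms_def)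
qed

lemma integral_normalized:
  fixes g :: "real \<Rightarrow> real"
  assumes [measurable]: "F \<in> borel_measurable borel" "g \<in> borel_measurable borel" and "\<And>x. 0 \<le> F x" "0 < W"
  shows "(\<integral>x. g x \<partial>density std_normal_distribution (\<lambda>x. ennreal (F x / W)))
    = (\<integral>x. F x * g x \<partial>std_normal_distribution) / W"
proof -
  have "(\<integral>x. g x \<partial>density std_normal_distribution (\<lambda>x. ennreal (F x / W)))
      = (\<integral>x. F x * g x / W \<partial>std_normal_distribution)"
    using assms(3,4) by (subst integral_density) auto
  then show ?thesis by simp
qed

locale gaussian_exp_moments = prob_space M for M :: "'a measure" +
  fixes S :: "nat \<Rightarrow> nat \<Rightarrow> 'a \<Rightarrow> real" and r :: "nat \<Rightarrow> nat"
  assumes S_measurable [measurable]: "\<And>n k. S n k \<in> borel_measurable M"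
    and r_at_top: "filterlim (\<lambda>n. real (r n)) at_top sequentially"
    and exp_moments: "\<And>C f \<eta>. smooth_test C f \<Longrightarrow> 0 < \<eta> \<Longrightarrow> \<forall>\<^sub>F n in sequentially.
      ennreal (exp (real (r n) * (gauss_log_mgf f - \<eta>)))
        \<le> (\<integral>\<^sup>+\<omega>. ennreal (exp (\<Sum>k=1..r n. f (S n k \<omega>))) \<partial>M) \<and>
      (\<integral>\<^sup>+\<omega>. ennreal (exp (\<Sum>k=1..r n. f (S n k \<omega>))) \<partial>M)
        \<le> ennreal (exp (real (r n) * (gauss_log_mgf f + \<eta>)))"
begin

definition \<mu> :: "nat \<Rightarrow> 'a \<Rightarrow> real measure" where "\<mu> n \<omega> = empirical_measure (r n) (\<lambda>k. S n k \<omega>)"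

definition weight :: "(real \<Rightarrow> real) \<Rightarrow> nat \<Rightarrow> 'a \<Rightarrow> ennreal" where
  "weight f n \<omega> = ennreal (exp (\<Sum>k=1..r n. f (S n k \<omega>)))"

lemma r_eventually_ge: "\<forall>\<^sub>F n in sequentially. c \<le> real (r n)"
  using r_at_top by (simp add: filterlim_at_top)

lemma exp_eventually_ge:
  assumes "0 < c" shows "\<forall>\<^sub>F n in sequentially. b \<le> exp (real (r n) * c)"
  using r_eventually_ge[of "b / c"]
proof eventually_elim
  case (elim n)
  then have "b \<le> real (r n) * c" using assms by (simp add: field_simps)
  also have "\<dots> \<le> exp (real (r n) * c)" using exp_ge_add_one_self[of "real (r n) * c"] by linarith
  finally show ?case .
qed

lemma weight_measurable:
  assumes "f \<in> borel_measurable borel" shows "weight f n \<in> borel_measurable M"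
proof -
  have "(\<lambda>\<omega>. f (S n k \<omega>)) \<in> borel_measurable M" for k
    by (rule measurable_compose[OF S_measurable assms])
  then show ?thesis unfolding weight_def[abs_def] by measurable
qed

lemma chernoff:
  assumes f: "smooth_test C f" and g: "smooth_test D g" and \<eta>: "0 < \<eta>"
  shows "\<forall>\<^sub>F n in sequentially.
    (\<integral>\<^sup>+\<omega>. weight f n \<omega> * indicator {\<omega>. real (r n) * c \<le> (\<Sum>k=1..r n. g (S n k \<omega>))} \<omega> \<partial>M)
      \<le> ennreal (exp (real (r n) * (gauss_log_mgf (\<lambda>x. f x + g x) + \<eta> - c)))"
  using exp_moments[OF smooth_test_add[OF f g] \<eta>]
proof eventually_elim
  case (elim n)
  let ?fg = "\<lambda>x. f x + g x"
  have "(\<integral>\<^sup>+\<omega>. weight f n \<omega> * indicator {\<omega>. real (r n) * c \<le> (\<Sum>k=1..r n. g (S n k \<omega>))} \<omega> \<partial>M)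
      \<le> (\<integral>\<^sup>+\<omega>. ennreal (exp (- (real (r n) * c))) * weight ?fg n \<omega> \<partial>M)"
  proof (rule nn_integral_mono)
    fix \<omega>
    show "weight f n \<omega> * indicator {\<omega>. real (r n) * c \<le> (\<Sum>k=1..r n. g (S n k \<omega>))} \<omega>
      \<le> ennreal (exp (- (real (r n) * c))) * weight ?fg n \<omega>"
    proof (cases "real (r n) * c \<le> (\<Sum>k=1..r n. g (S n k \<omega>))")
      case True
      then have "exp (\<Sum>k=1..r n. f (S n k \<omega>)) \<le> exp (- (real (r n) * c)) * exp (\<Sum>k=1..r n. ?fg (S n k \<omega>))"
        by (simp add: sum.distrib exp_add[symmetric])
      then show ?thesis using True by (simp add: weight_def ennreal_mult[symmetric] ennreal_leI)
    qed simp
  qed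
  also have "\<dots> = ennreal (exp (- (real (r n) * c))) * (\<integral>\<^sup>+\<omega>. weight ?fg n \<omega> \<partial>M)"
    by (rule nn_integral_cmult[OF weight_measurable[OF smooth_test_measurable[OF smooth_test_add[OF f g]]]])
  also have "\<dots> \<le> ennreal (exp (- (real (r n) * c))) * ennreal (exp (real (r n) * (gauss_log_mgf ?fg + \<eta>)))"
    using elim by (intro mult_left_mono) (auto simp: weight_def)
  also have "\<dots> = ennreal (exp (real (r n) * (gauss_log_mgf ?fg + \<eta> - c)))"
    by (simp add: ennreal_mult[symmetric] exp_add[symmetric] algebra_simps)
  finally show ?case .
qed

text \<open>With \<open>f = 0\<close> this gives the upper bound of the large deviation principle; with other \<open>f\<close> it shows concentration
  under the tilted law.  The rate is strictly better than \<open>a\<close> since finitely many separations leave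
  a positive margin, and for \<open>a = 0\<close> that makes the probability exponentially small.\<close>

lemma tilted_upper_bound:
  assumes F: "closedin weak_topology F" and f: "smooth_test C f"
    and sep: "\<And>\<nu>. \<nu> \<in> F \<Longrightarrow>
      \<exists>d. gauss_log_mgf (\<lambda>x. f x + tanh_sum d x) - gauss_log_mgf f + a < (\<integral>x. tanh_sum d x \<partial>\<nu>)"
  shows "\<exists>a'>a. \<forall>\<^sub>F n in sequentially.
    (\<integral>\<^sup>+\<omega>. weight f n \<omega> * indicator {\<omega>. \<mu> n \<omega> \<in> F} \<omega> \<partial>M) \<le> ennreal (exp (real (r n) * (gauss_log_mgf f - a')))"
proof -
  let ?\<Lambda> = gauss_log_mgf
  \<comment> \<open>the number \<open>i\<close> encodes a test function and a margin \<open>1 / (m + 1)\<close> by which it separates\<close>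
  define dd :: "nat \<Rightarrow> (rat \<times> rat \<times> rat) list" where "dd i = fst (from_nat i :: _ \<times> nat)" for i
  define mm :: "nat \<Rightarrow> nat" where "mm i = snd (from_nat i :: (rat \<times> rat \<times> rat) list \<times> nat)" for i
  define cc where "cc i = ?\<Lambda> (\<lambda>x. f x + tanh_sum (dd i) x) - ?\<Lambda> f + a + 1 / real (Suc (mm i))" for i
  define O' where "O' i = {\<nu> \<in> topspace weak_topology. cc i < (\<integral>x. tanh_sum (dd i) x \<partial>\<nu>)}" for i
  have cover: "F \<subseteq> (\<Union>i. O' i)"
  proof
    fix \<nu> assume \<nu>: "\<nu> \<in> F"
    obtain d where d: "?\<Lambda> (\<lambda>x. f x + tanh_sum d x) - ?\<Lambda> f + a < (\<integral>x. tanh_sum d x \<partial>\<nu>)" using sep[OF \<nu>] by blast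
    obtain m where m: "inverse (real (Suc m)) < (\<integral>x. tanh_sum d x \<partial>\<nu>) - (?\<Lambda> (\<lambda>x. f x + tanh_sum d x) - ?\<Lambda> f + a)"
      using reals_Archimedean[of "(\<integral>x. tanh_sum d x \<partial>\<nu>) - (?\<Lambda> (\<lambda>x. f x + tanh_sum d x) - ?\<Lambda> f + a)"] d by auto
    have "\<nu> \<in> O' (to_nat (d, m))"
      using m \<nu> closedin_subset[OF F] by (auto simp: O'_def cc_def dd_def mm_def inverse_eq_divide)
    then show "\<nu> \<in> (\<Union>i. O' i)" by blast
  qed
  \<comment> \<open>large enough for the part with \<open>\<integral> ln cosh d\<mu> > b\<close> to have exponent at most \<open>\<Lambda> f - a - 1\<close>\<close>
  define b where "b = ?\<Lambda> (\<lambda>x. f x + ln_cosh x) - ?\<Lambda> f + a + 2"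
  obtain N where N: "\<And>\<nu>. \<nu> \<in> F \<Longrightarrow> (\<integral>\<^sup>+x. ennreal (ln_cosh x) \<partial>\<nu>) \<le> ennreal b \<Longrightarrow> \<exists>i<N. \<nu> \<in> O' i"
    using finite_subcover_bounded_moment[OF F _ cover, of b] openin_tanh_sum_greater unfolding O'_def by blast
  \<comment> \<open>a common lower bound of the finitely many margins\<close>
  define \<delta> where "\<delta> = 1 / real (Suc (\<Sum>i<N. mm i))"
  have \<delta>: "0 < \<delta>" "\<delta> \<le> 1" by (simp_all add: \<delta>_def del: of_nat_sum)
  have \<delta>mm: "\<delta> \<le> 1 / real (Suc (mm i))" if "i < N" for i
  proof -
    have "mm i \<le> (\<Sum>i<N. mm i)" using that by (intro member_le_sum) auto
    then show ?thesis unfolding \<delta>_def by (intro frac_le) (simp_all del: of_nat_sum)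
  qed
  define A where "A i n = {\<omega>. real (r n) * cc i \<le> (\<Sum>k=1..r n. tanh_sum (dd i) (S n k \<omega>))}" for i n
  define B where "B n = {\<omega>. real (r n) * b \<le> (\<Sum>k=1..r n. ln_cosh (S n k \<omega>))}" for n
  have lcm [measurable]: "ln_cosh \<in> borel_measurable borel" by (rule smooth_test_measurable[OF smooth_test_ln_cosh])
  have fm: "f \<in> borel_measurable borel" by (rule smooth_test_measurable[OF f])
  have ev_i: "\<forall>\<^sub>F n in sequentially. (\<integral>\<^sup>+\<omega>. weight f n \<omega> * indicator (A i n) \<omega> \<partial>M)
      \<le> ennreal (exp (real (r n) * (?\<Lambda> f - a - 3 * \<delta> / 4)))" if i: "i < N" for i
  proof -
    obtain D where D: "smooth_test D (tanh_sum (dd i))" using smooth_test_tanh_sum by blast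
    have "0 < \<delta> / 4" using \<delta> by simp
    from chernoff[OF f D this, of "cc i"] show ?thesis
    proof eventually_elim
      case (elim n)
      have "?\<Lambda> (\<lambda>x. f x + tanh_sum (dd i) x) + \<delta> / 4 - cc i \<le> ?\<Lambda> f - a - 3 * \<delta> / 4"
        using \<delta>mm[OF i] by (simp add: cc_def)
      then show ?case unfolding A_def using elim
        by (elim order_trans) (intro ennreal_leI, simp add: mult_left_mono)
    qed
  qed
  have ev_B: "\<forall>\<^sub>F n in sequentially. (\<integral>\<^sup>+\<omega>. weight f n \<omega> * indicator (B n) \<omega> \<partial>M)
      \<le> ennreal (exp (real (r n) * (?\<Lambda> f - a - 3 * \<delta> / 4)))"
    using chernoff[OF f smooth_test_ln_cosh zero_less_one, of b]
  proof eventually_elim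
    case (elim n)
    have "?\<Lambda> (\<lambda>x. f x + ln_cosh x) + 1 - b \<le> ?\<Lambda> f - a - 3 * \<delta> / 4"
      using \<delta> by (simp add: b_def)
    then show ?case unfolding B_def using elim
      by (elim order_trans) (intro ennreal_leI, simp add: mult_left_mono)
  qed
  have "0 < \<delta> / 2" using \<delta> by simp
  note ev_N = exp_eventually_ge[OF this, of "real (Suc N)"]
  have ev_all: "\<forall>\<^sub>F n in sequentially. \<forall>i\<in>{..<N}. (\<integral>\<^sup>+\<omega>. weight f n \<omega> * indicator (A i n) \<omega> \<partial>M)
      \<le> ennreal (exp (real (r n) * (?\<Lambda> f - a - 3 * \<delta> / 4)))"
    using ev_i by (intro eventually_ball_finite) auto
  have "\<forall>\<^sub>F n in sequentially. (\<integral>\<^sup>+\<omega>. weight f n \<omega> * indicator {\<omega>. \<mu> n \<omega> \<in> F} \<omega> \<partial>M)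
      \<le> ennreal (exp (real (r n) * (?\<Lambda> f - (a + \<delta> / 4))))"
    using ev_all ev_B ev_N r_eventually_ge[of 1]
  proof eventually_elim
    case (elim n)
    have rn: "0 < r n" using elim(4) by simp
    let ?e = "exp (real (r n) * (?\<Lambda> f - a - 3 * \<delta> / 4))"
    have [measurable]: "(\<lambda>\<omega>. weight f n \<omega>) \<in> borel_measurable M" using weight_measurable[OF fm] .
    have mind: "(\<lambda>\<omega>. weight f n \<omega> * indicator {\<omega>. c \<le> (\<Sum>k=1..r n. g (S n k \<omega>))} \<omega>) \<in> borel_measurable M"
      if g: "g \<in> borel_measurable borel" for c :: real and g :: "real \<Rightarrow> real"
    proof -
      have "(\<lambda>\<omega>. \<Sum>k=1..r n. g (S n k \<omega>)) \<in> borel_measurable M"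
        by (rule borel_measurable_sum) (rule measurable_compose[OF S_measurable g])
      then have "{\<omega> \<in> space M. c \<le> (\<Sum>k=1..r n. g (S n k \<omega>))} \<in> sets M"
        by (rule borel_measurable_le[OF borel_measurable_const])
      then have "(\<lambda>\<omega>. weight f n \<omega> * indicator {\<omega> \<in> space M. c \<le> (\<Sum>k=1..r n. g (S n k \<omega>))} \<omega>) \<in> borel_measurable M"
        by measurable
      then show ?thesis by (rule measurable_cong[THEN iffD1, rotated]) (auto simp: indicator_def)
    qed
    have mA: "(\<lambda>\<omega>. weight f n \<omega> * indicator (A i n) \<omega>) \<in> borel_measurable M" for i
      unfolding A_def by (rule mind) (rule tanh_sum_measurable)
    have mB: "(\<lambda>\<omega>. weight f n \<omega> * indicator (B n) \<omega>) \<in> borel_measurable M"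
      unfolding B_def by (rule mind) (rule lcm)
    have sub: "weight f n \<omega> * indicator {\<omega>. \<mu> n \<omega> \<in> F} \<omega>
        \<le> weight f n \<omega> * indicator (B n) \<omega> + (\<Sum>i<N. weight f n \<omega> * indicator (A i n) \<omega>)" for \<omega>
    proof (cases "\<mu> n \<omega> \<in> F \<and> \<omega> \<notin> B n")
      case True
      then have "(\<Sum>k=1..r n. ln_cosh (S n k \<omega>)) / real (r n) \<le> b"
        using rn by (simp add: B_def field_simps)
      then have "(\<integral>\<^sup>+x. ennreal (ln_cosh x) \<partial>\<mu> n \<omega>) \<le> ennreal b"
        unfolding \<mu>_def nn_integral_empirical[OF lcm ln_cosh_nonneg rn] by (rule ennreal_leI)
      with N True obtain i where i: "i < N" "\<mu> n \<omega> \<in> O' i" by blast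
      then have "cc i < (\<Sum>k=1..r n. tanh_sum (dd i) (S n k \<omega>)) / real (r n)"
        by (simp add: O'_def \<mu>_def integral_empirical_measure[OF rn])
      then have "\<omega> \<in> A i n" using rn by (simp add: A_def field_simps)
      then have "weight f n \<omega> = weight f n \<omega> * indicator (A i n) \<omega>" by simp
      also have "\<dots> \<le> (\<Sum>i<N. weight f n \<omega> * indicator (A i n) \<omega>)"
        using i(1) by (intro member_le_sum) auto
      finally show ?thesis using True by simp
    next
      case False
      then show ?thesis by (auto simp: indicator_def)
    qed
    have "(\<integral>\<^sup>+\<omega>. weight f n \<omega> * indicator {\<omega>. \<mu> n \<omega> \<in> F} \<omega> \<partial>M)
        \<le> (\<integral>\<^sup>+\<omega>. weight f n \<omega> * indicator (B n) \<omega> + (\<Sum>i<N. weight f n \<omega> * indicator (A i n) \<omega>) \<partial>M)"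
      by (rule nn_integral_mono) (rule sub)
    also have "\<dots> = (\<integral>\<^sup>+\<omega>. weight f n \<omega> * indicator (B n) \<omega> \<partial>M) + (\<Sum>i<N. \<integral>\<^sup>+\<omega>. weight f n \<omega> * indicator (A i n) \<omega> \<partial>M)"
      by (simp only: nn_integral_add[OF mB borel_measurable_sum[OF mA]] nn_integral_sum[OF mA])
    also have "\<dots> \<le> ennreal ?e + (\<Sum>i<N. ennreal ?e)"
      using elim(1,2) by (intro add_mono sum_mono) auto
    also have "\<dots> = ennreal (real (Suc N) * ?e)"
    proof -
      have "(\<Sum>i<N. ennreal ?e) = ennreal (\<Sum>i<N. ?e)" by (rule sum_ennreal) simp
      then have "ennreal ?e + (\<Sum>i<N. ennreal ?e) = ennreal (?e + (\<Sum>i<N. ?e))"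
        by (simp add: sum_nonneg del: sum_constant)
      also have "?e + (\<Sum>i<N. ?e) = real (Suc N) * ?e" by (simp add: algebra_simps)
      finally show ?thesis .
    qed
    also have "\<dots> \<le> ennreal (exp (real (r n) * (\<delta> / 2)) * ?e)"
      using elim(3) by (intro ennreal_leI mult_right_mono) auto
    also have "exp (real (r n) * (\<delta> / 2)) * ?e = exp (real (r n) * (?\<Lambda> f - (a + \<delta> / 4)))"
      by (simp add: exp_add[symmetric] algebra_simps)
    finally show ?case .
  qed
  then show ?thesis using \<delta> by (intro exI[of _ "a + \<delta> / 4"]) auto
qed

definition lower_rate :: "real measure set \<Rightarrow> real \<Rightarrow> bool" where
  "lower_rate G c \<longleftrightarrow> (\<forall>\<epsilon>>0. \<forall>\<^sub>F n in sequentially.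
     exp (- (real (r n) * (c + \<epsilon>))) \<le> measure M {\<omega> \<in> space M. \<mu> n \<omega> \<in> G})"

text \<open>The normal law with the unnormalized density \<open>exp h\<close> has relative entropy
  \<open>\<integral> h exp h / \<integral> exp h - ln \<integral> exp h\<close>.  Both integrands are kept as separate arguments, so that limits in which
  \<open>h\<close> tends to minus infinity stay meaningful.\<close>

definition tilted_lower :: "(real \<Rightarrow> real) \<Rightarrow> (real \<Rightarrow> real) \<Rightarrow> bool" where
  "tilted_lower E K \<longleftrightarrow> (let Z = (\<integral>x. E x \<partial>std_normal_distribution) in
     \<forall>G. openin weak_topology G \<longrightarrow> density std_normal_distribution (\<lambda>x. ennreal (E x / Z)) \<in> G \<longrightarrow>
       lower_rate G ((\<integral>x. K x \<partial>std_normal_distribution) / Z - ln Z))"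

text \<open>Under the law tilted by \<open>f\<close> the empirical measure concentrates at \<open>\<beta>\<close>, since every other
  measure is separated from \<open>\<beta>\<close> by a test function.  The density of the tilted law is about
  \<open>exp (r (\<integral> f d\<beta> - \<Lambda> f))\<close> near \<open>\<beta>\<close>, which is the cost of undoing the tilt.\<close>

lemma tilted_lower_tanh_sum: "tilted_lower (\<lambda>x. exp (tanh_sum l x)) (\<lambda>x. tanh_sum l x * exp (tanh_sum l x))"
proof -
  let ?N = std_normal_distribution
  let ?\<Lambda> = gauss_log_mgf
  interpret N: real_distribution ?N by (rule real_dist_normal_dist)
  define f where "f = tanh_sum l"
  have fm [measurable]: "f \<in> borel_measurable borel" unfolding f_def by measurable
  obtain C where f: "smooth_test C f" using smooth_test_tanh_sum[of l] by (auto simp: f_def)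
  have intf: "integrable ?N (\<lambda>x. exp (f x))" by (rule smooth_test_integrable_exp[OF f])
  define Z where "Z = (\<integral>x. exp (f x) \<partial>?N)"
  have Z: "0 < Z" unfolding Z_def by (rule integral_exp_pos[OF N.prob_space_axioms intf])
  have \<Lambda>f: "?\<Lambda> f = ln Z" by (simp add: gauss_log_mgf_def Z_def)
  define \<beta> where "\<beta> = density ?N (\<lambda>x. ennreal (exp (f x) / Z))"
  have int_\<beta>: "(\<integral>x. g x \<partial>\<beta>) = (\<integral>x. exp (f x) * g x \<partial>?N) / Z" if "g \<in> borel_measurable borel" for g :: "real \<Rightarrow> real"
    unfolding \<beta>_def by (rule integral_normalized) (use that Z in auto)
  have rd: "real_distribution \<beta>"
    unfolding \<beta>_def by (rule real_distribution_normalized) (use intf Z in \<open>auto simp: Z_def\<close>)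
  have shift: "ln (\<integral>x. exp (tanh_sum d x) \<partial>\<beta>) = ?\<Lambda> (\<lambda>x. f x + tanh_sum d x) - ?\<Lambda> f" for d
  proof -
    obtain D where D: "smooth_test D (tanh_sum d)" using smooth_test_tanh_sum by blast
    have "0 < (\<integral>x. exp (f x + tanh_sum d x) \<partial>?N)"
      by (rule integral_exp_pos[OF N.prob_space_axioms smooth_test_integrable_exp[OF smooth_test_add[OF f D]]])
    moreover have "(\<integral>x. exp (tanh_sum d x) \<partial>\<beta>) = (\<integral>x. exp (f x + tanh_sum d x) \<partial>?N) / Z"
      by (subst int_\<beta>) (auto simp: exp_add)
    ultimately show ?thesis using Z unfolding \<Lambda>f by (simp add: ln_div gauss_log_mgf_def)
  qed
  define m where "m = (\<integral>x. f x \<partial>\<beta>)"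
  have "lower_rate G (m - ln Z)" if G: "openin weak_topology G" "\<beta> \<in> G" for G
    unfolding lower_rate_def
  proof (intro allI impI)
    fix \<epsilon> :: real assume \<epsilon>: "0 < \<epsilon>"
    define G' where "G' = G \<inter> {\<nu> \<in> topspace weak_topology. (\<integral>x. f x \<partial>\<nu>) < m + \<epsilon> / 2}"
    have G': "openin weak_topology G'" unfolding G'_def f_def by (intro openin_Int G openin_tanh_sum_less)
    have \<beta>G': "\<beta> \<in> G'" using G \<epsilon> rd
      by (auto simp: G'_def m_def topspace_weak_topology real_distribution_prob_algebra)
    define F where "F = topspace weak_topology - G'"
    have F: "closedin weak_topology F" unfolding F_def using G' by (intro closedin_diff) auto
    have sep: "\<exists>d. ?\<Lambda> (\<lambda>x. f x + tanh_sum d x) - ?\<Lambda> f + 0 < (\<integral>x. tanh_sum d x \<partial>\<nu>)" if \<nu>: "\<nu> \<in> F" for \<nu>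
    proof (rule ccontr)
      assume "\<not> ?thesis"
      then have "(\<integral>x. tanh_sum d x \<partial>\<nu>) \<le> ln (\<integral>x. exp (tanh_sum d x) \<partial>\<beta>)" for d
        unfolding shift by (simp add: not_less)
      moreover have "real_distribution \<nu>"
        using \<nu> by (simp add: F_def topspace_weak_topology real_distribution_prob_algebra)
      ultimately have "\<nu> = \<beta>" by (intro exp_moment_bound_imp_eq rd)
      then show False using \<nu> \<beta>G' by (simp add: F_def)
    qed
    obtain a' where a': "0 < a'" and ub: "\<forall>\<^sub>F n in sequentially.
      (\<integral>\<^sup>+\<omega>. weight f n \<omega> * indicator {\<omega>. \<mu> n \<omega> \<in> F} \<omega> \<partial>M) \<le> ennreal (exp (real (r n) * (?\<Lambda> f - a')))"
      using tilted_upper_bound[OF F f sep] by blast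
    \<comment> \<open>smaller than \<open>a'\<close>, so that the tilted mass outside \<open>G'\<close> is negligible\<close>
    define \<eta> where "\<eta> = min a' \<epsilon> / 4"
    have \<eta>: "0 < \<eta>" "\<eta> < a'" "\<eta> \<le> \<epsilon> / 4" using a' \<epsilon> by (auto simp: \<eta>_def)
    have e1: "0 < a' - \<eta>" and e2: "0 < \<epsilon> / 4" using \<eta> \<epsilon> by auto
    show "\<forall>\<^sub>F n in sequentially. exp (- (real (r n) * (m - ln Z + \<epsilon>))) \<le> measure M {\<omega> \<in> space M. \<mu> n \<omega> \<in> G}"
      using ub exp_moments[OF f \<eta>(1)] exp_eventually_ge[OF e1, of 2] exp_eventually_ge[OF e2, of 2] r_eventually_ge[of 1]
    proof eventually_elim
      case (elim n)
      have rn: "0 < r n" using elim(5) by simp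
      define R where "R = real (r n)"
      let ?A = "{\<omega> \<in> space M. \<mu> n \<omega> \<in> G'}"
      have A: "?A \<in> sets M" unfolding \<mu>_def by (rule sets_empirical_measure_event[OF rn]) (use G' in auto)
      have in_top: "\<mu> n \<omega> \<in> topspace weak_topology" for \<omega>
        unfolding \<mu>_def topspace_weak_topology by (rule empirical_measure_in_space[OF rn])
      have [measurable]: "(\<lambda>\<omega>. weight f n \<omega>) \<in> borel_measurable M" using weight_measurable[OF fm] .
      have pt: "weight f n \<omega> \<le> ennreal (exp (R * (m + \<epsilon> / 2))) * indicator ?A \<omega> + weight f n \<omega> * indicator {\<omega>. \<mu> n \<omega> \<in> F} \<omega>"
        if "\<omega> \<in> space M" for \<omega>
      proof (cases "\<mu> n \<omega> \<in> G'")
        case True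
        then have "(\<Sum>k=1..r n. f (S n k \<omega>)) / real (r n) < m + \<epsilon> / 2"
          by (simp add: G'_def \<mu>_def integral_empirical_measure[OF rn fm])
        then have "(\<Sum>k=1..r n. f (S n k \<omega>)) \<le> R * (m + \<epsilon> / 2)" using rn by (simp add: R_def field_simps)
        then have "weight f n \<omega> \<le> ennreal (exp (R * (m + \<epsilon> / 2)))" unfolding weight_def by (intro ennreal_leI) simp
        then show ?thesis using True that by (simp add: add_increasing2)
      next
        case False
        then show ?thesis using in_top[of \<omega>] by (simp add: F_def)
      qed
      have mF: "(\<lambda>\<omega>. weight f n \<omega> * indicator {\<omega>. \<mu> n \<omega> \<in> F} \<omega>) \<in> borel_measurable M"
      proof -
        have "{\<omega> \<in> space M. \<mu> n \<omega> \<in> F} \<in> sets M" unfolding \<mu>_def by (rule sets_empirical_measure_event[OF rn]) (use F in auto)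
        then have "(\<lambda>\<omega>. weight f n \<omega> * indicator {\<omega> \<in> space M. \<mu> n \<omega> \<in> F} \<omega>) \<in> borel_measurable M" by measurable
        then show ?thesis by (rule measurable_cong[THEN iffD1, rotated]) (auto simp: indicator_def)
      qed
      have "ennreal (exp (R * (ln Z - \<eta>))) \<le> (\<integral>\<^sup>+\<omega>. weight f n \<omega> \<partial>M)"
        using elim(2) by (simp add: R_def weight_def \<Lambda>f)
      also have "\<dots> \<le> (\<integral>\<^sup>+\<omega>. ennreal (exp (R * (m + \<epsilon> / 2))) * indicator ?A \<omega> + weight f n \<omega> * indicator {\<omega>. \<mu> n \<omega> \<in> F} \<omega> \<partial>M)"
        by (rule nn_integral_mono) (rule pt)
      also have "\<dots> = ennreal (exp (R * (m + \<epsilon> / 2))) * emeasure M ?A + (\<integral>\<^sup>+\<omega>. weight f n \<omega> * indicator {\<omega>. \<mu> n \<omega> \<in> F} \<omega> \<partial>M)"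
        using A mF by (subst nn_integral_add) (auto simp: nn_integral_cmult_indicator)
      also have "\<dots> \<le> ennreal (exp (R * (m + \<epsilon> / 2))) * emeasure M ?A + ennreal (exp (R * (ln Z - a')))"
        using elim(1) by (intro add_left_mono) (simp add: R_def \<Lambda>f)
      also have "\<dots> = ennreal (exp (R * (m + \<epsilon> / 2)) * prob ?A + exp (R * (ln Z - a')))"
        by (simp add: emeasure_eq_measure ennreal_mult[symmetric] ennreal_plus[symmetric] del: ennreal_plus)
      finally have main: "exp (R * (ln Z - \<eta>)) \<le> exp (R * (m + \<epsilon> / 2)) * prob ?A + exp (R * (ln Z - a'))"
        by (subst (asm) ennreal_le_iff) auto
      have "2 * exp (R * (ln Z - a')) \<le> exp (R * (a' - \<eta>)) * exp (R * (ln Z - a'))"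
        using elim(3) by (intro mult_right_mono) (auto simp: R_def)
      also have "\<dots> = exp (R * (ln Z - \<eta>))" by (simp add: exp_add[symmetric] algebra_simps)
      finally have half: "exp (R * (ln Z - \<eta>)) \<le> 2 * (exp (R * (m + \<epsilon> / 2)) * prob ?A)" using main by linarith
      also have "\<dots> \<le> exp (R * (\<epsilon> / 4)) * (exp (R * (m + \<epsilon> / 2)) * prob ?A)"
        using elim(4) by (intro mult_right_mono) (auto simp: R_def)
      also have "\<dots> = exp (R * (\<epsilon> / 4) + R * (m + \<epsilon> / 2)) * prob ?A" by (simp only: exp_add mult.assoc)
      also have "R * (\<epsilon> / 4) + R * (m + \<epsilon> / 2) = R * (m + 3 * \<epsilon> / 4)" by (simp add: field_simps)
      finally have "exp (R * (ln Z - \<eta>)) \<le> exp (R * (m + 3 * \<epsilon> / 4)) * prob ?A" .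
      then have "exp (- (R * (m + 3 * \<epsilon> / 4))) * exp (R * (ln Z - \<eta>))
          \<le> exp (- (R * (m + 3 * \<epsilon> / 4))) * (exp (R * (m + 3 * \<epsilon> / 4)) * prob ?A)"
        by (rule mult_left_mono) simp
      also have "\<dots> = prob ?A" by (simp add: mult.assoc[symmetric] exp_add[symmetric])
      also have "exp (- (R * (m + 3 * \<epsilon> / 4))) * exp (R * (ln Z - \<eta>)) = exp (- (R * (m - ln Z + 3 * \<epsilon> / 4 + \<eta>)))"
        by (simp add: exp_add[symmetric] algebra_simps)
      finally have 1: "exp (- (R * (m - ln Z + 3 * \<epsilon> / 4 + \<eta>))) \<le> prob ?A" .
      have "R * (m - ln Z + 3 * \<epsilon> / 4 + \<eta>) \<le> R * (m - ln Z + \<epsilon>)"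
        using \<eta>(3) by (intro mult_left_mono) (auto simp: R_def)
      then have "exp (- (R * (m - ln Z + \<epsilon>))) \<le> exp (- (R * (m - ln Z + 3 * \<epsilon> / 4 + \<eta>)))" by simp
      also note 1
      also have "prob ?A \<le> prob {\<omega> \<in> space M. \<mu> n \<omega> \<in> G}"
      proof (rule finite_measure_mono)
        show "{\<omega> \<in> space M. \<mu> n \<omega> \<in> G} \<in> sets M"
          unfolding \<mu>_def by (rule sets_empirical_measure_event[OF rn]) (use G in auto)
      qed (auto simp: G'_def)
      finally show ?case by (simp add: R_def)
    qed
  qed
  moreover have "m = (\<integral>x. tanh_sum l x * exp (tanh_sum l x) \<partial>?N) / (\<integral>x. exp (tanh_sum l x) \<partial>?N)"
    unfolding m_def by (subst int_\<beta>) (auto simp: f_def Z_def mult.commute)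
  ultimately show ?thesis
    unfolding tilted_lower_def Let_def \<beta>_def Z_def f_def by simp
qed

text \<open>The cost is continuous along dominated convergence of the densities, and by the definition of the
  weak topology the approximating laws end up in every open set that contains the limit.\<close>

lemma tilted_lower_limit:
  assumes low: "\<And>n::nat. tilted_lower (E n) (K n)"
    and [measurable]: "\<And>n. E n \<in> borel_measurable borel" "\<And>n. K n \<in> borel_measurable borel"
      "E' \<in> borel_measurable borel" "K' \<in> borel_measurable borel"
    and E0: "\<And>n x. 0 \<le> E n x" and E0': "\<And>x. 0 \<le> E' x"
    and bnd: "\<And>n x. E n x \<le> u x" "\<And>n x. \<bar>K n x\<bar> \<le> v x"
    and int: "integrable std_normal_distribution u" "integrable std_normal_distribution v"
    and lim: "\<And>x. (\<lambda>n. E n x) \<longlonglongrightarrow> E' x" "\<And>x. (\<lambda>n. K n x) \<longlonglongrightarrow> K' x"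
    and pos: "0 < (\<integral>x. E' x \<partial>std_normal_distribution)" "\<And>n. 0 < (\<integral>x. E n x \<partial>std_normal_distribution)"
  shows "tilted_lower E' K'"
proof -
  let ?N = std_normal_distribution
  interpret N: real_distribution ?N by (rule real_dist_normal_dist)
  define Z where "Z n = (\<integral>x. E n x \<partial>?N)" for n
  define Z' where "Z' = (\<integral>x. E' x \<partial>?N)"
  define \<beta> where "\<beta> n = density ?N (\<lambda>x. ennreal (E n x / Z n))" for n
  define \<beta>' where "\<beta>' = density ?N (\<lambda>x. ennreal (E' x / Z'))"
  have iE: "integrable ?N (E n)" for n
    by (rule Bochner_Integration.integrable_bound[OF int(1)])
      (use bnd(1) E0 in \<open>auto intro!: AE_I2 intro: order_trans[OF bnd(1) abs_ge_self]\<close>)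
  have iE': "integrable ?N E'"
  proof (rule Bochner_Integration.integrable_bound[OF int(1)])
    have "E' x \<le> u x" for x by (intro LIMSEQ_le_const2[OF lim(1)] exI allI impI bnd(1))
    then show "AE x in ?N. norm (E' x) \<le> norm (u x)"
      using E0' by (auto intro!: AE_I2 intro: order_trans[OF _ abs_ge_self])
  qed measurable
  have Zp: "0 < Z n" "0 < Z'" for n using pos by (auto simp: Z_def Z'_def)
  have limZ: "Z \<longlonglongrightarrow> Z'" unfolding Z_def[abs_def] Z'_def
    by (rule integral_dominated_convergence[where w=u]) (use int bnd E0 lim in auto)
  have limK: "(\<lambda>n. \<integral>x. K n x \<partial>?N) \<longlonglongrightarrow> (\<integral>x. K' x \<partial>?N)"
    by (rule integral_dominated_convergence[where w=v]) (use int bnd lim in auto)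
  have limc: "(\<lambda>n. (\<integral>x. K n x \<partial>?N) / Z n - ln (Z n)) \<longlonglongrightarrow> (\<integral>x. K' x \<partial>?N) / Z' - ln Z'"
    using Zp by (intro tendsto_intros limK limZ) auto
  have rdn: "real_distribution (\<beta> n)" for n
    unfolding \<beta>_def by (rule real_distribution_normalized) (use iE E0 Zp in \<open>auto simp: Z_def\<close>)
  have rd': "real_distribution \<beta>'"
    unfolding \<beta>'_def by (rule real_distribution_normalized) (use iE' E0' Zp in \<open>auto simp: Z'_def\<close>)
  have wc: "weak_conv_m \<beta> \<beta>'"
  proof (rule integral_bdd_continuous_conv_imp_weak_conv[OF rdn rd'])
    fix g :: "real \<Rightarrow> real" assume g: "\<And>x. isCont g x" "\<And>x. \<bar>g x\<bar> \<le> 1"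
    have [measurable]: "g \<in> borel_measurable borel"
      by (intro borel_measurable_continuous_onI continuous_at_imp_continuous_on ballI g(1))
    have eq: "(\<integral>x. g x \<partial>\<beta> n) = (\<integral>x. E n x * g x \<partial>?N) / Z n" for n
      unfolding \<beta>_def using Zp E0 by (intro integral_normalized) auto
    have eq': "(\<integral>x. g x \<partial>\<beta>') = (\<integral>x. E' x * g x \<partial>?N) / Z'"
      unfolding \<beta>'_def using Zp E0' by (intro integral_normalized) auto
    have "(\<lambda>n. \<integral>x. E n x * g x \<partial>?N) \<longlonglongrightarrow> (\<integral>x. E' x * g x \<partial>?N)"
    proof (rule integral_dominated_convergence[where w=u])
      show "AE x in ?N. (\<lambda>n. E n x * g x) \<longlonglongrightarrow> E' x * g x"
        by (intro AE_I2 tendsto_intros lim)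
      have "\<bar>E n x * g x\<bar> \<le> u x" for n x
        using mult_mono[OF bnd(1)[of n x] g(2)[of x]] E0[of n x] order_trans[OF E0[of n x] bnd(1)[of n x]]
        by (simp add: abs_mult)
      then show "AE x in ?N. norm (E n x * g x) \<le> u x" for n by simp
    qed (use int in simp_all)
    then show "(\<lambda>n. integral\<^sup>L (\<beta> n) g) \<longlonglongrightarrow> integral\<^sup>L \<beta>' g"
      unfolding eq eq' using Zp by (intro tendsto_intros limZ) auto
  qed
  have limit: "limitin weak_topology \<beta> \<beta>' sequentially"
    using rdn rd' wc by (subst limitin_weak_topology_iff) (auto simp: real_distribution_prob_algebra)
  show ?thesis unfolding tilted_lower_def Let_def Z'_def[symmetric]
  proof (intro allI impI)
    fix G assume G: "openin weak_topology G" "density ?N (\<lambda>x. ennreal (E' x / Z')) \<in> G"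
    define c where "c = (\<integral>x. K' x \<partial>?N) / Z' - ln Z'"
    have e1: "\<forall>\<^sub>F n in sequentially. \<beta> n \<in> G"
      using limit G by (auto simp: limitin_def \<beta>'_def)
    show "lower_rate G ((\<integral>x. K' x \<partial>?N) / Z' - ln Z')" unfolding lower_rate_def c_def[symmetric]
    proof (intro allI impI)
      fix \<epsilon> :: real assume \<epsilon>: "0 < \<epsilon>"
      have "\<forall>\<^sub>F n in sequentially. (\<integral>x. K n x \<partial>?N) / Z n - ln (Z n) < c + \<epsilon> / 2"
        using \<epsilon> by (intro order_tendstoD(2)[OF limc[folded c_def]]) simp
      with e1 have "\<forall>\<^sub>F n in sequentially. \<beta> n \<in> G \<and> (\<integral>x. K n x \<partial>?N) / Z n - ln (Z n) < c + \<epsilon> / 2"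
        by (rule eventually_conj)
      then obtain i where i: "\<beta> i \<in> G" "(\<integral>x. K i x \<partial>?N) / Z i - ln (Z i) < c + \<epsilon> / 2"
        using eventually_happens'[OF sequentially_bot] by blast
      have "lower_rate G ((\<integral>x. K i x \<partial>?N) / Z i - ln (Z i))"
        using low[of i] G(1) i(1) by (simp add: tilted_lower_def Let_def \<beta>_def Z_def)
      moreover have "0 < \<epsilon> / 2" using \<epsilon> by simp
      ultimately have "\<forall>\<^sub>F n in sequentially. exp (- (real (r n) * ((\<integral>x. K i x \<partial>?N) / Z i - ln (Z i) + \<epsilon> / 2))) \<le> prob {\<omega> \<in> space M. \<mu> n \<omega> \<in> G}"
        unfolding lower_rate_def by blast
      then show "\<forall>\<^sub>F n in sequentially. exp (- (real (r n) * (c + \<epsilon>))) \<le> prob {\<omega> \<in> space M. \<mu> n \<omega> \<in> G}"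
      proof eventually_elim
        case (elim n)
        have "real (r n) * ((\<integral>x. K i x \<partial>?N) / Z i - ln (Z i) + \<epsilon> / 2) \<le> real (r n) * (c + \<epsilon>)"
          using i(2) by (intro mult_left_mono) auto
        then have "exp (- (real (r n) * (c + \<epsilon>))) \<le> exp (- (real (r n) * ((\<integral>x. K i x \<partial>?N) / Z i - ln (Z i) + \<epsilon> / 2)))"
          by simp
        then show ?case using elim by (rule order_trans)
      qed
    qed
  qed
qed

text \<open>Both \<open>exp f\<close> and \<open>f exp f\<close> are continuous in \<open>f\<close> under bounded pointwise limits, so the bound spreads from
  the countable family.\<close>

lemma tilted_lower_bounded:
  assumes f: "f \<in> borel_measurable borel" "\<And>x. \<bar>f x\<bar> \<le> B"
  shows "tilted_lower (\<lambda>x. exp (f x)) (\<lambda>x. f x * exp (f x))"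
proof -
  interpret N: real_distribution std_normal_distribution by (rule real_dist_normal_dist)
  have "f \<in> bounded_closure" by (rule bounded_borel_in_closure[OF f])
  then show ?thesis
  proof (induction rule: bounded_closure.induct)
    case (base l) show ?case by (rule tilted_lower_tanh_sum)
  next
    case (lim f B g)
    note fm [measurable] = bounded_closure_measurable[OF lim.hyps(1)]
    have gc: "g \<in> bounded_closure" using lim.hyps by (rule bounded_closure.lim)
    note gm [measurable] = bounded_closure_measurable[OF gc]
    have gB: "\<bar>g x\<bar> \<le> B" for x
      by (intro LIMSEQ_le_const2[OF tendsto_rabs[OF lim.hyps(3)]] exI allI impI lim.hyps(2))
    have pos: "0 < (\<integral>x. exp (h x) \<partial>std_normal_distribution)"
      if [measurable]: "h \<in> borel_measurable borel" and "\<And>x. \<bar>h x\<bar> \<le> B" for h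
      by (rule integral_exp_pos[OF N.prob_space_axioms N.integrable_const_bound[where B="exp B"]])
        (use that in \<open>auto simp: abs_le_iff\<close>)
    show ?case
    proof (rule tilted_lower_limit[OF lim.IH, where u="\<lambda>_. exp B" and v="\<lambda>_. B * exp B"])
      show "exp (f n x) \<le> exp B" for n x using lim.hyps(2)[of n x] by simp
      show "\<bar>f n x * exp (f n x)\<bar> \<le> B * exp B" for n x
        using lim.hyps(2)[of n x] by (auto simp: abs_mult intro!: mult_mono)
      show "(\<lambda>n. exp (f n x)) \<longlonglongrightarrow> exp (g x)" for x by (intro tendsto_intros lim.hyps)
      show "(\<lambda>n. f n x * exp (f n x)) \<longlonglongrightarrow> g x * exp (g x)" for x by (intro tendsto_intros lim.hyps)
      show "0 < (\<integral>x. exp (g x) \<partial>std_normal_distribution)" by (rule pos[OF gm gB])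
      show "0 < (\<integral>x. exp (f n x) \<partial>std_normal_distribution)" for n by (rule pos[OF fm lim.hyps(2)])
    qed auto
  qed
qed

text \<open>Finite entropy makes \<open>\<bar>g ln g\<bar> + 1\<close> integrable, where \<open>g\<close> is the density with respect to the normal law, and
  this dominates \<open>h exp h\<close> for every truncation \<open>h\<close> of \<open>ln g\<close>; so the bound passes to the limit.\<close>

lemma lower_rate_entropy:
  assumes \<nu>: "finite_entropy_density \<nu> p" and G: "openin weak_topology G" "\<nu> \<in> G"
  shows "lower_rate G (\<integral>x. ln (p x / std_normal_density x) * p x \<partial>lborel)"
proof -
  let ?N = std_normal_distribution
  interpret N: real_distribution ?N by (rule real_dist_normal_dist)
  have pm [measurable]: "p \<in> borel_measurable borel" and p0: "\<And>x. 0 \<le> p x"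
    and \<nu>p: "\<nu> = density lborel (\<lambda>x. ennreal (p x))"
    and ip: "integrable lborel (\<lambda>x. ln (p x / std_normal_density x) * p x)"
    using \<nu> by (auto simp: finite_entropy_density_def)
  have pos: "0 < std_normal_density x" for x by (rule normal_density_pos) simp
  define g where "g x = p x / std_normal_density x" for x
  have gm [measurable]: "g \<in> borel_measurable borel" unfolding g_def[abs_def] by measurable
  have g0: "0 \<le> g x" for x using p0[of x] pos[of x] by (simp add: g_def)
  have pg: "p x = std_normal_density x * g x" for x using pos[of x] by (simp add: g_def)
  have \<nu>g: "\<nu> = density ?N (\<lambda>x. ennreal (g x))"
    unfolding \<nu>p pg[abs_def] using g0 less_imp_le[OF pos] by (subst density_density_eq) (auto simp: ennreal_mult)
  have "prob_space \<nu>" using G openin_subset[OF G(1)] by (auto simp: topspace_weak_topology space_prob_algebra)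
  then have "emeasure \<nu> (space \<nu>) = 1" by (rule prob_space.emeasure_space_1)
  then have ig: "(\<integral>\<^sup>+x. ennreal (g x) \<partial>?N) = ennreal 1" by (simp add: \<nu>g emeasure_density)
  have int_g: "integrable ?N g" by (rule integrableI_nn_integral_finite[OF _ _ ig]) (use g0 in auto)
  have g1: "(\<integral>x. g x \<partial>?N) = 1" by (subst integral_eq_nn_integral) (use g0 ig in auto)
  have entr: "ln (p x / std_normal_density x) * p x = std_normal_density x * (g x * ln (g x))" for x
    using pg[of x] by (simp add: g_def)
  have igl: "integrable ?N (\<lambda>x. g x * ln (g x))"
    using ip less_imp_le[OF pos] unfolding entr by (subst integrable_density) auto
  have val: "(\<integral>x. ln (p x / std_normal_density x) * p x \<partial>lborel) = (\<integral>x. g x * ln (g x) \<partial>?N)"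
    unfolding entr using less_imp_le[OF pos] by (subst integral_density) auto
  define h where "h n x = clip_ln n (g x)" for n x
  have hm [measurable]: "h n \<in> borel_measurable borel" for n unfolding h_def[abs_def] by measurable
  have eh: "exp (h n x) = max (exp (- real n)) (min (g x) (exp (real n)))" for n x
    unfolding h_def by (rule exp_clip_ln)
  have hb: "\<bar>h n x\<bar> \<le> real n" for n x
    unfolding h_def by (rule abs_clip_ln_le)
  have mid: "h n x = ln (g x)" if "exp (- real n) \<le> g x" "g x \<le> exp (real n)" for n x
    unfolding h_def by (rule clip_ln_eq_ln[OF that])
  have "tilted_lower g (\<lambda>x. g x * ln (g x))"
  proof (rule tilted_lower_limit[OF tilted_lower_bounded[OF hm hb],
        where u="\<lambda>x. g x + 1" and v="\<lambda>x. \<bar>g x * ln (g x)\<bar> + 1"])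
    show "exp (h n x) \<le> g x + 1" for n x
    proof -
      have "exp (- real n) \<le> 1" by simp
      then show ?thesis unfolding eh using g0[of x] by linarith
    qed
    show "\<bar>h n x * exp (h n x)\<bar> \<le> \<bar>g x * ln (g x)\<bar> + 1" for n x
    proof -
      consider "g x < exp (- real n)" | "exp (- real n) \<le> g x" "g x \<le> exp (real n)" | "exp (real n) < g x" by linarith
      then show ?thesis
      proof cases
        case 1
        moreover have "exp (- real n) \<le> exp (real n)" by simp
        ultimately have e: "exp (h n x) = exp (- real n)" unfolding eh by linarith
        have "\<bar>h n x\<bar> * exp (h n x) \<le> real n * exp (- real n)" unfolding e using hb by (intro mult_right_mono) auto
        also have "\<dots> \<le> exp (real n) * exp (- real n)"
          using exp_ge_add_one_self[of "real n"] by (intro mult_right_mono exp_ge_zero) linarith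
        also have "\<dots> = 1" by (simp add: exp_minus)
        finally have "\<bar>h n x\<bar> * exp (h n x) \<le> 1" .
        moreover have "\<bar>h n x * exp (h n x)\<bar> = \<bar>h n x\<bar> * exp (h n x)" by (simp add: abs_mult)
        moreover have "0 \<le> \<bar>g x * ln (g x)\<bar>" by (rule abs_ge_zero)
        ultimately show ?thesis by linarith
      next
        case 2
        have "0 < g x" using 2(1) exp_gt_zero[of "- real n"] by linarith
        then show ?thesis by (simp add: mid[OF 2] mult.commute)
      next
        case 3
        moreover have "exp (- real n) \<le> exp (real n)" by simp
        ultimately have e: "exp (h n x) = exp (real n)" unfolding eh by linarith
        have gp: "0 < g x" using 3 exp_gt_zero[of "real n"] by linarith
        have l: "real n \<le> ln (g x)" using 3 gp by (simp add: ln_ge_iff)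
        have "\<bar>h n x\<bar> * exp (h n x) \<le> ln (g x) * g x"
          unfolding e using hb[of n x] l 3 by (intro mult_mono) auto
        also have "\<dots> \<le> \<bar>g x * ln (g x)\<bar> + 1" by (simp add: mult.commute abs_if)
        finally show ?thesis by (simp add: abs_mult)
      qed
    qed
    have exp0: "(\<lambda>n. real n / exp (real n)) \<longlonglongrightarrow> 0"
      using filterlim_compose[OF tendsto_power_div_exp_0[of 1] filterlim_real_sequentially] by simp
    have ev: "\<forall>\<^sub>F n in sequentially. h n x = ln (g x) \<and> exp (h n x) = g x" if gp: "0 < g x" for x
      using eventually_clip_ln[OF gp] by eventually_elim (use gp in \<open>simp add: h_def\<close>)
    have zero: "exp (h n x) = exp (- real n)" "h n x = - real n" if "g x = 0" for n x
      using that by (simp_all add: h_def clip_ln_def max_def)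
    have neg: "(\<lambda>n. exp (- real n)) \<longlonglongrightarrow> 0"
      using filterlim_real_sequentially by (intro filterlim_compose[OF exp_at_bot]) (simp add: filterlim_uminus_at_top)
    show "(\<lambda>n. exp (h n x)) \<longlonglongrightarrow> g x" for x
    proof (cases "g x = 0")
      case True then show ?thesis using neg by (simp add: zero)
    next
      case False
      then have "0 < g x" using g0[of x] by simp
      from ev[OF this] show ?thesis by (intro tendsto_eventually) (auto elim: eventually_mono)
    qed
    show "(\<lambda>n. h n x * exp (h n x)) \<longlonglongrightarrow> g x * ln (g x)" for x
    proof (cases "g x = 0")
      case True
      have "(\<lambda>n. - (real n / exp (real n))) \<longlonglongrightarrow> - 0" by (intro tendsto_intros exp0)
      then show ?thesis using True by (simp add: zero exp_minus divide_inverse)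
    next
      case False
      then have "0 < g x" using g0[of x] by simp
      from ev[OF this] show ?thesis by (intro tendsto_eventually) (auto elim!: eventually_mono)
    qed
    show "0 < (\<integral>x. exp (h n x) \<partial>?N)" for n
      by (rule integral_exp_pos[OF N.prob_space_axioms N.integrable_const_bound[where B="exp (real n)"]])
        (use hb in \<open>auto simp: abs_le_iff\<close>)
  qed (use int_g igl g0 g1 in \<open>auto intro!: integrable_abs\<close>)
  then show ?thesis using G unfolding val \<nu>g by (simp add: tilted_lower_def Let_def g1)
qed

lemma lower_bound:
  assumes G: "openin weak_topology G"
  shows "- (INF \<nu>\<in>G. gauss_entropy \<nu>)
    \<le> liminf (\<lambda>n. ereal (1 / real (r n)) * ln_prob (measure M {\<omega> \<in> space M. \<mu> n \<omega> \<in> G}))"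
    (is "_ \<le> liminf ?L")
proof -
  have "- liminf ?L \<le> gauss_entropy \<nu>" if \<nu>: "\<nu> \<in> G" for \<nu>
  proof (cases "\<exists>p. finite_entropy_density \<nu> p")
    case False
    then show ?thesis by (simp add: gauss_entropy_eq_infinity)
  next
    case True
    then obtain p where p: "finite_entropy_density \<nu> p" by blast
    define c where "c = (\<integral>x. ln (p x / std_normal_density x) * p x \<partial>lborel)"
    have low: "lower_rate G c" unfolding c_def by (rule lower_rate_entropy[OF p G \<nu>])
    have "ereal (- c) \<le> liminf ?L"
    proof (rule ereal_le_epsilon2)
      fix \<epsilon> :: real assume \<epsilon>: "0 < \<epsilon>"
      have "\<forall>\<^sub>F n in sequentially. ereal (- c - \<epsilon>) \<le> ?L n"
        using low[unfolded lower_rate_def, rule_format, OF \<epsilon>] r_eventually_ge[of 1]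
      proof eventually_elim
        case (elim n)
        let ?P = "prob {\<omega> \<in> space M. \<mu> n \<omega> \<in> G}"
        have P: "0 < ?P" using elim(1) exp_gt_zero less_le_trans by blast
        have "ln (exp (- (real (r n) * (c + \<epsilon>)))) \<le> ln ?P" using elim(1) by (intro ln_mono) auto
        then have "- c - \<epsilon> \<le> 1 / real (r n) * ln ?P" using elim(2) by (simp add: field_simps)
        then show ?case using P by (simp add: ln_prob_def)
      qed
      then have "ereal (- c - \<epsilon>) \<le> liminf ?L" by (rule Liminf_bounded)
      then have "ereal (- c - \<epsilon>) + ereal \<epsilon> \<le> liminf ?L + ereal \<epsilon>" by (rule add_right_mono)
      then show "ereal (- c) \<le> liminf ?L + ereal \<epsilon>" by simp
    qed
    then have "- liminf ?L \<le> - ereal (- c)" by (simp only: ereal_minus_le_minus)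
    then show ?thesis by (simp add: gauss_entropy_eq[OF p] c_def)
  qed
  then have "- liminf ?L \<le> (INF \<nu>\<in>G. gauss_entropy \<nu>)" by (rule INF_greatest)
  then have "- (INF \<nu>\<in>G. gauss_entropy \<nu>) \<le> - (- liminf ?L)" by (simp only: ereal_minus_le_minus)
  then show ?thesis by simp
qed

lemma upper_bound:
  assumes F: "closedin weak_topology F"
  shows "limsup (\<lambda>n. ereal (1 / real (r n)) * ln_prob (measure M {\<omega> \<in> space M. \<mu> n \<omega> \<in> F}))
    \<le> - (INF \<nu>\<in>F. gauss_entropy \<nu>)"
    (is "limsup ?L \<le> _")
proof -
  interpret N: real_distribution std_normal_distribution by (rule real_dist_normal_dist)
  let ?I = "INF \<nu>\<in>F. gauss_entropy \<nu>"
  have real_case: "limsup ?L \<le> - ereal a" if a: "ereal a < ?I" for a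
  proof -
    obtain C where C: "smooth_test C (tanh_sum [])" using smooth_test_tanh_sum by blast
    have \<Lambda>0: "gauss_log_mgf (tanh_sum []) = 0" using N.prob_space by (simp add: gauss_log_mgf_def)
    have sep: "\<exists>d. gauss_log_mgf (\<lambda>x. tanh_sum [] x + tanh_sum d x) - gauss_log_mgf (tanh_sum []) + a < (\<integral>x. tanh_sum d x \<partial>\<nu>)"
      if \<nu>: "\<nu> \<in> F" for \<nu>
    proof (rule ccontr)
      assume "\<not> ?thesis"
      then have "(\<integral>x. tanh_sum d x \<partial>\<nu>) \<le> a + gauss_log_mgf (tanh_sum d)" for d
        by (simp add: not_less \<Lambda>0 add.commute)
      moreover have "real_distribution \<nu>"
        using \<nu> closedin_subset[OF F] by (auto simp: topspace_weak_topology real_distribution_prob_algebra)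
      ultimately have "gauss_entropy \<nu> \<le> ereal a" by (intro gauss_entropy_le)
      moreover have "ereal a < gauss_entropy \<nu>" using a \<nu> by (rule less_INF_D)
      ultimately show False by simp
    qed
    obtain a' where a': "a < a'" and ub: "\<forall>\<^sub>F n in sequentially.
        (\<integral>\<^sup>+\<omega>. weight (tanh_sum []) n \<omega> * indicator {\<omega>. \<mu> n \<omega> \<in> F} \<omega> \<partial>M)
        \<le> ennreal (exp (real (r n) * (gauss_log_mgf (tanh_sum []) - a')))"
      using tilted_upper_bound[OF F C sep] by blast
    have "\<forall>\<^sub>F n in sequentially. ?L n \<le> ereal (- a)"
      using ub r_eventually_ge[of 1]
    proof eventually_elim
      case (elim n)
      have rn: "0 < r n" using elim(2) by simp
      let ?A = "{\<omega> \<in> space M. \<mu> n \<omega> \<in> F}"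
      have A: "?A \<in> sets M" unfolding \<mu>_def by (rule sets_empirical_measure_event[OF rn]) (use F in auto)
      have "emeasure M ?A = (\<integral>\<^sup>+\<omega>. indicator ?A \<omega> \<partial>M)" using A by simp
      also have "\<dots> = (\<integral>\<^sup>+\<omega>. weight (tanh_sum []) n \<omega> * indicator {\<omega>. \<mu> n \<omega> \<in> F} \<omega> \<partial>M)"
        by (intro nn_integral_cong) (auto simp: weight_def indicator_def)
      also note elim(1)
      finally have le: "prob ?A \<le> exp (- (real (r n) * a'))"
        by (simp add: emeasure_eq_measure \<Lambda>0)
      show ?case
      proof (cases "prob ?A = 0")
        case True
        then show ?thesis using rn by (simp add: ln_prob_def)
      next
        case False
        then have P: "0 < prob ?A" by (simp add: zero_less_measure_iff)
        have "ln (prob ?A) \<le> ln (exp (- (real (r n) * a')))" using le P by (intro ln_mono) auto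
        then have "ln (prob ?A) \<le> - (real (r n) * a')" by simp
        also have "\<dots> \<le> - (real (r n) * a)" using a' by (simp add: mult_left_mono)
        finally have "1 / real (r n) * ln (prob ?A) \<le> - a" using rn by (simp add: field_simps)
        then show ?thesis using False by (simp add: ln_prob_def)
      qed
    qed
    then have "limsup ?L \<le> ereal (- a)" by (rule Limsup_bounded)
    then show ?thesis by simp
  qed
  have "?I \<le> - limsup ?L"
  proof (rule dense_le)
    fix z assume z: "z < ?I"
    show "z \<le> - limsup ?L"
    proof (cases z)
      case (real a)
      then have "- (- ereal a) \<le> - limsup ?L" using real_case[of a] z by (simp only: ereal_minus_le_minus)
      then show ?thesis using real by simp
    qed (use z in auto)
  qed
  then have "- (- limsup ?L) \<le> - ?I" by (simp only: ereal_minus_le_minus)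
  then show ?thesis by simp
qed

end

theorem proposition1p3:
  fixes M :: "'a measure" and X :: "nat \<Rightarrow> 'a \<Rightarrow> real" and \<tau> :: real and r :: "nat \<Rightarrow> nat"
  assumes "prob_space M"
    and "prob_space.indep_vars M (\<lambda>_. borel) X {1..}"
    and "\<And>j. 1 \<le> j \<Longrightarrow> (\<integral>\<omega>. X j \<omega> \<partial>M) = 0"
    and "\<And>j. 1 \<le> j \<Longrightarrow> (\<integral>\<omega>. (X j \<omega>)\<^sup>2 \<partial>M) = 1"
    and "0 < \<tau>"
    and "(SUP k\<in>{1..}. \<integral>\<^sup>+\<omega>. ennreal (\<bar>X k \<omega>\<bar> ^ 3 * exp (\<bar>X k \<omega>\<bar> / \<tau>)) \<partial>M) \<le> ennreal \<tau>"
    and "\<And>n. 1 \<le> n \<Longrightarrow> 0 < r n"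
    and "(\<lambda>n. real (r n) ^ 4 / real n) \<longlonglongrightarrow> 0"
    and "(\<lambda>n. ln (real n) / real (r n)) \<longlonglongrightarrow> 0"
  defines "\<mu> \<equiv> \<lambda>n \<omega>. empirical_measure (r n) (\<lambda>k. cosine_sum X n k \<omega>)"
  shows "(\<forall>G. openin weak_topology G \<longrightarrow>
            - (INF \<nu>\<in>G. gauss_entropy \<nu>)
              \<le> liminf (\<lambda>n. ereal (1 / real (r n)) * ln_prob (measure M {\<omega> \<in> space M. \<mu> n \<omega> \<in> G})))
       \<and> (\<forall>F. closedin weak_topology F \<longrightarrow>
            limsup (\<lambda>n. ereal (1 / real (r n)) * ln_prob (measure M {\<omega> \<in> space M. \<mu> n \<omega> \<in> F}))
              \<le> - (INF \<nu>\<in>F. gauss_entropy \<nu>))"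
proof -
  interpret prob_space M by fact
  have third: "(\<integral>\<^sup>+\<omega>. ennreal (\<bar>X j \<omega>\<bar> ^ 3 * exp (\<bar>X j \<omega>\<bar> / \<tau>)) \<partial>M) \<le> ennreal \<tau>" if "1 \<le> j" for j
    using that by (intro order_trans[OF SUP_upper assms(6)]) simp
  have meas: "cosine_sum X n k \<in> borel_measurable M" for n k
  proof -
    have [measurable]: "X j \<in> borel_measurable M" if "j \<in> {1..n}" for j
      using assms(2) that by (auto simp: indep_vars_def)
    show ?thesis unfolding cosine_sum_def[abs_def] by measurable
  qed
  have r_top: "filterlim (\<lambda>n. real (r n)) at_top sequentially"
  proof (rule filterlim_at_top_mono)
    show "filterlim (\<lambda>n. ln (real n)) at_top sequentially"
      by (rule filterlim_compose[OF ln_at_top filterlim_real_sequentially])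
    have "\<forall>\<^sub>F n in sequentially. ln (real n) / real (r n) < 1" by (rule order_tendstoD(2)[OF assms(9)]) simp
    then show "\<forall>\<^sub>F n in sequentially. ln (real n) \<le> real (r n)"
      using eventually_ge_at_top[of "1::nat"]
    proof eventually_elim
      case (elim n)
      then show ?case using assms(7)[of n] by (simp add: field_simps)
    qed
  qed
  interpret L: gaussian_exp_moments M "\<lambda>n k. cosine_sum X n k" r
    by (unfold_locales, rule meas, rule r_top)
      (rule exp_cosine_sum_asymptotics[OF assms(2-5) third assms(7,8)])
  have "L.\<mu> = \<mu>" by (simp add: L.\<mu>_def \<mu>_def fun_eq_iff)
  then show ?thesis using L.lower_bound L.upper_bound by simp
qed

end
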